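(* Let $d\geq 1$ and let $\mathcal{P}$ be a simplex in $\mathbb{R}^{d}$ with vertices $\mathbf{0},\mathbf{m}_{1},\ldots,\mathbf{m}_{d}\in\mathbb{Z}^{d}$, and let $M$ be the nonsingular $d\times d$ integer matrix with columns $\mathbf{m}_{1},\ldots,\mathbf{m}_{d}$, which maps the standard simplex $S_d$ onto $\mathcal{P}$. Let $w\in\mathbb{N}=\{0,1,2,\dots\}$, let $q\in C^{w+1}(\mathbb{R}^{d})$, and for $\tau>0$ let $q_{\tau,M}(x)=q(\tau Mx)$. For every $x\in\mathbb{R}^{d}$ and every $\tau>0$ write $$\sum_{n\in\mathbb{Z}^{d}}\omega_{\tau\mathcal{P}}(x+n)q(x+n)=|\det M|\sum_{V\in\{1,2\}^{d}}\ \sum_{I\in\{0,1\}^{d}}\ \sum_{|J|\leqslant w,\ J\sqsubseteq I}\tau^{d-|I|-|J|}\left\langle \mu(V,I,J),q_{\tau,M}\right\rangle \mathfrak{B}_{J+I,(MD_{V})^{t}}(x-\tau M\lambda_{V})+\mathcal{R}_{w}(x).$$ Then for every $\delta>0$ and every $\tau_{0}>0$ there exists a constant $c$, depending on $\delta$ and $\tau_{0}$ (and the dimension $d$) but independent of $q$, $M$ and $w$, such that for every $\tau>\tau_{0}$ and every $x\in\mathbb{R}^d$ $$\left\vert \mathcal{R}_{w}(x)\right\vert \leqslant c\,|\det M|\,\tau^{d-w-1}(2^{d-2}\pi^{-1}+\delta)^{w+1}\sup_{w-d+2\leqslant|\alpha|\leqslant w+1}\ \sup_{y\in S_{d}}\left\vert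 \frac{\partial^{\alpha}q_{\tau,M}}{\partial x^{\alpha}}(y)\right\vert ,$$ where $\alpha$ ranges over multi-indices of non-negative integers.
   Context: Standard simplex: $S_d=\{x\in\mathbb{R}^d: x_j\ge 0,\ \sum_{j=1}^d x_j\le 1\}$. For a multi-index, $|J|=j_1+\dots+j_d$. For $I\in\{0,1\}^d$ and a multi-index $J$ of non-negative integers, $J\sqsubseteq I$ means $j_k=0$ whenever $i_k=0$. $L^t$ is the transpose and $\mathbf 1_m=(1,\dots,1)\in\mathbb{R}^m$. Solid angle: $\omega_{A}(x)=\lim_{\varepsilon\to0+}\frac{1}{|\{|y|\le1\}|}\int_{|y|\le1}\chi_{A}(x-\varepsilon y)\,dy$ (the limit exists for every $x$ when $A$ is a convex polytope). Bernoulli polynomials: $\{B_n\}_{n\in\mathbb{N}}$ are the $1$-periodic functions on $\mathbb{R}$ defined on $(0,1)$ by $B_0=1$, $B_{n+1}'=B_n$, $\int_0^1B_{n+1}=0$, with value at integers $B_n(x)=\lim_{\varepsilon\to0+}\frac{B_n(x+\varepsilon)+B_n(x-\varepsilon)}2$. For a multi-index $J=(j_1,\dots,j_d)$ of non-negative integers, $B_J(x)=B_{j_1}(x_1)\cdots B_{j_d}(x_d)$ if $0\le x_k<1$ for all $k$, and $B_J(x)=0$ otherwise. For a nonsingular integer matrix $L$, $B_{J,L}(x)=|\det L|^{-1}B_J((L^{-1})^tx)$ and $\mathfrak{B}_{J,L}(x)=\sum_{n\in\mathbb{Z}^d}B_{J,L}(x+n)$, where at points of discontinuity $\mathfrak B_{J,L}$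 is regularized so that $\mathfrak{B}_{J,L}(x)=\lim_{\varepsilon\to0+}\frac1{|\{|y|\le1\}|}\int_{|y|\le1}\mathfrak{B}_{J,L}(x-\varepsilon y)\,dy$. Bases: for each $d\ge1$, $\mathcal{F}^{(d)}$ is a collection of $2^{d-1}$ ordered bases of $\mathbb{R}^d$ indexed by $(v_2,\dots,v_d)\in\{1,2\}^{d-1}$, defined recursively. For $d=1$ the only basis is $\{1\}$. For $d\ge2$, let $\{b_1',\dots,b_{d-1}'\}\in\mathcal F^{(d-1)}$ be the basis with index $(v_2,\dots,v_{d-1})$; the basis $\{b_1,\dots,b_d\}$ with index $(v_2,\dots,v_d)$ has $b_d=(0,\dots,0,1)$ and, for $1\le k\le d-1$, $b_k=(b_k',0)$ if $v_d=1$, $b_k=(b_k',-b_k'\cdot\mathbf 1_{d-1})$ if $v_d=2$. For $V=(v_1,\dots,v_d)\in\{1,2\}^d$, $\mathcal B_V$ is the basis with index $(v_2,\dots,v_d)$, and $D_V=[b_1|\cdots|b_d]$ is the matrix whose columns are the vectors of $\mathcal B_V$. Vectors $\lambda_V\in\mathbb{R}^d$: for $d=1$, $\lambda_1=0$, $\lambda_2=1$. For $d\ge2$, with $V'=(v_1,\dots,v_{d-1})$: $\lambda_V=(\lambda_{V'},0)$ if $v_d=1$, and $\lambda_V=(\lambda_{V'},1-\lambda_{V'}\cdot\mathbf 1_{d-1})$ if $v_d=2$. Functionals $\mu(V,I,J)$ (for $V\in\{1,2\}^d$, $I\in\{0,1\}^d$, $J\sqsubseteq I$): $\mu(V,I,J)=T_1^{v_1,i_1,j_1}T_2^{v_2,i_2,j_2}\cdots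 T_d^{v_d,i_d,j_d}$ (composition, $T_d$ applied first), where $T_h^{v,i,j}$ maps (sufficiently smooth) functions on $\mathbb{R}^h$ to functions on $\mathbb{R}^{h-1}$ (to numbers if $h=1$). For $h=1$: $T_1^{1,0,0}g=\int_0^1g(x_1)dx_1$, $T_1^{2,0,0}g=0$, $T_1^{1,1,j}g=-g^{(j)}(0)$, $T_1^{2,1,j}g=g^{(j)}(1)$. For $h\ge2$ and $x'\in\mathbb{R}^{h-1}$: $T_h^{1,0,0}g(x')=\int_0^{1-x'\cdot\mathbf 1_{h-1}}g(x',x_h)dx_h$, $T_h^{2,0,0}g(x')=0$, $T_h^{1,1,j}g(x')=-\frac{\partial^jg}{\partial x_h^j}(x',0)$, $T_h^{2,1,j}g(x')=\frac{\partial^jg}{\partial x_h^j}(x',1-x'\cdot\mathbf 1_{h-1})$. $\langle\mu(V,I,J),g\rangle$ is the resulting number. *)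

theory Defs
  imports "HOL-Analysis.Analysis" "Jordan_Normal_Form.Gauss_Jordan_Elimination"
    "Jordan_Normal_Form.Determinant"
begin

unbundle no vec_syntax
hide_const (open) Finite_Cartesian_Product.vec Finite_Cartesian_Product.row
  Finite_Cartesian_Product.column Finite_Cartesian_Product.mat
  Finite_Cartesian_Product.transpose Determinants.det
hide_type (open) Finite_Cartesian_Product.vec

text \<open>
  Points of \<open>\<real>\<^sup>d\<close> are the elements of \<open>carrier_vec d :: real vec set\<close>, so that \<open>d\<close> can be an
  ordinary natural number. Coordinates are numbered from \<open>0\<close>: the coordinate \<open>k\<close> below is the
  coordinate \<open>k + 1\<close> of the usual numbering. All functions on \<open>\<real>\<^sup>d\<close> are total functions on
  \<open>real vec\<close>, of which only the values on \<open>carrier_vec d\<close> matter. Multi-indices are extensional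
  functions on \<open>{..<d}\<close>.
\<close>

definition vsnoc :: "real vec \<Rightarrow> real \<Rightarrow> real vec" where
  "vsnoc x t = x @\<^sub>v vec_of_list [t]"

definition vec_total :: "real vec \<Rightarrow> real" where
  "vec_total x = (\<Sum>k<dim_vec x. x $ k)"

definition std_simplex :: "nat \<Rightarrow> real vec set" where
  "std_simplex d = {x \<in> carrier_vec d. (\<forall>k<d. 0 \<le> x $ k) \<and> vec_total x \<le> 1}"

text \<open>The type \<open>real vec\<close> contains vectors of every dimension and is no vector space, so the
  library's \<open>convex hull\<close> does not apply to it.\<close>

definition convex_vec :: "nat \<Rightarrow> real vec set \<Rightarrow> bool" where
  "convex_vec d A \<longleftrightarrow> A \<subseteq> carrier_vec d \<and>
     (\<forall>x\<in>A. \<forall>y\<in>A. \<forall>u\<ge>0. \<forall>v\<ge>0. u + v = 1 \<longrightarrow> u \<cdot>\<^sub>v x + v \<cdot>\<^sub>v y \<in> A)"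

definition lattice_simplex :: "nat \<Rightarrow> int mat \<Rightarrow> real vec set" where
  "lattice_simplex d M =
     convex_vec d hull (insert (0\<^sub>v d) (map_vec real_of_int ` set (cols M)))"

abbreviation multi_indices :: "nat \<Rightarrow> (nat \<Rightarrow> nat) set" where
  "multi_indices d \<equiv> {..<d} \<rightarrow>\<^sub>E UNIV"

definition msize :: "nat \<Rightarrow> (nat \<Rightarrow> nat) \<Rightarrow> nat" where
  "msize d J = (\<Sum>k<d. J k)"

definition subindex :: "nat \<Rightarrow> (nat \<Rightarrow> nat) \<Rightarrow> (nat \<Rightarrow> nat) \<Rightarrow> bool" where
  "subindex d J I \<longleftrightarrow> (\<forall>k<d. I k = 0 \<longrightarrow> J k = 0)"


subsection \<open>Partial derivatives and smoothness\<close>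

definition partial :: "nat \<Rightarrow> (real vec \<Rightarrow> real) \<Rightarrow> real vec \<Rightarrow> real" where
  "partial k f x = deriv (\<lambda>t. f (x + t \<cdot>\<^sub>v unit_vec (dim_vec x) k)) 0"

primrec mixed_partial :: "nat \<Rightarrow> (nat \<Rightarrow> nat) \<Rightarrow> (real vec \<Rightarrow> real) \<Rightarrow> real vec \<Rightarrow> real" where
  "mixed_partial 0 \<alpha> f = f"
| "mixed_partial (Suc n) \<alpha> f = mixed_partial n \<alpha> ((partial n ^^ \<alpha> n) f)"

text \<open>\<open>vec d y\<close> only depends on the first \<open>d\<close> values of \<open>y\<close>, hence continuity for the product
  topology on \<open>nat \<Rightarrow> real\<close> is continuity on \<open>\<real>\<^sup>d\<close>.\<close>

definition continuous_vec :: "nat \<Rightarrow> (real vec \<Rightarrow> real) \<Rightarrow> bool" where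
  "continuous_vec d f \<longleftrightarrow> continuous_on UNIV (\<lambda>y :: nat \<Rightarrow> real. f (vec d y))"

primrec C_k_vec :: "nat \<Rightarrow> nat \<Rightarrow> (real vec \<Rightarrow> real) \<Rightarrow> bool" where
  "C_k_vec d 0 f \<longleftrightarrow> continuous_vec d f"
| "C_k_vec d (Suc m) f \<longleftrightarrow> continuous_vec d f \<and>
     (\<forall>k<d. (\<forall>x\<in>carrier_vec d. (\<lambda>t. f (x + t \<cdot>\<^sub>v unit_vec d k)) differentiable at 0) \<and>
            C_k_vec d m (partial k f))"


subsection \<open>Averages over small balls and the solid angle\<close>

abbreviation lebesgue_prod :: "nat \<Rightarrow> (nat \<Rightarrow> real) measure" where
  "lebesgue_prod d \<equiv> Pi\<^sub>M {..<d} (\<lambda>_. lborel)"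

definition euclidean_unit_ball :: "nat \<Rightarrow> (nat \<Rightarrow> real) set" where
  "euclidean_unit_ball d = {y \<in> {..<d} \<rightarrow>\<^sub>E UNIV. (\<Sum>k<d. (y k)\<^sup>2) \<le> 1}"

definition ball_mean :: "nat \<Rightarrow> (real vec \<Rightarrow> real) \<Rightarrow> real vec \<Rightarrow> real \<Rightarrow> real" where
  "ball_mean d f x \<epsilon> =
     1 / measure (lebesgue_prod d) (euclidean_unit_ball d) *
     (LINT y:euclidean_unit_ball d|lebesgue_prod d. f (x - \<epsilon> \<cdot>\<^sub>v vec d y))"

definition regularize :: "nat \<Rightarrow> (real vec \<Rightarrow> real) \<Rightarrow> real vec \<Rightarrow> real" where
  "regularize d f x = Lim (at_right 0) (ball_mean d f x)"

definition solid_angle :: "nat \<Rightarrow> real vec set \<Rightarrow> real vec \<Rightarrow> real" where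
  "solid_angle d A = regularize d (indicat_real A)"


subsection \<open>Bernoulli functions\<close>

text \<open>The normalization is \<open>B\<^sub>n\<^sub>+\<^sub>1' = B\<^sub>n\<close>, without a factor \<open>n + 1\<close>.\<close>

primrec bernoulli_poly :: "nat \<Rightarrow> real poly" where
  "bernoulli_poly 0 = 1"
| "bernoulli_poly (Suc n) =
     (THE p. pderiv p = bernoulli_poly n \<and> integral {0..1} (poly p) = 0)"

definition bernoulli_fun :: "nat \<Rightarrow> real \<Rightarrow> real" where
  "bernoulli_fun n x =
     (let F = (\<lambda>t. poly (bernoulli_poly n) (frac t)) in
      if x \<in> \<int> then Lim (at_right 0) (\<lambda>\<epsilon>. (F (x + \<epsilon>) + F (x - \<epsilon>)) / 2) else F x)"

definition bernoulli_multi :: "nat \<Rightarrow> (nat \<Rightarrow> nat) \<Rightarrow> real vec \<Rightarrow> real" where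
  "bernoulli_multi d J x =
     (if \<forall>k<d. 0 \<le> x $ k \<and> x $ k < 1 then \<Prod>k<d. bernoulli_fun (J k) (x $ k) else 0)"

definition bernoulli_L :: "nat \<Rightarrow> (nat \<Rightarrow> nat) \<Rightarrow> real mat \<Rightarrow> real vec \<Rightarrow> real" where
  "bernoulli_L d J L x =
     inverse \<bar>det L\<bar> * bernoulli_multi d J (transpose_mat (the (mat_inverse L)) *\<^sub>v x)"

text \<open>Regularizing at every point, and not only at the discontinuities, changes nothing: at a
  point of continuity the limit of the averages is the value of the function.\<close>

definition bernoulli_periodic :: "nat \<Rightarrow> (nat \<Rightarrow> nat) \<Rightarrow> real mat \<Rightarrow> real vec \<Rightarrow> real" where
  "bernoulli_periodic d J L =
     regularize d (\<lambda>x. \<Sum>\<^sub>\<infinity>n\<in>carrier_vec d. bernoulli_L d J L (x + map_vec real_of_int n))"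


subsection \<open>The bases, the vectors \<open>\<lambda>\<^sub>V\<close> and the functionals \<open>\<mu>(V,I,J)\<close>\<close>

text \<open>The recursions start in dimension \<open>0\<close>; their step from \<open>0\<close> to \<open>1\<close> gives the basis \<open>{1}\<close>
  of \<open>\<real>\<close>, the values \<open>\<lambda>\<^sub>1 = 0\<close>, \<open>\<lambda>\<^sub>2 = 1\<close>, and the functionals \<open>T\<^sub>1\<close>. The entry \<open>V 0\<close> does not
  influence the basis.\<close>

primrec basis_V :: "nat \<Rightarrow> (nat \<Rightarrow> nat) \<Rightarrow> real vec list" where
  "basis_V 0 V = []"
| "basis_V (Suc n) V =
     map (\<lambda>b. vsnoc b (if V n = 1 then 0 else - vec_total b)) (basis_V n V)
     @ [unit_vec (Suc n) n]"

definition D_V :: "nat \<Rightarrow> (nat \<Rightarrow> nat) \<Rightarrow> real mat" where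
  "D_V d V = mat_of_cols d (basis_V d V)"

primrec lambda_V :: "nat \<Rightarrow> (nat \<Rightarrow> nat) \<Rightarrow> real vec" where
  "lambda_V 0 V = vNil"
| "lambda_V (Suc n) V =
     vsnoc (lambda_V n V) (if V n = 1 then 0 else 1 - vec_total (lambda_V n V))"

text \<open>The integral is the oriented one. This matters: \<open>T_op\<close> in a lower dimension differentiates
  the result across the hyperplane where \<open>1 - vec_total x'\<close> changes sign.\<close>

definition T_op ::
  "nat \<Rightarrow> nat \<Rightarrow> nat \<Rightarrow> (real vec \<Rightarrow> real) \<Rightarrow> real vec \<Rightarrow> real" where
  "T_op v i j g x' =
     (let s = 1 - vec_total x'; h = (\<lambda>t. g (vsnoc x' t)) in
      if i = 0 then (if v = 1 then (LBINT t=0..s. h t) else 0)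
      else (if v = 1 then - (deriv ^^ j) h 0 else (deriv ^^ j) h s))"

primrec mu ::
  "nat \<Rightarrow> (nat \<Rightarrow> nat) \<Rightarrow> (nat \<Rightarrow> nat) \<Rightarrow> (nat \<Rightarrow> nat) \<Rightarrow> (real vec \<Rightarrow> real) \<Rightarrow> real" where
  "mu 0 V I J g = g vNil"
| "mu (Suc n) V I J g = mu n V I J (T_op (V n) (I n) (J n) g)"


subsection \<open>The remainder of the Euler--Maclaurin expansion\<close>

definition dilated :: "(real vec \<Rightarrow> real) \<Rightarrow> real \<Rightarrow> int mat \<Rightarrow> real vec \<Rightarrow> real" where
  "dilated q \<tau> M x = q (\<tau> \<cdot>\<^sub>v (map_mat real_of_int M *\<^sub>v x))"

definition weighted_sum ::
  "nat \<Rightarrow> real vec set \<Rightarrow> (real vec \<Rightarrow> real) \<Rightarrow> real vec \<Rightarrow> real" where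
  "weighted_sum d A q x =
     (\<Sum>\<^sub>\<infinity>n\<in>carrier_vec d. solid_angle d A (x + map_vec real_of_int n)
                              * q (x + map_vec real_of_int n))"

definition main_term ::
  "nat \<Rightarrow> int mat \<Rightarrow> nat \<Rightarrow> (real vec \<Rightarrow> real) \<Rightarrow> real \<Rightarrow> real vec \<Rightarrow> real" where
  "main_term d M w q \<tau> x = real_of_int \<bar>det M\<bar> *
     (\<Sum>V \<in> {..<d} \<rightarrow>\<^sub>E {1, 2}. \<Sum>I \<in> {..<d} \<rightarrow>\<^sub>E {0, 1}.
      \<Sum>J \<in> {J \<in> multi_indices d. msize d J \<le> w \<and> subindex d J I}.
        \<tau> powi (int d - int (msize d I) - int (msize d J)) * mu d V I J (dilated q \<tau> M) *
        bernoulli_periodic d (\<lambda>k. J k + I k)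
          (transpose_mat (map_mat real_of_int M * D_V d V))
          (x - \<tau> \<cdot>\<^sub>v (map_mat real_of_int M *\<^sub>v lambda_V d V)))"

definition remainder ::
  "nat \<Rightarrow> int mat \<Rightarrow> nat \<Rightarrow> (real vec \<Rightarrow> real) \<Rightarrow> real \<Rightarrow> real vec \<Rightarrow> real" where
  "remainder d M w q \<tau> x =
     weighted_sum d ((\<lambda>p. \<tau> \<cdot>\<^sub>v p) ` lattice_simplex d M) q x - main_term d M w q \<tau> x"

end

theory Submission
  imports Defs "HOL-Complex_Analysis.Complex_Analysis"
begin

text \<open>
  In dimension one the estimate is the classical Euler-Maclaurin formula: the sum of \<open>h(t)\<close> over the
  points \<open>t\<close> of \<open>[0, s]\<close> with \<open>\<tau> t - \<xi>\<close> an integer differs from the integral and the boundary terms of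
  order at most \<open>w\<close>, up to powers of \<open>\<tau>\<close>, by the integral of the derivative of order \<open>w + 1\<close> of \<open>h\<close> against
  a periodic Bernoulli function. The Bernoulli
  polynomials have the generating function \<open>exp (x z) z / (exp z - 1)\<close>, whose singularities closest to
  the origin are \<open>2 \<pi> i\<close> and \<open>-2 \<pi> i\<close>. Hence \<open>B\<^sub>n\<close> is at most a constant times \<open>\<rho>\<^sup>n\<close> on \<open>[0, 1]\<close>, for every
  \<open>\<rho> > 1 / (2 \<pi>)\<close> (\<open>bernoulli_poly_bound\<close>), and this is where the powers of \<open>1 / \<pi>\<close> come from.

  In dimension \<open>d\<close> the lattice points of the standard simplex are summed one coordinate at a time.
  Over a lattice point \<open>p\<close> of the simplex one dimension lower lies the segment of the points \<open>(p, t)\<close>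
  with \<open>0 \<le> t \<le> 1 - vec_total p\<close>, and one application of the one-dimensional formula replaces the sum over
  it by the functionals \<open>T\<close>, applied to the integrand at \<open>p\<close>. The upper end of the segment depends on
  \<open>p\<close>, but modulo integers it contributes only the phase \<open>x\<^sub>1 + \<dots> + x\<^sub>k - \<tau>\<close>, because \<open>\<tau> p - x\<close> is
  integral. So the Bernoulli factors come out of the sum over \<open>p\<close>, and induction on the dimension
  applies to the functions \<open>T g\<close> (\<open>em_bound\<close>). Restricting a function to the slanted face turns each
  derivative into a difference of two, which costs a factor \<open>2\<close> per derivative and dimension; the first
  coordinate costs nothing, so \<open>1 / (2 \<pi>)\<close> becomes \<open>2\<^sup>d\<^sup>-\<^sup>1 / (2 \<pi>) = 2\<^sup>d\<^sup>-\<^sup>2 / \<pi>\<close>. A power of \<open>w + 1\<close>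
  collected on the way is absorbed by \<open>\<delta>\<close>. Each integration in a \<open>T\<close> may swallow one derivative, and at
  most \<open>d - 1\<close> integrations precede the step in which an error arises; this explains the orders from
  \<open>w - d + 2\<close> to \<open>w + 1\<close>.

  For a general simplex the lattice \<open>\<int>\<^sup>d\<close> splits into at most \<open>\<bar>det M\<bar>\<close> classes modulo its sublattice
  \<open>M \<int>\<^sup>d\<close> (\<open>exists_lattice_transversal\<close>). The translates of \<open>x\<close> by one class are the image under \<open>M\<close> of a
  shifted copy of \<open>\<int>\<^sup>d\<close>, so those in \<open>\<tau> P\<close> correspond to lattice points of the standard simplex; and in each
  class exactly one translate of \<open>x\<close> falls into the half-open cell on which \<open>B_{J,L}\<close> lives. Both sides
  therefore become sums over the classes of the corresponding expressions for the standard simplex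
  (\<open>weighted_lattice_sum\<close>, \<open>bernoulli_lattice_sum\<close>), with one error bound per class.

  All this presupposes that the point \<open>x\<close> is generic: no coordinate and no phase is an integer. Both
  sides of the expansion are limits of averages over small balls around \<open>x\<close>, and almost every point of
  such a ball is generic. The indicator of the simplex and the Bernoulli functions are bounded and have
  limits along every ray, so these averages converge, and the estimate at generic points passes to every \<open>x\<close> (\<open>remainder_bound\<close>).
\<close>

text \<open>Below, \<open>$\<close> is the entry of a vector of arbitrary dimension, and neither the component of an
  element of \<open>real ^ 'n\<close> nor the coefficient of a power series.\<close>

unbundle no vec_syntax
no_notation fps_nth (infixl "$" 75)
hide_const (open) Finite_Cartesian_Product.vec Finite_Cartesian_Product.row
  Finite_Cartesian_Product.column Finite_Cartesian_Product.mat
  Finite_Cartesian_Product.transpose Determinants.det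
hide_type (open) Finite_Cartesian_Product.vec

section \<open>Bernoulli polynomials and their growth\<close>

text \<open>
  The coefficients of \<open>z / (exp z - 1)\<close>, that is, the Bernoulli numbers divided by factorials. They are
  needed both over the reals, for the polynomials, and over the complex numbers, for the radius of
  convergence.
\<close>

definition bernoulli_coeffs :: "'a :: {field_char_0} fps" where
  "bernoulli_coeffs = inverse (fps_shift 1 (fps_exp 1))"

definition bernoulli_sum :: "nat \<Rightarrow> real poly" where
  "bernoulli_sum n = (\<Sum>k\<le>n. monom (fps_nth bernoulli_coeffs (n - k) / fact k) k)"

lemma bernoulli_coeffs_convolution:
  "(\<Sum>i\<le>n. fps_nth bernoulli_coeffs i / fact (Suc n - i)) = (if n = 0 then 1 else (0 :: 'a :: field_char_0))"
proof -
  have "bernoulli_coeffs * fps_shift 1 (fps_exp 1) = (1 :: 'a fps)"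
    unfolding bernoulli_coeffs_def by (rule inverse_mult_eq_1) simp
  hence "fps_nth (bernoulli_coeffs * fps_shift 1 (fps_exp 1)) n = (if n = 0 then 1 else (0 :: 'a))"
    by simp
  thus ?thesis
    by (simp add: fps_mult_nth atLeast0AtMost field_simps Suc_diff_le del: fact_Suc)
qed

lemma coeff_bernoulli_sum:
  "coeff (bernoulli_sum n) m = (if m \<le> n then fps_nth bernoulli_coeffs (n - m) / fact m else 0)"
  unfolding bernoulli_sum_def by (simp add: coeff_sum)

lemma poly_bernoulli_sum:
  "poly (bernoulli_sum n) x = (\<Sum>k\<le>n. fps_nth bernoulli_coeffs k * x ^ (n - k) / fact (n - k))"
proof -
  have "poly (bernoulli_sum n) x = (\<Sum>k\<le>n. fps_nth bernoulli_coeffs (n - k) * x ^ k / fact k)"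
    unfolding bernoulli_sum_def by (simp add: poly_sum poly_monom)
  also have "\<dots> = (\<Sum>k\<le>n. fps_nth bernoulli_coeffs k * x ^ (n - k) / fact (n - k))"
    by (rule sum.reindex_bij_witness[of _ "\<lambda>k. n - k" "\<lambda>k. n - k"]) auto
  finally show ?thesis .
qed

lemma pderiv_bernoulli_sum: "pderiv (bernoulli_sum (Suc n)) = bernoulli_sum n"
proof (rule poly_eqI)
  fix m
  have "of_nat (Suc m) / fact (Suc m) = (1 / fact m :: real)"
    by (simp add: fact_Suc divide_simps del: of_nat_Suc)
  thus "coeff (pderiv (bernoulli_sum (Suc n))) m = coeff (bernoulli_sum n) m"
    by (simp add: coeff_pderiv coeff_bernoulli_sum divide_simps del: of_nat_Suc fact_Suc)
qed

lemma poly_integral_FTC: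
  fixes p :: "real poly"
  shows "(poly (pderiv p) has_integral poly p 1 - poly p 0) {0..1}"
  by (rule fundamental_theorem_of_calculus)
     (auto simp flip: has_real_derivative_iff_has_vector_derivative
           intro: DERIV_subset[OF poly_DERIV])

lemma poly_bernoulli_sum_ends:
  assumes "n > 0"
  shows "poly (bernoulli_sum (Suc n)) 1 = poly (bernoulli_sum (Suc n)) 0"
proof -
  have "poly (bernoulli_sum (Suc n)) 0 = fps_nth bernoulli_coeffs (Suc n)"
    unfolding poly_bernoulli_sum
    by (subst sum.remove[of _ "Suc n"]) (auto intro!: sum.neutral)
  moreover have "poly (bernoulli_sum (Suc n)) 1 =
      fps_nth bernoulli_coeffs (Suc n) + (\<Sum>k\<le>n. fps_nth bernoulli_coeffs k / fact (Suc n - k))"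
    unfolding poly_bernoulli_sum by (subst sum.atMost_Suc) simp
  ultimately show ?thesis
    using assms by (simp only: bernoulli_coeffs_convolution) simp
qed

lemma bernoulli_poly_eq: "bernoulli_poly n = bernoulli_sum n"
proof (induction n)
  case 0
  have "fps_nth bernoulli_coeffs 0 = (1::real)"
    using bernoulli_coeffs_convolution[of 0, where 'a=real] by simp
  then show ?case
    by (simp add: bernoulli_sum_def monom_0 one_pCons)
next
  case (Suc n)
  have int: "integral {0..1} (poly (bernoulli_sum (Suc n))) = 0"
    using poly_integral_FTC[of "bernoulli_sum (Suc (Suc n))"] poly_bernoulli_sum_ends[of "Suc n"]
    by (simp add: pderiv_bernoulli_sum has_integral_integrable_integral)
  have "(THE p. pderiv p = bernoulli_sum n \<and> integral {0..1} (poly p) = 0) = bernoulli_sum (Suc n)"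
  proof (rule the_equality)
    show "pderiv (bernoulli_sum (Suc n)) = bernoulli_sum n \<and> integral {0..1} (poly (bernoulli_sum (Suc n))) = 0"
      using int pderiv_bernoulli_sum by simp
  next
    \<comment> \<open>The primitive is determined up to a constant, and the vanishing mean fixes the constant.\<close>
    fix p assume p: "pderiv p = bernoulli_sum n \<and> integral {0..1} (poly p) = (0::real)"
    hence "pderiv (p - bernoulli_sum (Suc n)) = 0"
      by (simp add: pderiv_diff pderiv_bernoulli_sum)
    then obtain c where c: "p - bernoulli_sum (Suc n) = [:c:]"
      using pderiv_iszero by blast
    hence pe: "poly p = (\<lambda>x. poly (bernoulli_sum (Suc n)) x + c)"
    proof (intro ext)
      fix x
      have "poly (p - bernoulli_sum (Suc n)) x = c" by (simp add: c)
      thus "poly p x = poly (bernoulli_sum (Suc n)) x + c" by (simp del: poly_diff add: poly_diff)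
    qed
    have "integral {0..1} (poly p) = integral {0..1} (poly (bernoulli_sum (Suc n))) + integral {0..1} (\<lambda>x::real. c)"
      unfolding pe by (rule integral_add) (auto intro!: integrable_continuous_real continuous_intros)
    hence "c = 0" using p int by simp
    thus "p = bernoulli_sum (Suc n)" using c by simp
  qed
  thus ?case by (simp add: Suc)
qed

lemma bernoulli_coeffs_of_real:
  "fps_nth (bernoulli_coeffs :: complex fps) n = of_real (fps_nth bernoulli_coeffs n)"
proof -
  define f :: "complex fps" where "f = Abs_fps (\<lambda>n. of_real (fps_nth bernoulli_coeffs n))"
  have "fps_shift 1 (fps_exp 1) * f = 1"
  proof (rule fps_ext)
    fix n
    have "fps_nth (fps_shift 1 (fps_exp 1) * f) n = fps_nth (f * fps_shift 1 (fps_exp 1)) n"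
      by (subst mult.commute) (rule refl)
    also have "\<dots> = of_real (\<Sum>i\<le>n. fps_nth bernoulli_coeffs i / fact (Suc n - i))"
      by (subst fps_mult_nth) (simp add: atLeast0AtMost Suc_diff_le f_def del: fact_Suc)
    also have "\<dots> = fps_nth 1 n"
      by (simp only: bernoulli_coeffs_convolution) simp
    finally show "fps_nth (fps_shift 1 (fps_exp 1) * f) n = fps_nth 1 n" .
  qed
  hence "f = bernoulli_coeffs"
    unfolding bernoulli_coeffs_def by (metis fps_inverse_unique)
  thus ?thesis by (metis f_def fps_nth_Abs_fps)
qed

text \<open>
  The function \<open>(exp z - 1) / z\<close> is entire, and its zeros are the nonzero multiples of \<open>2 \<pi> i\<close>.
\<close>

lemma bernoulli_coeffs_conv_radius:
  "fps_conv_radius (bernoulli_coeffs :: complex fps) \<ge> 2 * pi"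
proof -
  define f :: "complex fps" where "f = fps_shift 1 (fps_exp 1)"
  have f': "f = fps_shift 1 (fps_exp 1 - 1)"
    by (rule fps_ext) (simp add: f_def)
  have sub: "subdegree (fps_exp 1 - 1 :: complex fps) \<ge> 1"
  proof (rule subdegree_geI)
    show "fps_exp 1 - 1 \<noteq> (0 :: complex fps)"
    proof
      assume "fps_exp 1 - 1 = (0 :: complex fps)"
      hence "fps_nth (fps_exp 1 - 1 :: complex fps) 1 = 0" by simp
      thus False by simp
    qed
  qed simp
  have rad1: "fps_conv_radius (fps_exp 1 - 1 :: complex fps) = \<infinity>"
  proof -
    have "fps_conv_radius (fps_exp 1 - 1 :: complex fps) \<ge> min (fps_conv_radius (fps_exp 1 :: complex fps)) (fps_conv_radius (1 :: complex fps))"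
      by (rule fps_conv_radius_diff)
    thus ?thesis by simp
  qed
  have rad: "fps_conv_radius f = \<infinity>" unfolding f_def by simp
  have ev: "eval_fps f z = (if z = 0 then 1 else (exp z - 1) / z)" for z
    unfolding f' using sub rad1 by (subst eval_fps_shift) (auto simp: eval_fps_diff)
  have nz: "eval_fps f z \<noteq> 0" if "norm z < 2 * pi" for z
  proof (cases "z = 0")
    case False
    show ?thesis
    proof
      assume "eval_fps f z = 0"
      hence "exp z = 1" using False by (simp add: ev)
      then obtain n :: int where n: "Re z = 0" "Im z = of_int (2 * n) * pi" by (auto simp: exp_eq_1)
      hence "norm z = 2 * \<bar>of_int n\<bar> * pi" by (simp add: cmod_def abs_mult)
      moreover have "n \<noteq> 0" using n False by (auto simp: complex_eq_iff)
      hence "\<bar>of_int n :: real\<bar> \<ge> 1" by linarith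
      ultimately have "norm z \<ge> 2 * pi" by simp
      thus False using that by simp
    qed
  qed (simp add: ev)
  have "fps_conv_radius (inverse f) \<ge> min (2 * pi) (fps_conv_radius f)"
    by (rule fps_conv_radius_inverse) (use nz in \<open>auto simp: eball_def\<close>)
  thus ?thesis using rad by (simp add: bernoulli_coeffs_def f_def)
qed

lemma bernoulli_coeffs_bound:
  assumes "0 < r" "r < 2 * pi"
  shows "\<exists>A>0. \<forall>n. \<bar>fps_nth bernoulli_coeffs n\<bar> \<le> A * (1 / r) ^ n"
proof -
  have "ereal (norm (of_real r :: complex)) < fps_conv_radius (bernoulli_coeffs :: complex fps)"
    using assms by (intro less_le_trans[OF _ bernoulli_coeffs_conv_radius]) auto
  hence "summable (\<lambda>n. fps_nth (bernoulli_coeffs :: complex fps) n * of_real r ^ n)"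
    by (rule summable_fps)
  hence "Bseq (\<lambda>n. fps_nth (bernoulli_coeffs :: complex fps) n * of_real r ^ n)"
    by (intro convergent_imp_Bseq summable_LIMSEQ_zero[THEN convergentI])
  then obtain A where A: "A > 0" "\<And>n. norm (fps_nth (bernoulli_coeffs :: complex fps) n * of_real r ^ n) \<le> A"
    by (auto simp: Bseq_def)
  have "\<bar>fps_nth bernoulli_coeffs n\<bar> \<le> A * (1 / r) ^ n" for n
    using A(2)[of n] assms by (simp add: bernoulli_coeffs_of_real norm_mult norm_power field_simps)
  with A(1) show ?thesis by blast
qed

text \<open>
  The coefficients decay like \<open>r\<^sup>-\<^sup>n\<close> for each \<open>r < 2 \<pi>\<close>. Each \<open>B\<^sub>n\<close> is the convolution of them with the
  coefficients \<open>u\<^sup>k / k!\<close> of an exponential series, which costs only the constant factor \<open>exp r\<close>.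
\<close>

lemma bernoulli_poly_bound:
  assumes "\<rho> > 1 / (2 * pi)"
  shows "\<exists>A\<ge>1. \<forall>n. \<forall>u\<in>{0..1}. \<bar>poly (bernoulli_poly n) u\<bar> \<le> A * \<rho> ^ n"
proof -
  have rp: "\<rho> > 0" using assms by (smt (verit) divide_pos_pos pi_gt_zero)
  define r where "r = 1 / \<rho>"
  have r: "0 < r" "r < 2 * pi" using assms rp by (auto simp: r_def field_simps)
  obtain A where A: "A > 0" "\<And>n. \<bar>fps_nth bernoulli_coeffs n\<bar> \<le> A * (1 / r) ^ n"
    using bernoulli_coeffs_bound[OF r] by blast
  have "\<bar>poly (bernoulli_poly n) u\<bar> \<le> (1 + A * exp r) * \<rho> ^ n" if u: "u \<in> {0..1}" for n u
  proof -
    have "\<bar>poly (bernoulli_poly n) u\<bar> \<le> (\<Sum>k\<le>n. \<bar>fps_nth bernoulli_coeffs k * u ^ (n - k) / fact (n - k)\<bar>)"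
      unfolding bernoulli_poly_eq poly_bernoulli_sum by (rule sum_abs)
    also have "\<dots> \<le> (\<Sum>k\<le>n. (A * (1 / r) ^ n) * (r ^ (n - k) / fact (n - k)))"
    proof (rule sum_mono)
      fix k assume k: "k \<in> {..n}"
      have up: "\<bar>u ^ (n - k)\<bar> \<le> 1" using u by (auto simp: power_le_one abs_le_iff intro: order_trans[of _ 0])
      have "\<bar>fps_nth bernoulli_coeffs k\<bar> * \<bar>u ^ (n - k)\<bar> \<le> (A * (1 / r) ^ k) * 1"
        by (rule mult_mono) (use A up r in auto)
      also have "\<dots> = (A * (1 / r) ^ n) * r ^ (n - k)"
        using k r by (simp add: field_simps flip: power_add)
      finally have "\<bar>fps_nth bernoulli_coeffs k\<bar> * \<bar>u ^ (n - k)\<bar> / fact (n - k) \<le> (A * (1 / r) ^ n) * r ^ (n - k) / fact (n - k)"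
        by (rule divide_right_mono) simp
      thus "\<bar>fps_nth bernoulli_coeffs k * u ^ (n - k) / fact (n - k)\<bar> \<le> (A * (1 / r) ^ n) * (r ^ (n - k) / fact (n - k))"
        by (simp add: abs_mult)
    qed
    also have "\<dots> = (A * (1 / r) ^ n) * (\<Sum>k\<le>n. r ^ (n - k) / fact (n - k))"
      by (simp add: sum_distrib_left)
    also have "(\<Sum>k\<le>n. r ^ (n - k) / fact (n - k)) = (\<Sum>k\<le>n. r ^ k / fact k)"
      by (rule sum.reindex_bij_witness[of _ "\<lambda>k. n - k" "\<lambda>k. n - k"]) auto
    also have "\<dots> \<le> exp r"
    proof -
      have "(\<lambda>k. r ^ k /\<^sub>R fact k) sums exp r" by (rule exp_converges)
      hence "sum (\<lambda>k. r ^ k /\<^sub>R fact k) {..n} \<le> exp r"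
        using r sum_le_suminf[of "\<lambda>k. r ^ k /\<^sub>R fact k" "{..n}"] by (auto simp: sums_iff)
      thus ?thesis by (simp add: divide_inverse mult.commute)
    qed
    finally have "\<bar>poly (bernoulli_poly n) u\<bar> \<le> A * exp r * \<rho> ^ n"
      using A(1) r by (simp add: r_def field_simps mult_left_mono)
    also have "\<dots> \<le> (1 + A * exp r) * \<rho> ^ n" using rp by (simp add: algebra_simps)
    finally show ?thesis .
  qed
  moreover have "1 + A * exp r \<ge> 1" using A by simp
  ultimately show ?thesis by blast
qed

lemma bernoulli_fun_nonint: "x \<notin> \<int> \<Longrightarrow> bernoulli_fun n x = poly (bernoulli_poly n) (frac x)"
  by (simp add: bernoulli_fun_def Let_def)

lemma bernoulli_fun_int:
  assumes "x \<in> \<int>"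
  shows "bernoulli_fun n x = (poly (bernoulli_poly n) 0 + poly (bernoulli_poly n) 1) / 2"
proof -
  define F where "F = (\<lambda>t. poly (bernoulli_poly n) (frac t))"
  obtain k :: int where k: "x = of_int k" using assms by (auto elim: Ints_cases)
  have fr: "frac (x + \<epsilon>) = \<epsilon>" "frac (x - \<epsilon>) = 1 - \<epsilon>" if "\<epsilon> \<in> {0<..<1}" for \<epsilon>
    using that Ints_of_int[of k] Ints_of_int[of "k - 1"] unfolding k by (auto simp: frac_unique_iff)
  have ev: "eventually (\<lambda>\<epsilon>::real. \<epsilon> \<in> {0<..<1}) (at_right 0)"
    by (rule eventually_at_right_real) simp
  have "((\<lambda>\<epsilon>. (poly (bernoulli_poly n) \<epsilon> + poly (bernoulli_poly n) (1 - \<epsilon>)) / 2) \<longlongrightarrow>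
          (poly (bernoulli_poly n) 0 + poly (bernoulli_poly n) (1 - 0)) / 2) (at_right 0)"
    by (intro tendsto_intros) auto
  hence "((\<lambda>\<epsilon>. (F (x + \<epsilon>) + F (x - \<epsilon>)) / 2) \<longlongrightarrow>
          (poly (bernoulli_poly n) 0 + poly (bernoulli_poly n) 1) / 2) (at_right 0)"
    unfolding diff_zero
    by (rule Lim_transform_eventually) (use ev in \<open>auto elim!: eventually_mono simp: F_def fr\<close>)
  hence "Lim (at_right 0) (\<lambda>\<epsilon>. (F (x + \<epsilon>) + F (x - \<epsilon>)) / 2) = (poly (bernoulli_poly n) 0 + poly (bernoulli_poly n) 1) / 2"
    by (intro tendsto_Lim) auto
  thus ?thesis using assms by (simp add: bernoulli_fun_def Let_def F_def)
qed

lemma bernoulli_fun_0 [simp]: "bernoulli_fun 0 x = 1"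
  by (cases "x \<in> \<int>") (auto simp: bernoulli_fun_int bernoulli_fun_nonint)

lemma bernoulli_fun_add_Int:
  assumes "k \<in> \<int>"
  shows "bernoulli_fun n (x + k) = bernoulli_fun n x"
proof -
  obtain m :: int where m: "k = of_int m" using assms by (auto elim: Ints_cases)
  have "x + k \<in> \<int> \<longleftrightarrow> x \<in> \<int>" using assms by (metis Ints_add Ints_diff add_diff_cancel_right')
  moreover have "frac (x + k) = frac x" by (simp add: m frac_def)
  ultimately show ?thesis
    by (cases "x \<in> \<int>") (auto simp: bernoulli_fun_int bernoulli_fun_nonint)
qed

lemma bernoulli_fun_bound:
  assumes "\<forall>u\<in>{0..1}. \<bar>poly (bernoulli_poly n) u\<bar> \<le> B"
  shows "\<bar>bernoulli_fun n x\<bar> \<le> B"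
proof (cases "x \<in> \<int>")
  case True
  have "\<bar>poly (bernoulli_poly n) 0\<bar> \<le> B" "\<bar>poly (bernoulli_poly n) 1\<bar> \<le> B" using assms by auto
  then show ?thesis using True by (simp add: bernoulli_fun_int)
next
  case False
  have "frac x \<in> {0..1}" using frac_ge_0[of x] frac_lt_1[of x] by auto
  then show ?thesis using False assms by (simp add: bernoulli_fun_nonint)
qed

section \<open>Euler--Maclaurin summation on a segment\<close>

lemma deriv_poly_bernoulli:
  "((\<lambda>u. poly (bernoulli_poly (Suc n)) u) has_real_derivative poly (bernoulli_poly n) u) (at u)"
  using poly_DERIV[of "bernoulli_poly (Suc n)" u] by (simp add: bernoulli_poly_eq pderiv_bernoulli_sum)

text \<open>
  This agrees with \<open>bernoulli_fun\<close> away from the integers. At integers it is continuous from the right,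
  so that the fundamental theorem of calculus applies to it without averaging the two one-sided limits.
\<close>

definition bernoulli_frac :: "nat \<Rightarrow> real \<Rightarrow> real" where
  "bernoulli_frac n u = poly (bernoulli_poly n) (frac u)"

lemma bernoulli_frac_deriv:
  assumes "u \<notin> \<int>"
  shows "(bernoulli_frac (Suc n) has_real_derivative bernoulli_frac n u) (at u)"
proof -
  have ev: "eventually (\<lambda>v. \<lfloor>v\<rfloor> = \<lfloor>u\<rfloor>) (nhds u)"
    by (rule eventually_floor_eq[OF filterlim_ident assms])
  have "((\<lambda>v. poly (bernoulli_poly (Suc n)) (v - of_int \<lfloor>u\<rfloor>)) has_real_derivative poly (bernoulli_poly n) (u - of_int \<lfloor>u\<rfloor>) * 1) (at u)"
    by (rule DERIV_chain2[OF deriv_poly_bernoulli]) (auto intro!: derivative_eq_intros)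
  moreover have "eventually (\<lambda>v. bernoulli_frac (Suc n) v = poly (bernoulli_poly (Suc n)) (v - of_int \<lfloor>u\<rfloor>)) (nhds u)"
    using ev by eventually_elim (simp add: bernoulli_frac_def frac_def)
  ultimately show ?thesis
    by (subst DERIV_cong_ev[OF refl _ refl]) (auto simp: bernoulli_frac_def frac_def)
qed

text \<open>
  From the second Bernoulli polynomial on, the values at \<open>0\<close> and \<open>1\<close> coincide, so that the periodic
  extension has no jumps. This is why only the first Bernoulli function sees the lattice points.
\<close>

lemma bernoulli_frac_continuous: "isCont (bernoulli_frac (Suc (Suc n))) u"
proof (cases "u \<in> \<int>")
  case False
  show ?thesis using bernoulli_frac_deriv[OF False] by (rule DERIV_isCont)
next
  case True
  then obtain k :: int where k: "u = of_int k" by (auto elim: Ints_cases)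
  let ?p = "poly (bernoulli_poly (Suc (Suc n)))"
  have ends: "?p 1 = ?p 0" using poly_bernoulli_sum_ends[of "Suc n"] by (simp only: bernoulli_poly_eq zero_less_Suc simp_thms)
  have val: "bernoulli_frac (Suc (Suc n)) u = ?p 0" by (simp add: bernoulli_frac_def k)
  have "((\<lambda>v. ?p (v - of_int k)) \<longlongrightarrow> ?p (u - of_int k)) (at_right u)"
    by (intro tendsto_intros)
  moreover have "eventually (\<lambda>v. v \<in> {u<..<u+1}) (at_right u)"
    by (rule eventually_at_right_real) simp
  hence "eventually (\<lambda>v. ?p (v - of_int k) = bernoulli_frac (Suc (Suc n)) v) (at_right u)"
  proof eventually_elim
    case (elim v)
    hence "\<lfloor>v\<rfloor> = k" by (auto simp: k floor_eq_iff)
    thus ?case by (simp add: bernoulli_frac_def frac_def)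
  qed
  ultimately have R: "(bernoulli_frac (Suc (Suc n)) \<longlongrightarrow> bernoulli_frac (Suc (Suc n)) u) (at_right u)"
    unfolding val by (auto simp: k intro: Lim_transform_eventually)
  have "((\<lambda>v. ?p (v - of_int (k - 1))) \<longlongrightarrow> ?p (u - of_int (k - 1))) (at_left u)"
    by (intro tendsto_intros)
  moreover have "eventually (\<lambda>v. v \<in> {u-1<..<u}) (at_left u)"
    by (rule eventually_at_left_real) simp
  hence "eventually (\<lambda>v. ?p (v - of_int (k - 1)) = bernoulli_frac (Suc (Suc n)) v) (at_left u)"
  proof eventually_elim
    case (elim v)
    hence "\<lfloor>v\<rfloor> = k - 1" by (auto simp: k floor_eq_iff)
    thus ?case by (simp add: bernoulli_frac_def frac_def)
  qed
  ultimately have "(bernoulli_frac (Suc (Suc n)) \<longlongrightarrow> ?p (u - of_int (k - 1))) (at_left u)"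
    by (rule Lim_transform_eventually)
  moreover have "?p (u - of_int (k - 1)) = ?p 0" using ends by (simp add: k)
  ultimately have L: "(bernoulli_frac (Suc (Suc n)) \<longlongrightarrow> bernoulli_frac (Suc (Suc n)) u) (at_left u)"
    unfolding val by simp
  show ?thesis using L R by (simp add: isCont_def filterlim_split_at)
qed

text \<open>
  These are the parameters of the points of the lattice \<open>\<xi> + \<int>\<close> on the segment from \<open>0\<close> to \<open>\<tau> s\<close>.
\<close>

definition lattice_params :: "real \<Rightarrow> real \<Rightarrow> real \<Rightarrow> real set" where
  "lattice_params \<tau> \<xi> s = {t. 0 \<le> t \<and> t \<le> s \<and> \<tau> * t - \<xi> \<in> \<int>}"

lemma lattice_params_eq:
  assumes "\<tau> > 0"
  shows "lattice_params \<tau> \<xi> s = (\<lambda>m. (\<xi> + of_int m) / \<tau>) ` {\<lceil>-\<xi>\<rceil>..\<lfloor>\<tau> * s - \<xi>\<rfloor>}"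
proof (intro equalityI subsetI)
  fix t assume t: "t \<in> lattice_params \<tau> \<xi> s"
  then obtain m :: int where m: "\<tau> * t - \<xi> = of_int m" by (auto simp: lattice_params_def elim: Ints_cases)
  have "0 \<le> \<tau> * t" "\<tau> * t \<le> \<tau> * s" using t assms by (auto simp: lattice_params_def)
  hence "m \<in> {\<lceil>-\<xi>\<rceil>..\<lfloor>\<tau> * s - \<xi>\<rfloor>}" using m by (auto simp: ceiling_le_iff le_floor_iff)
  moreover have "t = (\<xi> + of_int m) / \<tau>" using m assms by (simp add: field_simps)
  ultimately show "t \<in> (\<lambda>m. (\<xi> + of_int m) / \<tau>) ` {\<lceil>-\<xi>\<rceil>..\<lfloor>\<tau> * s - \<xi>\<rfloor>}" by blast
next
  fix t assume "t \<in> (\<lambda>m. (\<xi> + of_int m) / \<tau>) ` {\<lceil>-\<xi>\<rceil>..\<lfloor>\<tau> * s - \<xi>\<rfloor>}"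
  then obtain m where m: "m \<in> {\<lceil>-\<xi>\<rceil>..\<lfloor>\<tau> * s - \<xi>\<rfloor>}" "t = (\<xi> + of_int m) / \<tau>" by blast
  thus "t \<in> lattice_params \<tau> \<xi> s"
  proof -
    have 1: "\<tau> * t = \<xi> + of_int m" using m(2) assms by simp
    hence "0 \<le> \<tau> * t" "\<tau> * t \<le> \<tau> * s" "\<tau> * t - \<xi> = of_int m" using m(1)
      by (auto simp: ceiling_le_iff le_floor_iff)
    thus ?thesis using assms by (simp add: lattice_params_def zero_le_mult_iff)
  qed
qed

lemma finite_lattice_params: "\<tau> > 0 \<Longrightarrow> finite (lattice_params \<tau> \<xi> s)"
  by (simp add: lattice_params_eq)

lemma card_lattice_params_le:
  assumes "\<tau> > 0" "s \<ge> 0"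
  shows "real (card (lattice_params \<tau> \<xi> s)) \<le> \<tau> * s + 1"
proof -
  have "real (card (lattice_params \<tau> \<xi> s)) \<le> real (card {\<lceil>-\<xi>\<rceil>..\<lfloor>\<tau> * s - \<xi>\<rfloor>})"
    unfolding lattice_params_eq[OF assms(1)] by (simp add: card_image_le del: card_atLeastAtMost_int)
  also have "\<dots> \<le> \<tau> * s + 1"
  proof -
    have "\<tau> * s \<ge> 0" using assms by simp
    thus ?thesis by (simp only: card_atLeastAtMost_int) linarith
  qed
  finally show ?thesis .
qed

text \<open>
  As the parameter moves from \<open>0\<close> to \<open>t\<close>, the floor of \<open>\<xi> - \<tau> t\<close> drops by one at each lattice point. The
  end points must not be lattice points themselves, since their jump would be counted in part only.
\<close>

lemma floor_diff_eq_card: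
  assumes \<tau>: "\<tau> > 0" and t: "t \<ge> 0" and x: "\<xi> \<notin> \<int>" and xt: "\<xi> - \<tau> * t \<notin> \<int>"
  shows "real (card (lattice_params \<tau> \<xi> t)) = of_int \<lfloor>\<xi>\<rfloor> - of_int \<lfloor>\<xi> - \<tau> * t\<rfloor>"
proof -
  have inj: "inj_on (\<lambda>m. (\<xi> + of_int m) / \<tau>) {\<lceil>-\<xi>\<rceil>..\<lfloor>\<tau> * t - \<xi>\<rfloor>}"
    using \<tau> by (auto simp: inj_on_def)
  have "\<tau> * t \<ge> 0" using \<tau> t by simp
  have "\<tau> * t - \<xi> \<notin> \<int>" using xt Ints_minus[of "\<tau> * t - \<xi>"] by auto
  hence f: "\<lfloor>\<tau> * t - \<xi>\<rfloor> = - \<lfloor>\<xi> - \<tau> * t\<rfloor> - 1" using floor_minus[of "\<xi> - \<tau> * t"] ceiling_altdef[of "\<xi> - \<tau> * t"] xt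
    by (auto simp: Ints_def split: if_splits)
  have "\<lfloor>\<xi>\<rfloor> - \<lfloor>\<xi> - \<tau> * t\<rfloor> \<ge> 0" using \<open>\<tau> * t \<ge> 0\<close> by (simp add: floor_mono)
  thus ?thesis
    unfolding lattice_params_eq[OF \<tau>] card_image[OF inj]
    by (simp add: f ceiling_minus)
qed

text \<open>
  The first Bernoulli function is a linear function minus the floor. Integration by parts against the
  linear part gives \<open>\<tau> h\<close> and the boundary terms; against the floor it gives the sum of \<open>h\<close> over the jumps.
\<close>

lemma euler_maclaurin_base:
  assumes \<tau>: "\<tau> > 0" and s: "s \<ge> 0" and x: "\<xi> \<notin> \<int>" and xs: "\<xi> - \<tau> * s \<notin> \<int>"
    and h: "\<And>t. (h has_real_derivative h' t) (at t)" and cont: "continuous_on UNIV h'"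
  shows "((\<lambda>t. \<tau> * h t - h' t * bernoulli_frac (Suc 0) (\<xi> - \<tau> * t)) has_integral
           (\<Sum>t\<in>lattice_params \<tau> \<xi> s. h t) - h s * bernoulli_frac (Suc 0) (\<xi> - \<tau> * s) + h 0 * bernoulli_frac (Suc 0) \<xi>) {0..s}"
proof -
  let ?L = "lattice_params \<tau> \<xi> s"
  have B1: "bernoulli_frac (Suc 0) u = u - of_int \<lfloor>u\<rfloor> - 1/2" for u
  proof -
    have "poly (bernoulli_poly (Suc 0)) v = v - 1/2" for v
    proof -
      have b0: "fps_nth bernoulli_coeffs 0 = (1::real)"
        using bernoulli_coeffs_convolution[of 0, where 'a=real] by simp
      have b1: "fps_nth bernoulli_coeffs (Suc 0) = (-1/2::real)"
        using bernoulli_coeffs_convolution[of 1, where 'a=real] b0 by simp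
      show ?thesis unfolding bernoulli_poly_eq poly_bernoulli_sum by (simp add: b0 b1)
    qed
    thus ?thesis by (simp add: bernoulli_frac_def frac_def)
  qed
  have lin: "((\<lambda>t. - (\<tau> * h t) + h' t * (\<xi> - \<tau> * t - 1/2)) has_integral
     h s * (\<xi> - \<tau> * s - 1/2) - h 0 * (\<xi> - \<tau> * 0 - 1/2)) {0..s}"
    by (rule fundamental_theorem_of_calculus[OF s])
       (auto simp flip: has_real_derivative_iff_has_vector_derivative
         intro!: derivative_eq_intros DERIV_subset[OF h] simp: algebra_simps)
  \<comment> \<open>Each lattice point \<open>t0\<close> contributes a step function that is switched on from \<open>t0\<close> on.\<close>
  have jump: "((\<lambda>t. if t0 \<le> t then h' t else 0) has_integral h s - h t0) {0..s}" if t0: "t0 \<in> ?L" for t0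
  proof -
    have "(h' has_integral h s - h t0) {t0..s}"
      using t0 by (intro fundamental_theorem_of_calculus)
       (auto simp flip: has_real_derivative_iff_has_vector_derivative
         intro!: DERIV_subset[OF h] simp: lattice_params_def)
    hence "((\<lambda>t. if t \<in> {t0..s} then h' t else 0) has_integral h s - h t0) {0..s}"
      using t0 by (subst has_integral_restrict) (auto simp: lattice_params_def)
    thus ?thesis by (rule has_integral_eq[rotated]) auto
  qed
  have const: "((\<lambda>t. of_int \<lfloor>\<xi>\<rfloor> * h' t) has_integral of_int \<lfloor>\<xi>\<rfloor> * (h s - h 0)) {0..s}"
    by (intro has_integral_mult_right fundamental_theorem_of_calculus[OF s])
       (auto simp flip: has_real_derivative_iff_has_vector_derivative intro!: DERIV_subset[OF h])
  have jumps: "((\<lambda>t. \<Sum>t0\<in>?L. if t0 \<le> t then h' t else 0) has_integral (\<Sum>t0\<in>?L. h s - h t0)) {0..s}"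
    by (rule has_integral_sum[OF finite_lattice_params[OF \<tau>] jump])
  have all: "((\<lambda>t. (of_int \<lfloor>\<xi>\<rfloor> * h' t - (\<Sum>t0\<in>?L. if t0 \<le> t then h' t else 0)) - (- (\<tau> * h t) + h' t * (\<xi> - \<tau> * t - 1/2)))
     has_integral (of_int \<lfloor>\<xi>\<rfloor> * (h s - h 0) - (\<Sum>t0\<in>?L. h s - h t0)) - (h s * (\<xi> - \<tau> * s - 1/2) - h 0 * (\<xi> - \<tau> * 0 - 1/2))) {0..s}"
    by (intro has_integral_diff const jumps lin)
  have val: "(of_int \<lfloor>\<xi>\<rfloor> * (h s - h 0) - (\<Sum>t0\<in>?L. h s - h t0)) - (h s * (\<xi> - \<tau> * s - 1/2) - h 0 * (\<xi> - \<tau> * 0 - 1/2))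
    = (\<Sum>t\<in>?L. h t) - h s * bernoulli_frac (Suc 0) (\<xi> - \<tau> * s) + h 0 * bernoulli_frac (Suc 0) \<xi>"
  proof -
    have "(\<Sum>t0\<in>?L. h s - h t0) = real (card ?L) * h s - (\<Sum>t\<in>?L. h t)"
      by (simp add: sum_subtractf)
    also have "real (card ?L) = of_int \<lfloor>\<xi>\<rfloor> - of_int \<lfloor>\<xi> - \<tau> * s\<rfloor>"
      by (rule floor_diff_eq_card[OF \<tau> s x xs])
    finally have "(\<Sum>t0\<in>?L. h s - h t0) = (of_int \<lfloor>\<xi>\<rfloor> - of_int \<lfloor>\<xi> - \<tau> * s\<rfloor>) * h s - (\<Sum>t\<in>?L. h t)" .
    thus ?thesis unfolding B1 by (simp only:) (simp add: algebra_simps)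
  qed
  \<comment> \<open>Off the lattice points, the number of steps that are switched on is the drop of the floor.\<close>
  show ?thesis
  proof (rule has_integral_spike_finite[OF finite_lattice_params[OF \<tau>, of \<xi> s] _ all[unfolded val]])
    fix t assume t: "t \<in> {0..s} - ?L"
    have sub: "{t0 \<in> ?L. t0 \<le> t} = lattice_params \<tau> \<xi> t" using t by (auto simp: lattice_params_def)
    have xt: "\<xi> - \<tau> * t \<notin> \<int>" using t Ints_minus[of "\<xi> - \<tau> * t"] by (auto simp: lattice_params_def)
    have "(\<Sum>t0\<in>?L. if t0 \<le> t then h' t else 0) = real (card (lattice_params \<tau> \<xi> t)) * h' t"
      unfolding sub[symmetric] using finite_lattice_params[OF \<tau>, of \<xi> s]
      by (simp add: sum.If_cases Int_def)
    also have "real (card (lattice_params \<tau> \<xi> t)) = of_int \<lfloor>\<xi>\<rfloor> - of_int \<lfloor>\<xi> - \<tau> * t\<rfloor>"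
      using floor_diff_eq_card[OF \<tau> _ x xt] t by simp
    finally show "\<tau> * h t - h' t * bernoulli_frac (Suc 0) (\<xi> - \<tau> * t) =
       (of_int \<lfloor>\<xi>\<rfloor> * h' t - (\<Sum>t0\<in>?L. if t0 \<le> t then h' t else 0)) - (- (\<tau> * h t) + h' t * (\<xi> - \<tau> * t - 1/2))"
      by (simp add: B1 algebra_simps)
  qed
qed

text \<open>
  Integration by parts for two consecutive Bernoulli functions; the continuity of the second one is
  what makes the finitely many integers on the way harmless.
\<close>

lemma euler_maclaurin_parts:
  assumes \<tau>: "\<tau> > 0" and s: "s \<ge> 0"
    and h: "\<And>t. (h has_real_derivative h' t) (at t)"
  shows "((\<lambda>t. \<tau> * (h t * bernoulli_frac (Suc n) (\<xi> - \<tau> * t)) - h' t * bernoulli_frac (Suc (Suc n)) (\<xi> - \<tau> * t)) has_integral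
           h 0 * bernoulli_frac (Suc (Suc n)) \<xi> - h s * bernoulli_frac (Suc (Suc n)) (\<xi> - \<tau> * s)) {0..s}"
proof -
  define F where "F = (\<lambda>t. - (h t * bernoulli_frac (Suc (Suc n)) (\<xi> - \<tau> * t)))"
  have "((\<lambda>t. \<tau> * (h t * bernoulli_frac (Suc n) (\<xi> - \<tau> * t)) - h' t * bernoulli_frac (Suc (Suc n)) (\<xi> - \<tau> * t)) has_integral F s - F 0) {0..s}"
  proof (rule fundamental_theorem_of_calculus_strong[OF finite_lattice_params[OF \<tau>, of \<xi> s] s])
    show "continuous_on {0..s} F"
    proof (rule continuous_at_imp_continuous_on, rule ballI)
      fix t
      have "isCont (\<lambda>t. bernoulli_frac (Suc (Suc n)) (\<xi> - \<tau> * t)) t"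
        by (rule isCont_o2[OF _ bernoulli_frac_continuous]) (intro continuous_intros)
      thus "isCont F t" unfolding F_def by (intro continuous_intros DERIV_isCont[OF h])
    qed
  next
    fix t assume t: "t \<in> {0..s} - lattice_params \<tau> \<xi> s"
    have xt: "\<xi> - \<tau> * t \<notin> \<int>" using t Ints_minus[of "\<xi> - \<tau> * t"] by (auto simp: lattice_params_def)
    have "((\<lambda>t. bernoulli_frac (Suc (Suc n)) (\<xi> - \<tau> * t)) has_real_derivative bernoulli_frac (Suc n) (\<xi> - \<tau> * t) * (- \<tau>)) (at t)"
      by (rule DERIV_chain2[where f = "bernoulli_frac (Suc (Suc n))" and g = "\<lambda>t. \<xi> - \<tau> * t" and x = t, OF bernoulli_frac_deriv[OF xt]]) (auto intro!: derivative_eq_intros)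
    hence "(F has_real_derivative \<tau> * (h t * bernoulli_frac (Suc n) (\<xi> - \<tau> * t)) - h' t * bernoulli_frac (Suc (Suc n)) (\<xi> - \<tau> * t)) (at t)"
      unfolding F_def by (auto intro!: derivative_eq_intros h simp: algebra_simps)
    thus "(F has_vector_derivative \<tau> * (h t * bernoulli_frac (Suc n) (\<xi> - \<tau> * t)) - h' t * bernoulli_frac (Suc (Suc n)) (\<xi> - \<tau> * t)) (at t)"
      by (simp add: has_real_derivative_iff_has_vector_derivative)
  qed
  thus ?thesis by (simp add: F_def)
qed

text \<open>
  The remainder is stated as the value of an integral, multiplied by \<open>\<tau>\<^sup>w\<close>, so that the step of the
  induction is a single integration by parts of the remainder integral.
\<close>

lemma euler_maclaurin:
  fixes h :: "nat \<Rightarrow> real \<Rightarrow> real"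
  assumes \<tau>: "\<tau> > 0" and s: "s \<ge> 0" and x: "\<xi> \<notin> \<int>" and xs: "\<xi> - \<tau> * s \<notin> \<int>"
    and h: "\<And>j t. j \<le> w \<Longrightarrow> (h j has_real_derivative h (Suc j) t) (at t)"
    and cont: "continuous_on UNIV (h (Suc w))"
  shows "((\<lambda>t. h (Suc w) t * bernoulli_frac (Suc w) (\<xi> - \<tau> * t)) has_integral
     \<tau> ^ w * (\<tau> * integral {0..s} (h 0) + (\<Sum>j\<le>w. (1/\<tau>) ^ j *
        (h j s * bernoulli_frac (Suc j) (\<xi> - \<tau> * s) - h j 0 * bernoulli_frac (Suc j) \<xi>)) - (\<Sum>t\<in>lattice_params \<tau> \<xi> s. h 0 t))) {0..s}"
  using h cont
proof (induction w)
  case 0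
  have "continuous_on {0..s} (h 0)"
    by (rule continuous_at_imp_continuous_on) (auto intro: DERIV_isCont[OF 0(1)])
  hence I: "((\<lambda>t. \<tau> * h 0 t) has_integral \<tau> * integral {0..s} (h 0)) {0..s}"
    by (intro has_integral_mult_right integrable_integral integrable_continuous_real)
  from has_integral_diff[OF I euler_maclaurin_base[OF \<tau> s x xs 0(1)[OF order_refl] 0(2)]]
  show ?case by (simp add: algebra_simps)
next
  case (Suc w)
  have cont': "continuous_on UNIV (h (Suc w))"
    by (rule continuous_at_imp_continuous_on) (auto intro: DERIV_isCont[OF Suc(2)])
  have IH: "((\<lambda>t. h (Suc w) t * bernoulli_frac (Suc w) (\<xi> - \<tau> * t)) has_integral
     \<tau> ^ w * (\<tau> * integral {0..s} (h 0) + (\<Sum>j\<le>w. (1/\<tau>) ^ j *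
        (h j s * bernoulli_frac (Suc j) (\<xi> - \<tau> * s) - h j 0 * bernoulli_frac (Suc j) \<xi>)) - (\<Sum>t\<in>lattice_params \<tau> \<xi> s. h 0 t))) {0..s}"
    by (rule Suc.IH) (use Suc.prems(1) cont' in auto)
  note P = euler_maclaurin_parts[OF \<tau> s Suc.prems(1)[of "Suc w", OF order_refl], of w \<xi>]
  have pw: "\<tau> ^ Suc w * (1/\<tau>) ^ Suc w = 1" using \<tau> by (simp flip: power_mult_distrib)
  from has_integral_diff[OF has_integral_mult_right[OF IH, of \<tau>] P]
  have "((\<lambda>t. h (Suc (Suc w)) t * bernoulli_frac (Suc (Suc w)) (\<xi> - \<tau> * t)) has_integral
     \<tau> * (\<tau> ^ w * (\<tau> * integral {0..s} (h 0) + (\<Sum>j\<le>w. (1/\<tau>) ^ j *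
        (h j s * bernoulli_frac (Suc j) (\<xi> - \<tau> * s) - h j 0 * bernoulli_frac (Suc j) \<xi>)) - (\<Sum>t\<in>lattice_params \<tau> \<xi> s. h 0 t)))
     - (h (Suc w) 0 * bernoulli_frac (Suc (Suc w)) \<xi> - h (Suc w) s * bernoulli_frac (Suc (Suc w)) (\<xi> - \<tau> * s))) {0..s}"
    by (simp add: algebra_simps)
  moreover have "\<tau> * (\<tau> ^ w * (A + S - L)) - (a - b) = \<tau> ^ Suc w * (A + (S + (1/\<tau>) ^ Suc w * (b - a)) - L)" for A S L a b
  proof -
    have "\<tau> ^ Suc w * (A + (S + (1/\<tau>) ^ Suc w * (b - a)) - L) = \<tau> ^ Suc w * (A + S - L) + (\<tau> ^ Suc w * (1/\<tau>) ^ Suc w) * (b - a)"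
      by (simp only: ring_distribs mult.assoc add_diff_eq diff_add_eq add_ac)
    thus ?thesis unfolding pw by simp
  qed
  ultimately show ?case by (simp only: sum.atMost_Suc)
qed

lemma euler_maclaurin_bound:
  fixes h :: "nat \<Rightarrow> real \<Rightarrow> real"
  assumes \<tau>: "\<tau> > 0" and s: "s \<ge> 0" "s \<le> 1" and x: "\<xi> \<notin> \<int>" and xs: "\<xi> - \<tau> * s \<notin> \<int>"
    and h: "\<And>j t. j \<le> w \<Longrightarrow> (h j has_real_derivative h (Suc j) t) (at t)"
    and cont: "continuous_on UNIV (h (Suc w))"
    and K: "\<And>t. t \<in> {0..s} \<Longrightarrow> \<bar>h (Suc w) t\<bar> \<le> K"
    and B: "\<And>u. \<bar>bernoulli_frac (Suc w) u\<bar> \<le> B"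
  shows "\<bar>(\<Sum>t\<in>lattice_params \<tau> \<xi> s. h 0 t) - (\<tau> * integral {0..s} (h 0) + (\<Sum>j\<le>w. (1/\<tau>) ^ j *
        (h j s * bernoulli_frac (Suc j) (\<xi> - \<tau> * s) - h j 0 * bernoulli_frac (Suc j) \<xi>)))\<bar> \<le> (1/\<tau>) ^ w * (K * B)"
proof -
  let ?X = "(\<tau> * integral {0..s} (h 0) + (\<Sum>j\<le>w. (1/\<tau>) ^ j *
        (h j s * bernoulli_frac (Suc j) (\<xi> - \<tau> * s) - h j 0 * bernoulli_frac (Suc j) \<xi>)))"
  let ?S = "(\<Sum>t\<in>lattice_params \<tau> \<xi> s. h 0 t)"
  have K0: "K \<ge> 0" using K[of 0] s by fastforce
  have B0: "B \<ge> 0" using B[of 0] by linarith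
  have "norm (\<tau> ^ w * (?X - ?S)) \<le> K * B * measure lborel {0..s}"
    by (rule has_integral_bound[OF _ euler_maclaurin[OF \<tau> s(1) x xs h cont, unfolded interval_cbox], unfolded interval_cbox[symmetric]])
       (use K B K0 B0 in \<open>auto simp: abs_mult intro!: mult_mono\<close>)
  hence "\<tau> ^ w * \<bar>?X - ?S\<bar> \<le> K * B * s" using s \<tau> by (simp add: abs_mult)
  also have "\<dots> \<le> K * B" using s K0 B0 by (simp add: mult_left_le)
  finally have "\<bar>?X - ?S\<bar> \<le> (1/\<tau>) ^ w * (K * B)" using \<tau> by (simp add: field_simps)
  thus ?thesis by (simp add: abs_minus_commute)
qed

section \<open>Differentiable functions of a vector\<close>

lemma dim_vsnoc [simp]: "dim_vec (vsnoc x t) = Suc (dim_vec x)"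
  by (simp add: vsnoc_def)

lemma vsnoc_carrier [simp]: "x \<in> carrier_vec n \<Longrightarrow> vsnoc x t \<in> carrier_vec (Suc n)"
  by (intro carrier_vecI) simp

lemma vsnoc_index: "k < Suc (dim_vec x) \<Longrightarrow> vsnoc x t $ k = (if k < dim_vec x then x $ k else t)"
  unfolding vsnoc_def by (auto simp: less_Suc_eq)

lemma vec_total_vsnoc [simp]: "vec_total (vsnoc x t) = vec_total x + t"
  by (simp add: vec_total_def vsnoc_index)

text \<open>
  Continuity of \<open>f\<close> refers to the product topology on \<open>nat \<Rightarrow> real\<close>, and \<open>g\<close> is lifted to that space by
  padding with zeros. This reduces continuity of composites to continuity of the finitely many entries.
\<close>

lemma continuous_vec_compose:
  fixes g :: "'a :: topological_space \<Rightarrow> real vec"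
  assumes f: "continuous_vec d f" and g: "\<And>z. z \<in> A \<Longrightarrow> g z \<in> carrier_vec d"
    and c: "\<And>k. k < d \<Longrightarrow> continuous_on A (\<lambda>z. g z $ k)"
  shows "continuous_on A (\<lambda>z. f (g z))"
proof -
  define y where "y = (\<lambda>z k. if k < d then g z $ k else 0)"
  have "continuous_on A (\<lambda>z. y z k)" for k
    using c by (cases "k < d") (auto simp: y_def)
  hence "continuous_on A y"
    by (intro continuous_on_coordinatewise_then_product)
  hence "continuous_on A (\<lambda>z. f (vec d (y z)))"
    by (rule continuous_on_compose2[OF f[unfolded continuous_vec_def]]) simp
  moreover have "vec d (y z) = g z" if "z \<in> A" for z
    using g[OF that] by (intro eq_vecI) (auto simp: y_def)
  ultimately show ?thesis by (simp cong: continuous_on_cong)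
qed

lemma continuous_on_vec_index [continuous_intros]:
  "k < d \<Longrightarrow> continuous_on A (\<lambda>y :: nat \<Rightarrow> real. vec d y $ k)"
  by (simp add: continuous_on_product_coordinates continuous_on_subset[of UNIV])

lemma continuous_vec_cong:
  "(\<And>x. x \<in> carrier_vec d \<Longrightarrow> f x = g x) \<Longrightarrow> continuous_vec d f = continuous_vec d g"
  by (simp add: continuous_vec_def)

lemma partial_cong:
  assumes "\<And>x. x \<in> carrier_vec d \<Longrightarrow> f x = g x" "x \<in> carrier_vec d"
  shows "partial k f x = partial k g x"
proof -
  have "(\<lambda>t. f (x + t \<cdot>\<^sub>v unit_vec (dim_vec x) k)) = (\<lambda>t. g (x + t \<cdot>\<^sub>v unit_vec (dim_vec x) k))"
    using assms by (intro ext assms(1)) auto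
  thus ?thesis by (simp add: partial_def)
qed

lemma C_k_vec_cong:
  "(\<And>x. x \<in> carrier_vec d \<Longrightarrow> f x = g x) \<Longrightarrow> C_k_vec d m f = C_k_vec d m g"
proof (induction m arbitrary: f g)
  case 0
  then show ?case by (simp cong: continuous_vec_cong)
next
  case (Suc m)
  have "C_k_vec d m (partial k f) = C_k_vec d m (partial k g)" for k
    by (rule Suc.IH) (rule partial_cong[OF Suc.prems])
  moreover have "(\<lambda>t. f (x + t \<cdot>\<^sub>v unit_vec d k)) = (\<lambda>t. g (x + t \<cdot>\<^sub>v unit_vec d k))"
    if "x \<in> carrier_vec d" for x k
    using that by (intro ext Suc.prems) auto
  moreover have "continuous_vec d f = continuous_vec d g"
    by (rule continuous_vec_cong[OF Suc.prems])
  ultimately show ?case by (auto cong: ball_cong)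
qed

lemma C_k_vec_continuous: "C_k_vec d m f \<Longrightarrow> continuous_vec d f"
  by (cases m) auto

lemma C_k_vec_Suc_D: "C_k_vec d (Suc m) f \<Longrightarrow> C_k_vec d m f"
  by (induction m arbitrary: f) auto

lemma C_k_vec_mono: "C_k_vec d m f \<Longrightarrow> m' \<le> m \<Longrightarrow> C_k_vec d m' f"
proof (induction m)
  case (Suc m)
  show ?case
  proof (cases "m' = Suc m")
    case False
    hence "m' \<le> m" using Suc.prems by simp
    thus ?thesis using Suc.IH C_k_vec_Suc_D[OF Suc.prems(1)] by blast
  qed (use Suc.prems in simp)
qed simp

lemma C_k_vec_partial: "C_k_vec d (Suc m) f \<Longrightarrow> k < d \<Longrightarrow> C_k_vec d m (partial k f)"
  by simp

text \<open>
  Partial derivatives are defined as derivatives at parameter \<open>0\<close>; this moves the base point along the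
  line in order to differentiate at other parameters.
\<close>

lemma has_real_derivative_line_shift:
  fixes f :: "real vec \<Rightarrow> real"
  assumes "x \<in> carrier_vec d" "v \<in> carrier_vec d"
  shows "((\<lambda>t. f (x + t \<cdot>\<^sub>v v)) has_real_derivative D) (at t0) \<longleftrightarrow>
         ((\<lambda>t. f ((x + t0 \<cdot>\<^sub>v v) + t \<cdot>\<^sub>v v)) has_real_derivative D) (at 0)"
proof -
  have "(x + t0 \<cdot>\<^sub>v v) + t \<cdot>\<^sub>v v = x + (t + t0) \<cdot>\<^sub>v v" for t
    using assms by (intro eq_vecI) (auto simp: algebra_simps)
  thus ?thesis
    using DERIV_shift[of "\<lambda>t. f (x + t \<cdot>\<^sub>v v)" D 0 t0] by simp
qed

lemma has_partial:
  assumes "C_k_vec d (Suc m) f" "k < d" "x \<in> carrier_vec d"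
  shows "((\<lambda>t. f (x + t \<cdot>\<^sub>v unit_vec d k)) has_real_derivative partial k f (x + t0 \<cdot>\<^sub>v unit_vec d k)) (at t0)"
proof -
  have "x + t0 \<cdot>\<^sub>v unit_vec d k \<in> carrier_vec d" using assms(3) by auto
  hence "(\<lambda>t. f ((x + t0 \<cdot>\<^sub>v unit_vec d k) + t \<cdot>\<^sub>v unit_vec d k)) differentiable at 0"
    using assms(1,2) by auto
  hence "((\<lambda>t. f ((x + t0 \<cdot>\<^sub>v unit_vec d k) + t \<cdot>\<^sub>v unit_vec d k)) has_real_derivative
      partial k f (x + t0 \<cdot>\<^sub>v unit_vec d k)) (at 0)"
    using assms(3) by (simp add: partial_def DERIV_deriv_iff_real_differentiable)
  thus ?thesis by (subst has_real_derivative_line_shift) (use assms in auto)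
qed

lemma partialI:
  assumes "x \<in> carrier_vec d" "((\<lambda>t. f (x + t \<cdot>\<^sub>v unit_vec d k)) has_real_derivative D) (at 0)"
  shows "partial k f x = D"
  using assms by (auto simp: partial_def intro: DERIV_imp_deriv)

text \<open>
  The direction \<open>v\<close> is built up one coordinate at a time. Adding a coordinate is the chain rule on the
  diagonal of a function of two parameters, one of whose partial derivatives is continuous.
\<close>

lemma has_directional_derivative:
  assumes f: "C_k_vec d (Suc m) f" and x: "x \<in> carrier_vec d" and v: "v \<in> carrier_vec d"
  shows "((\<lambda>t. f (x + t \<cdot>\<^sub>v v)) has_real_derivative (\<Sum>k<d. v $ k * partial k f (x + t0 \<cdot>\<^sub>v v))) (at t0)"
proof -
  \<comment> \<open>\<open>T m\<close> keeps the first \<open>m\<close> entries of the direction.\<close>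
  define T where "T = (\<lambda>m. vec d (\<lambda>k. if k < m then v $ k else 0))"
  have T: "T m \<in> carrier_vec d" for m by (simp add: T_def)
  have "\<forall>x\<in>carrier_vec d. \<forall>t0. ((\<lambda>t. f (x + t \<cdot>\<^sub>v T m)) has_real_derivative (\<Sum>k<m. v $ k * partial k f (x + t0 \<cdot>\<^sub>v T m))) (at t0)"
    if "m \<le> d" for m
    using that
  proof (induction m)
    case 0
    have "x + t \<cdot>\<^sub>v T 0 = x" if "x \<in> carrier_vec d" for x t
      using that by (intro eq_vecI) (auto simp: T_def)
    thus ?case by auto
  next
    case (Suc m)
    show ?case
    proof (intro ballI allI)
      fix x :: "real vec" and t0 :: real assume x: "x \<in> carrier_vec d"
      define \<phi> where "\<phi> = (\<lambda>s t. f (x + s \<cdot>\<^sub>v T m + (t * v $ m) \<cdot>\<^sub>v unit_vec d m))"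
      define p where "p = (\<lambda>k s t. partial k f (x + s \<cdot>\<^sub>v T m + (t * v $ m) \<cdot>\<^sub>v unit_vec d m))"
      have m: "m < d" using Suc.prems by simp
      have fx: "((\<lambda>s. \<phi> s t) has_derivative (\<lambda>h. h * (\<Sum>k<m. v $ k * p k s t))) (at s)" for s t
      proof -
        have eq: "x + s \<cdot>\<^sub>v T m + (t * v $ m) \<cdot>\<^sub>v unit_vec d m = (x + (t * v $ m) \<cdot>\<^sub>v unit_vec d m) + s \<cdot>\<^sub>v T m" for s
          using x T[of m] by (intro eq_vecI) auto
        have "x + (t * v $ m) \<cdot>\<^sub>v unit_vec d m \<in> carrier_vec d" using x by auto
        hence "((\<lambda>s. \<phi> s t) has_real_derivative (\<Sum>k<m. v $ k * p k s t)) (at s)"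
          using Suc unfolding \<phi>_def p_def eq by auto
        moreover have "(\<lambda>h. h * (\<Sum>k<m. v $ k * p k s t)) = (*) (\<Sum>k<m. v $ k * p k s t)"
          by (intro ext mult.commute)
        ultimately show ?thesis by (simp only: has_field_derivative_def)
      qed
      have fy: "((\<lambda>t. \<phi> s t) has_derivative blinfun_apply (blinfun_mult_right (v $ m * p m s t))) (at t)" for s t
      proof -
        have "x + s \<cdot>\<^sub>v T m \<in> carrier_vec d" using x T[of m] by auto
        hence "((\<lambda>u. f (x + s \<cdot>\<^sub>v T m + u \<cdot>\<^sub>v unit_vec d m)) has_real_derivative p m s t) (at (t * v $ m))"
          unfolding p_def by (rule has_partial[OF f m])
        hence "((\<lambda>t. \<phi> s t) has_real_derivative p m s t * v $ m) (at t)"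
          unfolding \<phi>_def by (rule DERIV_chain2) (auto intro!: derivative_eq_intros)
        thus ?thesis by (auto simp: has_field_derivative_def mult.commute)
      qed
      have pc: "continuous_on UNIV (\<lambda>z. p m (fst z) (snd z))"
        unfolding p_def
        by (rule continuous_vec_compose[of d])
           (use f m x T[of m] in \<open>auto intro!: continuous_intros intro: C_k_vec_continuous\<close>)
      have "((\<lambda>(s, t). \<phi> s t) has_derivative (\<lambda>(hs, ht). hs * (\<Sum>k<m. v $ k * p k t0 t0) + blinfun_apply (blinfun_mult_right (v $ m * p m t0 t0)) ht)) (at (t0, t0) within UNIV \<times> UNIV)"
      proof (rule has_derivative_partialsI[of _ _ _ _ _ _ "\<lambda>s t. blinfun_mult_right (v $ m * p m s t)"])
        have "continuous_on UNIV (\<lambda>z. blinfun_mult_right (v $ m * p m (fst z) (snd z)))"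
          by (intro bounded_linear.continuous_on[OF bounded_linear_blinfun_mult_right] continuous_intros pc)
        thus "continuous (at (t0, t0) within UNIV \<times> UNIV) (\<lambda>(s, t). blinfun_mult_right (v $ m * p m s t))"
          by (simp add: continuous_on_eq_continuous_at case_prod_unfold)
      qed (use fx fy in auto)
      hence D: "((\<lambda>(s, t). \<phi> s t) has_derivative (\<lambda>(hs, ht). hs * (\<Sum>k<m. v $ k * p k t0 t0) + (v $ m * p m t0 t0) * ht)) (at (t0, t0))"
        by simp
      have "((\<lambda>t. (t, t)) has_derivative (\<lambda>h. (h, h))) (at t0)"
        by (auto intro!: derivative_eq_intros)
      from has_derivative_compose[OF this D]
      have "((\<lambda>t. \<phi> t t) has_real_derivative (\<Sum>k<Suc m. v $ k * p k t0 t0)) (at t0)"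
        unfolding has_field_derivative_def prod.case
        by (rule has_derivative_eq_rhs) (auto simp: fun_eq_iff algebra_simps)
      moreover have "x + t \<cdot>\<^sub>v T m + (t * v $ m) \<cdot>\<^sub>v unit_vec d m = x + t \<cdot>\<^sub>v T (Suc m)" for t
        using x m by (intro eq_vecI) (auto simp: T_def less_Suc_eq)
      ultimately show "((\<lambda>t. f (x + t \<cdot>\<^sub>v T (Suc m))) has_real_derivative (\<Sum>k<Suc m. v $ k * partial k f (x + t0 \<cdot>\<^sub>v T (Suc m)))) (at t0)"
        unfolding \<phi>_def p_def by simp
    qed
  qed
  moreover have "T d = v" using v by (intro eq_vecI) (auto simp: T_def)
  ultimately show ?thesis using x by auto
qed

lemma C_k_vec_SucI:
  assumes "continuous_vec d f"
    and "\<And>k x. k < d \<Longrightarrow> x \<in> carrier_vec d \<Longrightarrow> ((\<lambda>t. f (x + t \<cdot>\<^sub>v unit_vec d k)) has_real_derivative f' k x) (at 0)"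
    and "\<And>k. k < d \<Longrightarrow> C_k_vec d m (f' k)"
  shows "C_k_vec d (Suc m) f"
proof -
  have "partial k f x = f' k x" if "k < d" "x \<in> carrier_vec d" for k x
    using that assms(2) by (intro partialI)
  hence "C_k_vec d m (partial k f)" if "k < d" for k
    using that assms(3) by (subst C_k_vec_cong[of d _ "f' k"]) auto
  thus ?thesis using assms(1,2) by (auto simp: real_differentiable_def)
qed

lemma C_k_vec_const: "C_k_vec d m (\<lambda>_. c)"
  by (induction m arbitrary: c)
     (auto simp: continuous_vec_def intro!: C_k_vec_SucI[of _ _ "\<lambda>_ _. 0"] simp del: C_k_vec.simps(2))

lemma has_partial_0:
  assumes "C_k_vec d (Suc m) f" "k < d" "x \<in> carrier_vec d"
  shows "((\<lambda>t. f (x + t \<cdot>\<^sub>v unit_vec d k)) has_real_derivative partial k f x) (at 0)"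
proof -
  have "x + 0 \<cdot>\<^sub>v unit_vec d k = x" using assms(3) by (intro eq_vecI) auto
  thus ?thesis using has_partial[OF assms, of 0] by simp
qed

lemma C_k_vec_lincomb:
  "C_k_vec d m f \<Longrightarrow> C_k_vec d m g \<Longrightarrow> C_k_vec d m (\<lambda>x. a * f x + b * g x)"
proof (induction m arbitrary: f g)
  case 0
  then show ?case by (auto simp: continuous_vec_def intro!: continuous_intros)
next
  case (Suc m)
  show ?case
  proof (rule C_k_vec_SucI)
    show "continuous_vec d (\<lambda>x. a * f x + b * g x)"
      using Suc.prems[THEN C_k_vec_continuous] by (auto simp: continuous_vec_def intro!: continuous_intros)
    show "C_k_vec d m (\<lambda>x. a * partial k f x + b * partial k g x)" if "k < d" for k
      using Suc.prems that by (intro Suc.IH) auto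
    show "((\<lambda>t. a * f (x + t \<cdot>\<^sub>v unit_vec d k) + b * g (x + t \<cdot>\<^sub>v unit_vec d k)) has_real_derivative a * partial k f x + b * partial k g x) (at 0)"
      if "k < d" "x \<in> carrier_vec d" for k x
      using has_partial_0[OF Suc.prems(1) that] has_partial_0[OF Suc.prems(2) that]
      by (auto intro!: derivative_eq_intros)
  qed
qed

lemma partial_lincomb:
  assumes "C_k_vec d (Suc m) f" "C_k_vec d (Suc m) g" "k < d" "x \<in> carrier_vec d"
  shows "partial k (\<lambda>x. a * f x + b * g x) x = a * partial k f x + b * partial k g x"
  by (rule partialI[OF assms(4)])
     (use has_partial_0[OF assms(1,3,4)] has_partial_0[OF assms(2,3,4)] in \<open>auto intro!: derivative_eq_intros\<close>)

lemma C_k_vec_sum: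
  assumes "finite A" "\<And>i. i \<in> A \<Longrightarrow> C_k_vec d m (f i)"
  shows "C_k_vec d m (\<lambda>x. \<Sum>i\<in>A. c i * f i x)"
  using assms
proof (induction A rule: finite_induct)
  case empty
  then show ?case by (simp add: C_k_vec_const)
next
  case (insert i A)
  have "C_k_vec d m (\<lambda>x. c i * f i x + 1 * (\<Sum>i\<in>A. c i * f i x))"
    by (rule C_k_vec_lincomb) (use insert in auto)
  then show ?case using insert by simp
qed

section \<open>Composition with affine maps\<close>

text \<open>
  The map \<open>A\<close> is described only by its behavior along the coordinate directions: moving along the
  coordinate \<open>i\<close> moves the image along \<open>u i\<close>. That is what differentiating a composite with \<open>A\<close> needs.
\<close>

definition affine_map :: "nat \<Rightarrow> nat \<Rightarrow> (real vec \<Rightarrow> real vec) \<Rightarrow> (nat \<Rightarrow> real vec) \<Rightarrow> bool" where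
  "affine_map n d A u \<longleftrightarrow>
     (\<forall>x\<in>carrier_vec n. A x \<in> carrier_vec d) \<and> (\<forall>i<n. u i \<in> carrier_vec d) \<and>
     (\<forall>i<n. \<forall>x\<in>carrier_vec n. \<forall>t. A (x + t \<cdot>\<^sub>v unit_vec n i) = A x + t \<cdot>\<^sub>v u i) \<and>
     (\<forall>k<d. continuous_vec n (\<lambda>x. A x $ k))"

lemma continuous_vec_affine:
  assumes "affine_map n d A u" "continuous_vec d f"
  shows "continuous_vec n (\<lambda>x. f (A x))"
  unfolding continuous_vec_def
proof (rule continuous_vec_compose[OF assms(2)])
  show "A (vec n z) \<in> carrier_vec d" for z :: "nat \<Rightarrow> real"
    using assms(1) unfolding affine_map_def by auto
  show "continuous_on UNIV (\<lambda>z :: nat \<Rightarrow> real. A (vec n z) $ k)" if "k < d" for k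
    using assms(1) that unfolding affine_map_def continuous_vec_def by auto
qed

lemma has_derivative_affine:
  assumes A: "affine_map n d A u" and f: "C_k_vec d (Suc m) f" and i: "i < n" and x: "x \<in> carrier_vec n"
  shows "((\<lambda>t. f (A (x + t \<cdot>\<^sub>v unit_vec n i))) has_real_derivative (\<Sum>k<d. u i $ k * partial k f (A x))) (at 0)"
proof -
  have c: "A x \<in> carrier_vec d" "u i \<in> carrier_vec d"
    and eq: "A (x + t \<cdot>\<^sub>v unit_vec n i) = A x + t \<cdot>\<^sub>v u i" for t
    using A i x unfolding affine_map_def by blast+
  have "A x + 0 \<cdot>\<^sub>v u i = A x" using c by (intro eq_vecI) auto
  thus ?thesis
    using has_directional_derivative[OF f c, of 0] by (simp only: eq)
qed

lemma partial_affine: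
  assumes "affine_map n d A u" "C_k_vec d (Suc m) f" "i < n" "x \<in> carrier_vec n"
  shows "partial i (\<lambda>x. f (A x)) x = (\<Sum>k<d. u i $ k * partial k f (A x))"
  by (rule partialI[OF assms(4) has_derivative_affine[OF assms]])

lemma C_k_vec_affine:
  assumes A: "affine_map n d A u"
  shows "C_k_vec d m f \<Longrightarrow> C_k_vec n m (\<lambda>x. f (A x))"
proof (induction m arbitrary: f)
  case 0
  then show ?case using continuous_vec_affine[OF A] by simp
next
  case (Suc m)
  show ?case
  proof (rule C_k_vec_SucI[where f' = "\<lambda>i x. \<Sum>k<d. u i $ k * partial k f (A x)"])
    show "((\<lambda>t. f (A (x + t \<cdot>\<^sub>v unit_vec n i))) has_real_derivative (\<Sum>k<d. u i $ k * partial k f (A x))) (at 0)"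
      if "i < n" "x \<in> carrier_vec n" for i x
      by (rule has_derivative_affine[OF A Suc.prems that])
    show "continuous_vec n (\<lambda>x. f (A x))"
      by (rule continuous_vec_affine[OF A C_k_vec_continuous[OF Suc.prems]])
    have "C_k_vec n m (\<lambda>x. partial k f (A x))" if "k < d" for k
      by (rule Suc.IH[OF C_k_vec_partial[OF Suc.prems that]])
    thus "C_k_vec n m (\<lambda>x. \<Sum>k<d. u i $ k * partial k f (A x))" for i
      by (intro C_k_vec_sum) auto
  qed
qed

section \<open>Iterated partial derivatives\<close>

text \<open>
  A word of indices, rather than a multi-index, records the order of the differentiations, so that the
  estimates can follow the order in which the derivatives arise. Symmetry of mixed derivatives enters
  only in the comparison with multi-indices.
\<close>

primrec word_partial :: "nat list \<Rightarrow> (real vec \<Rightarrow> real) \<Rightarrow> real vec \<Rightarrow> real" where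
  "word_partial [] f = f"
| "word_partial (k # ks) f = word_partial ks (partial k f)"

lemma word_partial_append: "word_partial (ks @ ls) f = word_partial ls (word_partial ks f)"
  by (induction ks arbitrary: f) auto

lemma word_partial_replicate: "word_partial (replicate j k) f = (partial k ^^ j) f"
  by (induction j arbitrary: f) (simp_all add: funpow_Suc_right del: funpow.simps(2))

lemma word_partial_cong:
  assumes "\<And>x. x \<in> carrier_vec d \<Longrightarrow> f x = g x" "x \<in> carrier_vec d"
  shows "word_partial ks f x = word_partial ks g x"
  using assms
proof (induction ks arbitrary: f g)
  case (Cons k ks)
  show ?case unfolding word_partial.simps
    by (rule Cons.IH) (use partial_cong[OF Cons.prems(1)] Cons.prems(2) in auto)
qed auto

lemma C_k_vec_word_partial:
  "C_k_vec d (m + length ks) f \<Longrightarrow> set ks \<subseteq> {..<d} \<Longrightarrow> C_k_vec d m (word_partial ks f)"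
proof (induction ks arbitrary: f)
  case (Cons k ks)
  have "C_k_vec d (Suc (m + length ks)) f" "k < d" using Cons.prems by auto
  hence "C_k_vec d (m + length ks) (partial k f)" by (rule C_k_vec_partial)
  thus ?case using Cons.IH Cons.prems(2) by simp
qed simp

lemma word_partial_lincomb:
  assumes "C_k_vec d (length ks) f" "C_k_vec d (length ks) g" "set ks \<subseteq> {..<d}" "x \<in> carrier_vec d"
  shows "word_partial ks (\<lambda>x. a * f x + b * g x) x = a * word_partial ks f x + b * word_partial ks g x"
  using assms
proof (induction ks arbitrary: f g)
  case (Cons k ks)
  have k: "k < d" using Cons.prems by auto
  have "word_partial ks (partial k (\<lambda>x. a * f x + b * g x)) x = word_partial ks (\<lambda>x. a * partial k f x + b * partial k g x) x"
  proof (rule word_partial_cong[OF _ Cons.prems(4)])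
    fix y :: "real vec" assume "y \<in> carrier_vec d"
    thus "partial k (\<lambda>x. a * f x + b * g x) y = a * partial k f y + b * partial k g y"
      using Cons.prems(1,2) k by (intro partial_lincomb) (simp_all del: C_k_vec.simps(2))
  qed
  also have "\<dots> = a * word_partial ks (partial k f) x + b * word_partial ks (partial k g) x"
    by (rule Cons.IH) (use Cons.prems k in \<open>simp_all\<close>)
  finally show ?case by simp
qed auto

section \<open>Restriction to the faces of the standard simplex\<close>

lemma vec_total_add_unit:
  assumes "x \<in> carrier_vec n" "i < n"
  shows "vec_total (x + t \<cdot>\<^sub>v unit_vec n i) = vec_total x + t"
proof -
  have "vec_total (x + t \<cdot>\<^sub>v unit_vec n i) = (\<Sum>k<n. x $ k + (if k = i then t else 0))"
    using assms by (auto simp: vec_total_def intro!: sum.cong)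
  also have "\<dots> = vec_total x + t"
    using assms by (simp add: vec_total_def sum.distrib)
  finally show ?thesis .
qed

lemma continuous_vec_total: "continuous_vec n vec_total"
  unfolding continuous_vec_def vec_total_def by (auto intro!: continuous_intros)

lemma vsnoc_add_smult:
  assumes "x \<in> carrier_vec n" "y \<in> carrier_vec n"
  shows "vsnoc (x + h \<cdot>\<^sub>v y) (a + h * b) = vsnoc x a + h \<cdot>\<^sub>v vsnoc y b"
  using assms by (intro eq_vecI) (auto simp: vsnoc_index)

lemma affine_map_bottom:
  "affine_map n (Suc n) (\<lambda>x. vsnoc x 0) (\<lambda>i. vsnoc (unit_vec n i) 0)"
  unfolding affine_map_def
proof (intro conjI allI impI ballI)
  show "vsnoc (x + t \<cdot>\<^sub>v unit_vec n i) 0 = vsnoc x 0 + t \<cdot>\<^sub>v vsnoc (unit_vec n i) 0"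
    if "i < n" "x \<in> carrier_vec n" for i t and x :: "real vec"
    using vsnoc_add_smult[OF that(2) unit_vec_carrier, of t i 0 0] by simp
  show "continuous_vec n (\<lambda>x. vsnoc x 0 $ k)" if "k < Suc n" for k
    using that by (cases "k < n") (auto simp: continuous_vec_def vsnoc_index intro!: continuous_intros)
qed simp_all

text \<open>
  Moving along a coordinate in the base changes the last coordinate of the point on the slanted face
  by the opposite amount.
\<close>

lemma affine_map_top:
  "affine_map n (Suc n) (\<lambda>x. vsnoc x (1 - vec_total x)) (\<lambda>i. vsnoc (unit_vec n i) (- 1))"
  unfolding affine_map_def
proof (intro conjI allI impI ballI)
  show "vsnoc (x + t \<cdot>\<^sub>v unit_vec n i) (1 - vec_total (x + t \<cdot>\<^sub>v unit_vec n i)) =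
      vsnoc x (1 - vec_total x) + t \<cdot>\<^sub>v vsnoc (unit_vec n i) (- 1)"
    if "i < n" "x \<in> carrier_vec n" for i t and x :: "real vec"
    using vsnoc_add_smult[OF that(2) unit_vec_carrier, of t i "1 - vec_total x" "-1"] vec_total_add_unit[OF that(2,1)]
    by (simp add: algebra_simps)
  show "continuous_vec n (\<lambda>x. vsnoc x (1 - vec_total x) $ k)" if "k < Suc n" for k
    using that continuous_vec_total[of n]
    by (cases "k < n") (auto simp: continuous_vec_def vsnoc_index intro!: continuous_intros)
qed simp_all

lemma sum_vsnoc_unit:
  assumes "i < n"
  shows "(\<Sum>k<Suc n. vsnoc (unit_vec n i) c $ k * F k) = F i + c * (F n :: real)"
proof -
  have "(\<Sum>k<n. vsnoc (unit_vec n i) c $ k * F k) = (\<Sum>k<n. if k = i then F k else 0)"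
    by (rule sum.cong) (auto simp: vsnoc_index unit_vec_def)
  thus ?thesis using assms by (simp add: vsnoc_index)
qed

lemma partial_bottom:
  assumes "C_k_vec (Suc n) (Suc m) f" "i < n" "x \<in> carrier_vec n"
  shows "partial i (\<lambda>x. f (vsnoc x 0)) x = partial i f (vsnoc x 0)"
  unfolding partial_affine[OF affine_map_bottom assms] sum_vsnoc_unit[OF assms(2)] by simp

lemma partial_top:
  assumes "C_k_vec (Suc n) (Suc m) f" "i < n" "x \<in> carrier_vec n"
  shows "partial i (\<lambda>x. f (vsnoc x (1 - vec_total x))) x =
    partial i f (vsnoc x (1 - vec_total x)) - partial n f (vsnoc x (1 - vec_total x))"
  unfolding partial_affine[OF affine_map_top assms] sum_vsnoc_unit[OF assms(2)] by simp

lemma std_simplex_bottom: "x \<in> std_simplex n \<Longrightarrow> vsnoc x 0 \<in> std_simplex (Suc n)"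
  by (auto simp: std_simplex_def vsnoc_index less_Suc_eq)

lemma std_simplex_vsnoc:
  "x \<in> carrier_vec n \<Longrightarrow> vsnoc x t \<in> std_simplex (Suc n) \<longleftrightarrow> x \<in> std_simplex n \<and> 0 \<le> t \<and> t \<le> 1 - vec_total x"
  by (auto simp: std_simplex_def vsnoc_index less_Suc_eq)

lemma std_simplex_total: "x \<in> std_simplex n \<Longrightarrow> 0 \<le> vec_total x \<and> vec_total x \<le> 1"
  by (auto simp: std_simplex_def vec_total_def intro!: sum_nonneg)

lemma std_simplex_carrier: "x \<in> std_simplex n \<Longrightarrow> x \<in> carrier_vec n"
  by (auto simp: std_simplex_def)

lemma word_partial_bottom:
  "C_k_vec (Suc n) (length ks) f \<Longrightarrow> set ks \<subseteq> {..<n} \<Longrightarrow> x \<in> carrier_vec n \<Longrightarrow>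
    word_partial ks (\<lambda>x. f (vsnoc x 0)) x = word_partial ks f (vsnoc x 0)"
proof (induction ks arbitrary: f)
  case (Cons k ks)
  have k: "k < n" "k < Suc n" using Cons.prems by auto
  have f: "C_k_vec (Suc n) (Suc (length ks)) f" using Cons.prems by simp
  have "word_partial ks (partial k (\<lambda>x. f (vsnoc x 0))) x = word_partial ks (\<lambda>x. partial k f (vsnoc x 0)) x"
    by (rule word_partial_cong[OF partial_bottom[OF f k(1)] Cons.prems(3)])
  also have "\<dots> = word_partial ks (partial k f) (vsnoc x 0)"
    by (rule Cons.IH) (use Cons.prems C_k_vec_partial[OF f k(2)] in auto)
  finally show ?case by simp
qed auto

text \<open>
  Each derivative of a function on the slanted face is the difference of two partial derivatives in the
  ambient space, and so the bound doubles with each derivative.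
\<close>

lemma word_partial_top_bound:
  "C_k_vec (Suc n) (length ks) f \<Longrightarrow> set ks \<subseteq> {..<n} \<Longrightarrow> x \<in> std_simplex n \<Longrightarrow>
    (\<And>ls y. set ls \<subseteq> {..<Suc n} \<Longrightarrow> length ls = length ks \<Longrightarrow> y \<in> std_simplex (Suc n) \<Longrightarrow> \<bar>word_partial ls f y\<bar> \<le> K) \<Longrightarrow>
    \<bar>word_partial ks (\<lambda>x. f (vsnoc x (1 - vec_total x))) x\<bar> \<le> 2 ^ length ks * K"
proof (induction ks arbitrary: f)
  case Nil
  have "vsnoc x (1 - vec_total x) \<in> std_simplex (Suc n)"
    using Nil.prems(3) std_simplex_total[OF Nil.prems(3)] by (subst std_simplex_vsnoc) (auto simp: std_simplex_carrier)
  thus ?case using Nil.prems(4)[of "[]"] by simp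
next
  case (Cons k ks)
  have k: "k < n" "k < Suc n" using Cons.prems by auto
  have ks: "set ks \<subseteq> {..<n}" using Cons.prems by auto
  note x = std_simplex_carrier[OF Cons.prems(3)]
  have f: "C_k_vec (Suc n) (Suc (length ks)) f" using Cons.prems by simp
  let ?top = "\<lambda>x. vsnoc x (1 - vec_total x)"
  let ?F = "\<lambda>k x. partial k f (?top x)"
  have C: "C_k_vec n (length ks) (?F k)" if "k < Suc n" for k
    by (rule C_k_vec_affine[OF affine_map_top C_k_vec_partial[OF f that]])
  have "word_partial ks (partial k (\<lambda>x. f (?top x))) x = word_partial ks (\<lambda>x. 1 * ?F k x + (-1) * ?F n x) x"
    by (rule word_partial_cong[OF _ x]) (simp add: partial_top[OF f k(1)])
  also have "\<dots> = 1 * word_partial ks (?F k) x + (-1) * word_partial ks (?F n) x"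
    by (rule word_partial_lincomb[OF C C ks x]) (use k in auto)
  finally have eq: "word_partial (k # ks) (\<lambda>x. f (?top x)) x = word_partial ks (?F k) x - word_partial ks (?F n) x"
    by simp
  have "\<bar>word_partial ks (?F i) x\<bar> \<le> 2 ^ length ks * K" if "i < Suc n" for i
  proof (rule Cons.IH[OF C_k_vec_partial[OF f that] ks Cons.prems(3)])
    fix ls y assume "set ls \<subseteq> {..<Suc n}" "length ls = length ks" "y \<in> std_simplex (Suc n)"
    thus "\<bar>word_partial ls (partial i f) y\<bar> \<le> K" using Cons.prems(4)[of "i # ls" y] that by simp
  qed
  from this[OF k(2)] this[of n] show ?case unfolding eq by simp
qed

section \<open>Integration over the last coordinate\<close>

text \<open>
  The substitution \<open>t = s u\<close> moves the variable bound from the domain of integration into the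
  integrand, where continuity and differentiability in parameters are available. It is valid for
  negative \<open>s\<close> as well, because the integral is oriented.
\<close>

lemma oriented_integral_rescale:
  fixes h :: "real \<Rightarrow> real"
  assumes h: "continuous_on UNIV h"
  shows "(LBINT t=0..s. h t) = integral {0..1} (\<lambda>u. s * h (s * u))"
    and "s \<ge> 0 \<Longrightarrow> (LBINT t=0..s. h t) = integral {0..s} h"
proof -
  define F where "F = (\<lambda>u::real. LBINT y=0..u. h y)"
  have F: "(F has_real_derivative h x) (at x)" for x
  proof -
    define a where "a = min 0 x - 1"
    define b where "b = max 0 x + 1"
    have "((\<lambda>u. LBINT y=(0::real)..u. h y) has_vector_derivative h x) (at x within {a..b})"
      by (rule interval_integral_FTC2) (auto simp: a_def b_def intro: continuous_on_subset[OF h])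
    moreover have "at x within {a..b} = at x"
      by (rule at_within_Icc_at) (auto simp: a_def b_def)
    ultimately show ?thesis by (simp add: F_def has_real_derivative_iff_has_vector_derivative zero_ereal_def)
  qed
  have F0: "F 0 = 0" by (simp add: F_def zero_ereal_def)
  have "((\<lambda>u. s * h (s * u)) has_integral F (s * 1) - F (s * 0)) {0..1}"
  proof (rule fundamental_theorem_of_calculus)
    fix u :: real
    have "((\<lambda>u. F (s * u)) has_real_derivative h (s * u) * s) (at u)"
      by (rule DERIV_chain2[OF F]) (auto intro!: derivative_eq_intros)
    thus "((\<lambda>u. F (s * u)) has_vector_derivative s * h (s * u)) (at u within {0..1})"
      by (auto simp: mult.commute simp flip: has_real_derivative_iff_has_vector_derivative intro: DERIV_subset)
  qed simp
  hence "integral {0..1} (\<lambda>u. s * h (s * u)) = F s"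
    using F0 by (subst integral_unique) auto
  thus "(LBINT t=0..s. h t) = integral {0..1} (\<lambda>u. s * h (s * u))"
    unfolding F_def by (rule sym)
  assume "s \<ge> 0"
  hence "(h has_integral F s - F 0) {0..s}"
    by (rule fundamental_theorem_of_calculus)
       (auto simp flip: has_real_derivative_iff_has_vector_derivative intro: DERIV_subset[OF F])
  thus "(LBINT t=0..s. h t) = integral {0..s} h"
    using F0 by (simp add: F_def integral_unique)
qed

definition slice_integral :: "(real vec \<Rightarrow> real) \<Rightarrow> real vec \<Rightarrow> real" where
  "slice_integral f x = (LBINT t=0..1 - vec_total x. f (vsnoc x t))"

lemma continuous_on_slice:
  assumes "continuous_vec (Suc n) f" "x \<in> carrier_vec n"
  shows "continuous_on UNIV (\<lambda>t. f (vsnoc x t))"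
proof (rule continuous_vec_compose[OF assms(1)])
  show "continuous_on UNIV (\<lambda>t. vsnoc x t $ k)" if "k < Suc n" for k
    using that assms(2) by (cases "k < n") (auto simp: vsnoc_index)
qed (use assms in auto)

lemma slice_integral_eq:
  assumes "continuous_vec (Suc n) f" "x \<in> carrier_vec n"
  shows "slice_integral f x = integral {0..1} (\<lambda>u. (1 - vec_total x) * f (vsnoc x ((1 - vec_total x) * u)))"
  unfolding slice_integral_def by (rule oriented_integral_rescale(1)[OF continuous_on_slice[OF assms]])

lemma slice_integral_bound:
  assumes f: "continuous_vec (Suc n) f" and x: "x \<in> std_simplex n"
    and K: "\<And>y. y \<in> std_simplex (Suc n) \<Longrightarrow> \<bar>f y\<bar> \<le> K"
  shows "\<bar>slice_integral f x\<bar> \<le> K"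
proof -
  note xc = std_simplex_carrier[OF x]
  define s where "s = 1 - vec_total x"
  have s: "0 \<le> s" "s \<le> 1" using std_simplex_total[OF x] by (auto simp: s_def)
  have "vsnoc x 0 \<in> std_simplex (Suc n)" by (rule std_simplex_bottom[OF x])
  hence K0: "K \<ge> 0" using K by fastforce
  have cont: "continuous_on {0..1} (\<lambda>u. s * f (vsnoc x (s * u)))"
    by (intro continuous_intros continuous_on_compose2[OF continuous_on_slice[OF f xc]]) auto
  have "norm (integral {0..1} (\<lambda>u. s * f (vsnoc x (s * u)))) \<le> K * (1 - 0)"
  proof (rule integral_bound)
    fix u :: real assume u: "u \<in> {0..1}"
    have "vsnoc x (s * u) \<in> std_simplex (Suc n)"
      using x xc s u by (subst std_simplex_vsnoc) (auto simp: s_def mult_left_le)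
    hence "\<bar>s\<bar> * \<bar>f (vsnoc x (s * u))\<bar> \<le> 1 * K"
      using s K K0 by (intro mult_mono) auto
    thus "norm (s * f (vsnoc x (s * u))) \<le> K" by (simp add: abs_mult)
  qed (use cont in auto)
  thus ?thesis unfolding slice_integral_eq[OF f xc] s_def by simp
qed

lemma continuous_vec_slice_integral:
  assumes f: "continuous_vec (Suc n) f"
  shows "continuous_vec n (slice_integral f)"
proof -
  define s where "s = (\<lambda>y :: nat \<Rightarrow> real. 1 - vec_total (vec n y))"
  have s: "continuous_on UNIV s"
    using continuous_vec_total[of n] unfolding s_def continuous_vec_def by (intro continuous_intros)
  have s1: "continuous_on A (\<lambda>z :: (nat \<Rightarrow> real) \<times> real. s (fst z))" for A
    by (rule continuous_on_compose2[OF s continuous_on_fst[OF continuous_on_id]]) auto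
  have p1: "continuous_on A (\<lambda>z :: (nat \<Rightarrow> real) \<times> real. fst z k)" for A k
    by (rule continuous_on_compose2[OF continuous_on_product_coordinates[of k] continuous_on_fst[OF continuous_on_id]]) auto
  have "continuous_on (UNIV \<times> cbox 0 1) (\<lambda>z. f (vsnoc (vec n (fst z)) (s (fst z) * snd z)))"
  proof (rule continuous_vec_compose[OF f])
    show "continuous_on (UNIV \<times> cbox 0 1) (\<lambda>z. vsnoc (vec n (fst z)) (s (fst z) * snd z) $ k)" if "k < Suc n" for k
      using that by (cases "k < n") (auto simp: vsnoc_index intro!: continuous_intros s1 p1)
  qed auto
  hence "continuous_on (UNIV \<times> cbox 0 1) (\<lambda>z. s (fst z) * f (vsnoc (vec n (fst z)) (s (fst z) * snd z)))"
    by (intro continuous_intros s1)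
  hence "continuous_on UNIV (\<lambda>y. integral (cbox 0 1) (\<lambda>u. s y * f (vsnoc (vec n y) (s y * u))))"
    by (intro integral_continuous_on_param) (simp add: case_prod_unfold)
  moreover have "slice_integral f (vec n y) = integral (cbox 0 1) (\<lambda>u. s y * f (vsnoc (vec n y) (s y * u)))" for y
    by (simp add: slice_integral_eq[OF f vec_carrier] s_def)
  ultimately show ?thesis unfolding continuous_vec_def by simp
qed

text \<open>
  Differentiation under the integral sign, after rescaling to the unit interval, differentiates the
  argument also in the last coordinate. Integrating these terms by parts turns them into the value on
  the slanted face, as expected for a variable upper bound.
\<close>

lemma has_derivative_slice_integral:
  assumes f: "C_k_vec (Suc n) (Suc m) f" and i: "i < n" and x: "x \<in> carrier_vec n"
  shows "((\<lambda>h. slice_integral f (x + h \<cdot>\<^sub>v unit_vec n i)) has_real_derivative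
           slice_integral (partial i f) x - f (vsnoc x (1 - vec_total x))) (at 0)"
proof -
  define s where "s = 1 - vec_total x"
  \<comment> \<open>The point over \<open>x + h e\<^sub>i\<close> at relative height \<open>u\<close>; it depends affinely on \<open>h\<close>.\<close>
  define P where "P = (\<lambda>h u. vsnoc (x + h \<cdot>\<^sub>v unit_vec n i) ((s - h) * u))"
  note f0 = C_k_vec_continuous[OF f]
  have fp: "continuous_vec (Suc n) (partial k f)" if "k < Suc n" for k
    by (rule C_k_vec_continuous[OF C_k_vec_partial[OF f that]])
  have xh: "x + h \<cdot>\<^sub>v unit_vec n i \<in> carrier_vec n" for h using x by auto
  have Pc: "P h u \<in> carrier_vec (Suc n)" for h u using xh by (simp add: P_def)
  have P0: "P 0 u = vsnoc x (s * u)" for u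
  proof -
    have "x + 0 \<cdot>\<^sub>v unit_vec n i = x" using x by (intro eq_vecI) auto
    thus ?thesis by (simp add: P_def)
  qed
  have Pd: "P h u = P 0 u + h \<cdot>\<^sub>v vsnoc (unit_vec n i) (- u)" for h u
    using vsnoc_add_smult[OF x unit_vec_carrier, of h i "s * u" "- u"] unfolding P0
    by (simp add: P_def algebra_simps)
  have Pcont: "continuous_on A (\<lambda>z. g (P (fst z) (snd z)))" if "continuous_vec (Suc n) g" for g and A :: "(real \<times> real) set"
  proof (rule continuous_vec_compose[OF that])
    show "continuous_on A (\<lambda>z. P (fst z) (snd z) $ k)" if "k < Suc n" for k
      using that x by (cases "k < n") (auto simp: P_def vsnoc_index intro!: continuous_intros)
  qed (use Pc in auto)
  have P0cont: "continuous_on A (\<lambda>u. g (P 0 u))" if "continuous_vec (Suc n) g" for g and A :: "real set"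
    by (rule continuous_on_compose2[OF Pcont[OF that, of UNIV], of A "\<lambda>u. (0, u)", simplified]) (auto intro!: continuous_intros)
  define f' where "f' = (\<lambda>h u. - f (P h u) + (s - h) * (partial i f (P h u) - u * partial n f (P h u)))"
  have D: "((\<lambda>h. (s - h) * f (P h u)) has_real_derivative f' h u) (at h)" for h u
  proof -
    have "((\<lambda>h. f (P 0 u + h \<cdot>\<^sub>v vsnoc (unit_vec n i) (- u))) has_real_derivative
        (\<Sum>k<Suc n. vsnoc (unit_vec n i) (- u) $ k * partial k f (P h u))) (at h)"
      unfolding Pd[of h] by (rule has_directional_derivative[OF f Pc]) simp
    hence "((\<lambda>h. f (P h u)) has_real_derivative partial i f (P h u) - u * partial n f (P h u)) (at h)"
      unfolding sum_vsnoc_unit[OF i] Pd[symmetric] by simp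
    thus ?thesis unfolding f'_def by (auto intro!: derivative_eq_intros simp: algebra_simps)
  qed
  have leib: "((\<lambda>h. integral (cbox 0 1) (\<lambda>u. (s - h) * f (P h u))) has_field_derivative integral (cbox 0 1) (f' 0)) (at 0 within UNIV)"
  proof (rule leibniz_rule_field_derivative)
    show "(\<lambda>u. (s - h) * f (P h u)) integrable_on cbox 0 1" for h
      by (intro integrable_continuous continuous_intros continuous_on_compose2[OF Pcont[OF f0, of UNIV], of _ "\<lambda>u. (h, u)", simplified])
    show "continuous_on (UNIV \<times> cbox 0 1) (\<lambda>(h, u). f' h u)"
      unfolding f'_def case_prod_unfold by (intro continuous_intros Pcont f0 fp) (use i in auto)
  qed (use D in auto)
  have eqL: "slice_integral f (x + h \<cdot>\<^sub>v unit_vec n i) = integral (cbox 0 1) (\<lambda>u. (s - h) * f (P h u))" for h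
    unfolding slice_integral_eq[OF f0 xh] vec_total_add_unit[OF x i] P_def s_def by (simp add: algebra_simps)
  \<comment> \<open>The value on the slanted face is the boundary term of \<open>u f (P 0 u)\<close> at \<open>u = 1\<close>.\<close>
  have parts: "((\<lambda>u. f (P 0 u) + s * (u * partial n f (P 0 u))) has_integral 1 * f (P 0 1) - 0 * f (P 0 0)) {0..1}"
  proof (rule fundamental_theorem_of_calculus)
    fix u :: real
    have eq: "vsnoc x 0 + t \<cdot>\<^sub>v unit_vec (Suc n) n = vsnoc x t" for t
      using x by (intro eq_vecI) (auto simp: vsnoc_index less_Suc_eq)
    have "((\<lambda>t. f (vsnoc x t)) has_real_derivative partial n f (vsnoc x (s * u))) (at (s * u))"
      using has_partial[OF f, of n "vsnoc x 0" "s * u"] x by (simp add: eq)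
    hence "((\<lambda>u. f (P 0 u)) has_real_derivative partial n f (P 0 u) * s) (at u)"
      unfolding P0 by (rule DERIV_chain2) (auto intro!: derivative_eq_intros)
    hence "((\<lambda>u. u * f (P 0 u)) has_real_derivative f (P 0 u) + s * (u * partial n f (P 0 u))) (at u)"
      by (auto intro!: derivative_eq_intros)
    thus "((\<lambda>u. u * f (P 0 u)) has_vector_derivative f (P 0 u) + s * (u * partial n f (P 0 u))) (at u within {0..1})"
      by (auto simp flip: has_real_derivative_iff_has_vector_derivative intro: DERIV_subset)
  qed simp
  have "(\<lambda>u. s * partial i f (P 0 u)) integrable_on {0..1}"
    by (intro integrable_continuous_real continuous_intros P0cont fp) (use i in auto)
  hence "((\<lambda>u. s * partial i f (P 0 u)) has_integral slice_integral (partial i f) x) {0..1}"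
    using slice_integral_eq[OF fp x, of i] i by (simp add: P0 s_def has_integral_integral)
  from has_integral_diff[OF this parts]
  have "integral (cbox 0 1) (f' 0) = slice_integral (partial i f) x - f (vsnoc x s)"
    by (intro integral_unique) (simp add: f'_def P0 algebra_simps)
  thus ?thesis using leib unfolding eqL s_def by simp
qed

lemma partial_slice_integral:
  assumes "C_k_vec (Suc n) (Suc m) f" "i < n" "x \<in> carrier_vec n"
  shows "partial i (slice_integral f) x = slice_integral (partial i f) x - f (vsnoc x (1 - vec_total x))"
  by (rule partialI[OF assms(3) has_derivative_slice_integral[OF assms]])

lemma C_k_vec_slice_integral:
  "C_k_vec (Suc n) m f \<Longrightarrow> C_k_vec n m (slice_integral f)"
proof (induction m arbitrary: f)
  case 0
  then show ?case using continuous_vec_slice_integral by simp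
next
  case (Suc m)
  show ?case
  proof (rule C_k_vec_SucI[where f' = "\<lambda>i x. 1 * slice_integral (partial i f) x + (- 1) * f (vsnoc x (1 - vec_total x))"])
    show "continuous_vec n (slice_integral f)"
      by (rule continuous_vec_slice_integral[OF C_k_vec_continuous[OF Suc.prems]])
    show "((\<lambda>t. slice_integral f (x + t \<cdot>\<^sub>v unit_vec n k)) has_real_derivative
        1 * slice_integral (partial k f) x + (- 1) * f (vsnoc x (1 - vec_total x))) (at 0)"
      if "k < n" "x \<in> carrier_vec n" for k x
      using has_derivative_slice_integral[OF Suc.prems that] by simp
    show "C_k_vec n m (\<lambda>x. 1 * slice_integral (partial k f) x + (- 1) * f (vsnoc x (1 - vec_total x)))" if "k < n" for k
      by (rule C_k_vec_lincomb[OF Suc.IH[OF C_k_vec_partial[OF Suc.prems]] C_k_vec_affine[OF affine_map_top C_k_vec_Suc_D[OF Suc.prems]]])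
         (use that in simp)
  qed
qed

text \<open>
  A derivative of the integral is an integral of a derivative minus a value on the slanted face with
  one derivative less. At most one derivative is lost in total: once a boundary value is taken,
  no integral is left. Hence all words have the length of \<open>ks\<close> or one less.
\<close>

lemma word_partial_slice_integral_bound:
  "C_k_vec (Suc n) (length ks) f \<Longrightarrow> set ks \<subseteq> {..<n} \<Longrightarrow> x \<in> std_simplex n \<Longrightarrow>
    (\<And>ls y. set ls \<subseteq> {..<Suc n} \<Longrightarrow> length ls \<le> length ks \<Longrightarrow> length ks \<le> Suc (length ls) \<Longrightarrow>
       y \<in> std_simplex (Suc n) \<Longrightarrow> \<bar>word_partial ls f y\<bar> \<le> K) \<Longrightarrow>
    \<bar>word_partial ks (slice_integral f) x\<bar> \<le> 2 ^ length ks * K"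
proof (induction ks arbitrary: f)
  case Nil
  show ?case
    using slice_integral_bound[of n f x K] Nil.prems(1,3) Nil.prems(4)[of "[]"] by simp
next
  case (Cons k ks)
  have k: "k < n" "k < Suc n" using Cons.prems by auto
  have ks: "set ks \<subseteq> {..<n}" using Cons.prems by auto
  note x = std_simplex_carrier[OF Cons.prems(3)]
  have f: "C_k_vec (Suc n) (Suc (length ks)) f" using Cons.prems by simp
  let ?F = "\<lambda>x. f (vsnoc x (1 - vec_total x))"
  let ?G = "slice_integral (partial k f)"
  have "word_partial ks (partial k (slice_integral f)) x = word_partial ks (\<lambda>x. 1 * ?G x + (-1) * ?F x) x"
    by (rule word_partial_cong[OF _ x]) (simp add: partial_slice_integral[OF f k(1)])
  also have "\<dots> = 1 * word_partial ks ?G x + (-1) * word_partial ks ?F x"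
    by (rule word_partial_lincomb[OF C_k_vec_slice_integral[OF C_k_vec_partial[OF f k(2)]] C_k_vec_affine[OF affine_map_top C_k_vec_Suc_D[OF f]] ks x])
  finally have eq: "word_partial (k # ks) (slice_integral f) x = word_partial ks ?G x - word_partial ks ?F x" by simp
  have "\<bar>word_partial ks ?G x\<bar> \<le> 2 ^ length ks * K"
  proof (rule Cons.IH[OF C_k_vec_partial[OF f k(2)] ks Cons.prems(3)])
    fix ls y assume "set ls \<subseteq> {..<Suc n}" "length ls \<le> length ks" "length ks \<le> Suc (length ls)" "y \<in> std_simplex (Suc n)"
    thus "\<bar>word_partial ls (partial k f) y\<bar> \<le> K" using Cons.prems(4)[of "k # ls" y] k by simp
  qed
  \<comment> \<open>The boundary value carries one derivative less than the word \<open>k # ks\<close>.\<close>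
  moreover have "\<bar>word_partial ks ?F x\<bar> \<le> 2 ^ length ks * K"
    by (rule word_partial_top_bound[OF C_k_vec_Suc_D[OF f] ks Cons.prems(3)]) (use Cons.prems(4) in auto)
  ultimately show ?case unfolding eq by simp
qed

section \<open>Derivatives of the functions T g\<close>

lemma deriv_slice:
  assumes "x \<in> carrier_vec n"
  shows "(deriv ^^ j) (\<lambda>t. g (vsnoc x t)) = (\<lambda>t. (partial n ^^ j) g (vsnoc x t))"
proof (induction j arbitrary: g)
  case (Suc j)
  have "deriv (\<lambda>t. g (vsnoc x t)) = (\<lambda>t. partial n g (vsnoc x t))"
  proof
    fix t
    have "vsnoc x t + u \<cdot>\<^sub>v unit_vec (Suc n) n = vsnoc x (t + u)" for u
      using assms by (intro eq_vecI) (auto simp: vsnoc_index less_Suc_eq)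
    thus "deriv (\<lambda>t. g (vsnoc x t)) t = partial n g (vsnoc x t)"
      using assms by (simp add: partial_def deriv_shift_0[of _ t] o_def)
  qed
  thus ?case using Suc by (simp add: funpow_Suc_right del: funpow.simps(2))
qed simp

text \<open>
  The second functional is zero by definition, so an integrated coordinate contributes only for the
  index \<open>1\<close>.
\<close>

lemma T_op_integral: "T_op (Suc 0) 0 j g = slice_integral g" "T_op 2 0 j g = (\<lambda>_. 0)"
  by (auto simp: T_op_def slice_integral_def Let_def)

lemma T_op_ends:
  assumes "x \<in> carrier_vec n"
  shows "T_op (Suc 0) (Suc 0) j g x = - word_partial (replicate j n) g (vsnoc x 0)"
    and "T_op 2 (Suc 0) j g x = word_partial (replicate j n) g (vsnoc x (1 - vec_total x))"
  using assms by (auto simp: T_op_def Let_def deriv_slice word_partial_replicate)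

lemma C_k_vec_T_op:
  assumes g: "C_k_vec (Suc n) (m + j) g" and v: "v \<in> {1, 2}" and i: "i \<in> {0, 1}"
  shows "C_k_vec n m (T_op v i j g)"
proof -
  have G: "C_k_vec (Suc n) m (word_partial (replicate j n) g)"
    using g by (intro C_k_vec_word_partial) auto
  have "C_k_vec n m (\<lambda>x. (-1) * word_partial (replicate j n) g (vsnoc x 0) + 0 * word_partial (replicate j n) g (vsnoc x 0))"
    by (intro C_k_vec_lincomb C_k_vec_affine[OF affine_map_bottom G])
  hence "C_k_vec n m (T_op (Suc 0) (Suc 0) j g)"
    by (subst C_k_vec_cong[OF T_op_ends(1)]) auto
  moreover have "C_k_vec n m (T_op 2 (Suc 0) j g)"
    using C_k_vec_affine[OF affine_map_top G] by (subst C_k_vec_cong[OF T_op_ends(2)])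
  moreover have "C_k_vec n m (T_op (Suc 0) 0 j g)"
    unfolding T_op_integral by (rule C_k_vec_slice_integral[OF C_k_vec_mono[OF g]]) simp
  moreover have "C_k_vec n m (T_op 2 0 j g)"
    unfolding T_op_integral by (rule C_k_vec_const)
  ultimately show ?thesis using v i by auto
qed

text \<open>
  For \<open>i = 1\<close> the total number \<open>length ks + j\<close> of derivatives is preserved, and for \<open>i = 0\<close> at most one is
  lost. The hypothesis on the words expresses both cases by the single inequality with \<open>i\<close>.
\<close>

lemma word_partial_T_op_bound:
  assumes g: "C_k_vec (Suc n) (length ks + j) g" and v: "v \<in> {1, 2}" and i: "i \<in> {0, 1}" "i = 0 \<Longrightarrow> j = 0"
    and ks: "set ks \<subseteq> {..<n}" and x: "x \<in> std_simplex n" and K0: "K \<ge> 0"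
    and K: "\<And>ls y. set ls \<subseteq> {..<Suc n} \<Longrightarrow> length ls \<le> length ks + j \<Longrightarrow> length ks + j + i \<le> Suc (length ls) \<Longrightarrow>
       y \<in> std_simplex (Suc n) \<Longrightarrow> \<bar>word_partial ls g y\<bar> \<le> K"
  shows "\<bar>word_partial ks (T_op v i j g) x\<bar> \<le> 2 ^ length ks * K"
proof -
  note xc = std_simplex_carrier[OF x]
  let ?G = "word_partial (replicate j n) g"
  have G: "C_k_vec (Suc n) (length ks) ?G"
    using g by (intro C_k_vec_word_partial) auto
  have KG: "\<bar>word_partial ls ?G y\<bar> \<le> K" if "i = Suc 0" "set ls \<subseteq> {..<Suc n}" "length ls = length ks" "y \<in> std_simplex (Suc n)" for ls y
    proof -
    have "set (replicate j n @ ls) \<subseteq> {..<Suc n}" using that(2) by (auto simp: set_replicate_conv_if)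
    from K[OF this _ _ that(4)] show ?thesis using that(1,3) by (simp add: word_partial_append)
  qed
  have p2: "K \<le> 2 ^ length ks * K" using mult_right_mono[OF one_le_power[of 2] K0, of "length ks"] by simp
  consider "v = Suc 0" "i = Suc 0" | "v = 2" "i = Suc 0" | "v = Suc 0" "i = 0" | "v = 2" "i = 0" using v i by auto
  thus ?thesis
  proof cases
    case 1
    have "word_partial ks (T_op (Suc 0) (Suc 0) j g) x = word_partial ks (\<lambda>x. (-1) * ?G (vsnoc x 0) + 0 * ?G (vsnoc x 0)) x"
      by (rule word_partial_cong[OF _ xc]) (simp add: T_op_ends(1))
    also have "\<dots> = (-1) * word_partial ks (\<lambda>x. ?G (vsnoc x 0)) x + 0 * word_partial ks (\<lambda>x. ?G (vsnoc x 0)) x"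
      by (rule word_partial_lincomb[OF C_k_vec_affine[OF affine_map_bottom G] C_k_vec_affine[OF affine_map_bottom G] ks xc])
    also have "\<dots> = - word_partial ks ?G (vsnoc x 0)"
      by (simp add: word_partial_bottom[OF G ks xc])
    finally have "\<bar>word_partial ks (T_op (Suc 0) (Suc 0) j g) x\<bar> \<le> K"
      using KG[OF 1(2), of ks "vsnoc x 0"] ks std_simplex_bottom[OF x] by force
    thus ?thesis using 1 p2 by simp
  next
    case 2
    have "word_partial ks (T_op 2 (Suc 0) j g) x = word_partial ks (\<lambda>x. ?G (vsnoc x (1 - vec_total x))) x"
      by (rule word_partial_cong[OF T_op_ends(2) xc])
    thus ?thesis using word_partial_top_bound[OF G ks x KG[OF 2(2)]] 2 by simp
  next
    case 3
    hence "j = 0" using i by simp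
    thus ?thesis unfolding 3 T_op_integral
      by (intro word_partial_slice_integral_bound[OF _ ks x]) (use g K 3 in auto)
  next
    case 4
    have "word_partial ks (\<lambda>_. 0) x = 0" for x ks
    proof (induction ks)
      case (Cons k ks)
      have "partial k (\<lambda>_. 0) = (\<lambda>_. 0)" by (auto simp: partial_def fun_eq_iff)
      thus ?case using Cons by simp
    qed simp
    thus ?thesis using 4 K0 by (simp only: T_op_integral) simp
  qed
qed

section \<open>Symmetry of mixed partial derivatives\<close>

lemma mvt_real:
  fixes f :: "real \<Rightarrow> real"
  assumes "h > 0" "\<And>x. (f has_real_derivative f' x) (at x)"
  shows "\<exists>z\<in>{0..h}. f h - f 0 = h * f' z"
  using MVT2[OF assms(1), of f f'] assms(2) by (auto simp: atLeastAtMost_iff)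

text \<open>
  The second difference over a square of side \<open>h\<close> equals \<open>h\<^sup>2\<close> times each of the two mixed derivatives at
  some point of the square, by the mean value theorem in either order. As \<open>h\<close> tends to \<open>0\<close>, continuity
  at the corner identifies the two values.
\<close>

lemma mixed_derivatives_commute:
  fixes \<phi> :: "real \<Rightarrow> real \<Rightarrow> real"
  assumes s: "\<And>s t. ((\<lambda>s. \<phi> s t) has_real_derivative \<phi>s s t) (at s)"
    and t: "\<And>s t. ((\<lambda>t. \<phi> s t) has_real_derivative \<phi>t s t) (at t)"
    and st: "\<And>s t. ((\<lambda>t. \<phi>s s t) has_real_derivative \<phi>st s t) (at t)"
    and ts: "\<And>s t. ((\<lambda>s. \<phi>t s t) has_real_derivative \<phi>ts s t) (at s)"
    and c1: "isCont (\<lambda>z. \<phi>st (fst z) (snd z)) (0, 0)" and c2: "isCont (\<lambda>z. \<phi>ts (fst z) (snd z)) (0, 0)"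
  shows "\<phi>st 0 0 = \<phi>ts 0 0"
proof -
  have ex: "\<exists>p q. p \<in> {0..h} \<times> {0..h} \<and> q \<in> {0..h} \<times> {0..h} \<and> \<phi>st (fst p) (snd p) = \<phi>ts (fst q) (snd q)"
    if h: "h > 0" for h
  proof -
    define \<Delta> where "\<Delta> = (\<phi> h h - \<phi> h 0) - (\<phi> 0 h - \<phi> 0 0)"
    have "((\<lambda>s. \<phi> s h - \<phi> s 0) has_real_derivative \<phi>s s h - \<phi>s s 0) (at s)" for s
      by (intro derivative_intros s)
    from mvt_real[OF h this] obtain a where a: "a \<in> {0..h}" "\<Delta> = h * (\<phi>s a h - \<phi>s a 0)"
      unfolding \<Delta>_def by blast
    from mvt_real[OF h st, of a] obtain b where b: "b \<in> {0..h}" "\<phi>s a h - \<phi>s a 0 = h * \<phi>st a b" by blast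
    have "((\<lambda>t. \<phi> h t - \<phi> 0 t) has_real_derivative \<phi>t h t - \<phi>t 0 t) (at t)" for t
      by (intro derivative_intros t)
    from mvt_real[OF h this] obtain c where c: "c \<in> {0..h}" "\<Delta> = h * (\<phi>t h c - \<phi>t 0 c)"
      unfolding \<Delta>_def by (auto simp: algebra_simps)
    from mvt_real[OF h ts, of c] obtain e where e: "e \<in> {0..h}" "\<phi>t h c - \<phi>t 0 c = h * \<phi>ts e c" by blast
    have "h * (h * \<phi>st a b) = h * (h * \<phi>ts e c)" by (rule trans[OF a(2)[unfolded b(2), symmetric] c(2)[unfolded e(2)]])
    hence "\<phi>st a b = \<phi>ts e c" using h by (metis less_irrefl mult_left_cancel)
    thus ?thesis using a(1) b(1) c(1) e(1) by (intro exI[of _ "(a, b)"] exI[of _ "(e, c)"]) auto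
  qed
  define H where "H = (\<lambda>n. 1 / real (Suc n))"
  have "\<exists>p q. p \<in> {0..H n} \<times> {0..H n} \<and> q \<in> {0..H n} \<times> {0..H n} \<and> \<phi>st (fst p) (snd p) = \<phi>ts (fst q) (snd q)" for n
    by (rule ex) (simp add: H_def)
  then obtain p q where pq: "p n \<in> {0..H n} \<times> {0..H n}" "q n \<in> {0..H n} \<times> {0..H n}"
    "\<phi>st (fst (p n)) (snd (p n)) = \<phi>ts (fst (q n)) (snd (q n))" for n
    by moura
  have H0: "H \<longlonglongrightarrow> 0" unfolding H_def by (rule LIMSEQ_Suc[OF lim_1_over_n])
  have squeeze: "r \<longlonglongrightarrow> (0, 0)" if "\<And>n. r n \<in> {0..H n} \<times> {0..H n}" for r :: "nat \<Rightarrow> real \<times> real"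
  proof -
    have "(\<lambda>n. (fst (r n), snd (r n))) \<longlonglongrightarrow> (0, 0)"
      by (intro tendsto_Pair tendsto_sandwich[OF _ _ tendsto_const H0] always_eventually allI)
         (use that in \<open>auto simp: mem_Times_iff\<close>)
    thus ?thesis by simp
  qed
  have "(\<lambda>n. \<phi>st (fst (p n)) (snd (p n))) \<longlonglongrightarrow> \<phi>st 0 0"
    using isCont_tendsto_compose[OF c1 squeeze[OF pq(1)]] by simp
  moreover have "(\<lambda>n. \<phi>ts (fst (q n)) (snd (q n))) \<longlonglongrightarrow> \<phi>ts 0 0"
    using isCont_tendsto_compose[OF c2 squeeze[OF pq(2)]] by simp
  ultimately show ?thesis using pq(3) by (simp add: LIMSEQ_unique)
qed

lemma partial_commute:
  assumes f: "C_k_vec d (Suc (Suc m)) f" and i: "i < d" and j: "j < d" and x: "x \<in> carrier_vec d"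
  shows "partial i (partial j f) x = partial j (partial i f) x"
proof -
  define P where "P = (\<lambda>s t. x + s \<cdot>\<^sub>v unit_vec d i + t \<cdot>\<^sub>v unit_vec d j)"
  have Pc: "P s t \<in> carrier_vec d" for s t using x by (simp add: P_def)
  have P': "P s t = (x + t \<cdot>\<^sub>v unit_vec d j) + s \<cdot>\<^sub>v unit_vec d i" for s t
    using x by (intro eq_vecI) (auto simp: P_def)
  have ds: "((\<lambda>s. g (P s t)) has_real_derivative partial i g (P s t)) (at s)" if "C_k_vec d (Suc k) g" for g k s t
    unfolding P' using has_partial[OF that i, of "x + t \<cdot>\<^sub>v unit_vec d j" s] x by simp
  have dt: "((\<lambda>t. g (P s t)) has_real_derivative partial j g (P s t)) (at t)" if "C_k_vec d (Suc k) g" for g k s t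
    unfolding P_def using has_partial[OF that j, of "x + s \<cdot>\<^sub>v unit_vec d i" t] x by simp
  have cont: "isCont (\<lambda>z. g (P (fst z) (snd z))) (0, 0)" if "continuous_vec d g" for g
  proof -
    have "continuous_on UNIV (\<lambda>z. g (P (fst z) (snd z)))"
    proof (rule continuous_vec_compose[OF that])
      show "continuous_on UNIV (\<lambda>z. P (fst z) (snd z) $ k)" if "k < d" for k
        using that x by (simp add: P_def) (intro continuous_intros)
    qed (rule Pc)
    thus ?thesis by (simp add: continuous_on_eq_continuous_at)
  qed
  have fi: "C_k_vec d (Suc m) (partial i f)" and fj: "C_k_vec d (Suc m) (partial j f)"
    using C_k_vec_partial[OF f] i j by blast+
  have "partial j (partial i f) (P 0 0) = partial i (partial j f) (P 0 0)"
    by (rule mixed_derivatives_commute[of "\<lambda>s t. f (P s t)" "\<lambda>s t. partial i f (P s t)" "\<lambda>s t. partial j f (P s t)"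
          "\<lambda>s t. partial j (partial i f) (P s t)" "\<lambda>s t. partial i (partial j f) (P s t)"])
       (rule ds[OF f] dt[OF f] ds[OF fj] dt[OF fi] cont C_k_vec_continuous[OF C_k_vec_partial[OF fi j]] C_k_vec_continuous[OF C_k_vec_partial[OF fj i]])+
  moreover have "P 0 0 = x" using x by (intro eq_vecI) (auto simp: P_def)
  ultimately show ?thesis by simp
qed

lemma word_partial_move:
  "C_k_vec d (Suc (length ks)) f \<Longrightarrow> set ks \<subseteq> {..<d} \<Longrightarrow> k < d \<Longrightarrow> x \<in> carrier_vec d \<Longrightarrow>
   word_partial (k # ks) f x = word_partial (ks @ [k]) f x"
proof (induction ks arbitrary: f x)
  case (Cons l ks)
  have f: "C_k_vec d (Suc (Suc (length ks))) f" and l: "l < d" and ks: "set ks \<subseteq> {..<d}" using Cons.prems by auto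
  have "word_partial (k # l # ks) f x = word_partial ks (partial l (partial k f)) x" by simp
  also have "\<dots> = word_partial ks (partial k (partial l f)) x"
    by (rule word_partial_cong[OF partial_commute[OF f l Cons.prems(3)] Cons.prems(4)])
  also have "\<dots> = word_partial (ks @ [k]) (partial l f) x"
    using Cons.IH[OF C_k_vec_partial[OF f l] ks Cons.prems(3,4)] by simp
  finally show ?case by simp
qed simp

lemma word_partial_perm:
  "mset ks = mset ls \<Longrightarrow> C_k_vec d (length ks) f \<Longrightarrow> set ks \<subseteq> {..<d} \<Longrightarrow> x \<in> carrier_vec d \<Longrightarrow>
   word_partial ks f x = word_partial ls f x"
proof (induction ks arbitrary: ls f)
  case (Cons k ks)
  have "k \<in> set ls" using Cons.prems(1) by (metis list.set_intros(1) set_mset_mset)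
  then obtain as bs where ls: "ls = as @ k # bs" by (auto simp: in_set_conv_decomp)
  have ms: "mset ks = mset (as @ bs)" using Cons.prems(1) by (simp add: ls)
  have len: "length ks = length as + length bs" using mset_eq_length[OF ms] by simp
  have st: "set ks = set as \<union> set bs" using mset_eq_setD[OF ms] by simp
  have k: "k < d" and ks: "set ks \<subseteq> {..<d}" using Cons.prems(3) by auto
  have f: "C_k_vec d (Suc (length ks)) f" using Cons.prems(2) by simp
  have fa: "C_k_vec d (Suc (length as)) f" by (rule C_k_vec_mono[OF f]) (simp add: len)
  \<comment> \<open>The letter \<open>k\<close> is moved to its position in the second word past the letters of \<open>as\<close>.\<close>
  have "word_partial (k # ks) f x = word_partial (as @ bs) (partial k f) x"
    using Cons.IH[OF ms C_k_vec_partial[OF f k] ks Cons.prems(4)] by simp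
  also have "\<dots> = word_partial bs (word_partial (k # as) f) x" by (simp add: word_partial_append)
  also have "\<dots> = word_partial bs (word_partial (as @ [k]) f) x"
    by (rule word_partial_cong[OF word_partial_move[OF fa _ k] Cons.prems(4)]) (use ks st in auto)
  also have "\<dots> = word_partial ls f x" by (simp add: ls word_partial_append)
  finally show ?case .
qed simp

primrec index_word :: "nat \<Rightarrow> (nat \<Rightarrow> nat) \<Rightarrow> nat list" where
  "index_word 0 \<alpha> = []"
| "index_word (Suc n) \<alpha> = replicate (\<alpha> n) n @ index_word n \<alpha>"

lemma mixed_partial_eq: "mixed_partial n \<alpha> f = word_partial (index_word n \<alpha>) f"
  by (induction n arbitrary: f) (simp_all add: word_partial_append word_partial_replicate)

lemma count_index_word: "count (mset (index_word n \<alpha>)) k = (if k < n then \<alpha> k else 0)"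
  by (induction n) (auto simp: less_Suc_eq count_replicate_mset)

lemma length_index_word: "length (index_word n \<alpha>) = msize n \<alpha>"
  by (induction n) (auto simp: msize_def)

lemma set_index_word: "set (index_word n \<alpha>) \<subseteq> {..<n}"
  by (induction n) (auto simp: less_Suc_eq)

text \<open>
  By symmetry, bounds for the derivatives along words are bounds for the partial derivatives indexed by
  multi-indices, and conversely.
\<close>

lemma word_partial_as_mixed:
  assumes f: "C_k_vec d (length ks) f" and ks: "set ks \<subseteq> {..<d}"
  shows "\<exists>\<alpha>\<in>multi_indices d. msize d \<alpha> = length ks \<and> (\<forall>x\<in>carrier_vec d. word_partial ks f x = mixed_partial d \<alpha> f x)"
proof -
  define \<alpha> where "\<alpha> = (\<lambda>k\<in>{..<d}. count (mset ks) k)"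
  have ms: "mset ks = mset (index_word d \<alpha>)"
  proof (rule multiset_eqI)
    fix k
    show "count (mset ks) k = count (mset (index_word d \<alpha>)) k"
      using ks by (auto simp: count_index_word \<alpha>_def count_eq_zero_iff)
  qed
  have "msize d \<alpha> = length ks" using mset_eq_length[OF ms] by (simp add: length_index_word)
  moreover have "\<alpha> \<in> multi_indices d" by (simp add: \<alpha>_def)
  moreover have "word_partial ks f x = mixed_partial d \<alpha> f x" if "x \<in> carrier_vec d" for x
    unfolding mixed_partial_eq by (rule word_partial_perm[OF ms f ks that])
  ultimately show ?thesis by blast
qed

section \<open>Lattice points of the standard simplex\<close>

text \<open>
  These are the points \<open>p\<close> of the simplex for which \<open>\<tau> p\<close> lies in the lattice \<open>x + \<int>\<^sup>n\<close>.
\<close>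

definition lattice_points :: "nat \<Rightarrow> (nat \<Rightarrow> real) \<Rightarrow> real \<Rightarrow> real vec set" where
  "lattice_points n x \<tau> = {p \<in> std_simplex n. \<forall>k<n. \<tau> * p $ k - x k \<in> \<int>}"

text \<open>
  The coordinate \<open>k\<close> of \<open>x - \<tau> \<lambda>\<^sub>V\<close> in the basis with index \<open>V\<close>, as \<open>basis_coordinates\<close> shows. It depends
  on \<open>V\<close> only through the entry \<open>k\<close>, which allows one coordinate to be treated at a time.
\<close>

definition em_coord :: "(nat \<Rightarrow> nat) \<Rightarrow> (nat \<Rightarrow> real) \<Rightarrow> real \<Rightarrow> nat \<Rightarrow> real" where
  "em_coord V x \<tau> k = (if V k = 1 then x k else (\<Sum>i\<le>k. x i) - \<tau>)"

definition em_exponents :: "nat \<Rightarrow> nat \<Rightarrow> (nat \<Rightarrow> nat) \<Rightarrow> (nat \<Rightarrow> nat) set" where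
  "em_exponents n w I = {J \<in> multi_indices n. msize n J \<le> w \<and> subindex n J I}"

definition em_term :: "nat \<Rightarrow> (real vec \<Rightarrow> real) \<Rightarrow> (nat \<Rightarrow> real) \<Rightarrow> real \<Rightarrow> (nat \<Rightarrow> nat) \<Rightarrow> (nat \<Rightarrow> nat) \<Rightarrow> (nat \<Rightarrow> nat) \<Rightarrow> real" where
  "em_term n g x \<tau> V I J = \<tau> powi (int n - int (msize n I) - int (msize n J)) * mu n V I J g *
     (\<Prod>k<n. bernoulli_fun (J k + I k) (em_coord V x \<tau> k))"

text \<open>
  This is the main term for the standard simplex, with \<open>bernoulli_fun\<close> in place of the regularized
  periodic functions.
\<close>

definition em_main :: "nat \<Rightarrow> nat \<Rightarrow> (real vec \<Rightarrow> real) \<Rightarrow> (nat \<Rightarrow> real) \<Rightarrow> real \<Rightarrow> real" where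
  "em_main n w g x \<tau> = (\<Sum>V \<in> {..<n} \<rightarrow>\<^sub>E {1, 2}. \<Sum>I \<in> {..<n} \<rightarrow>\<^sub>E {0, 1}. \<Sum>J \<in> em_exponents n w I. em_term n g x \<tau> V I J)"

text \<open>
  The negation of this says that one of finitely many linear functionals of \<open>x\<close>, up to a constant, takes
  an integral value. None of the Bernoulli functions in \<open>em_main\<close> is then evaluated at a discontinuity.
\<close>

definition em_generic :: "nat \<Rightarrow> (nat \<Rightarrow> real) \<Rightarrow> real \<Rightarrow> bool" where
  "em_generic n x \<tau> \<longleftrightarrow> (\<forall>k<n. x k \<notin> \<int> \<and> (\<Sum>i\<le>k. x i) - \<tau> \<notin> \<int>)"

lemma vec_eq_vsnoc:
  assumes "v \<in> carrier_vec (Suc n)"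
  shows "v = vsnoc (vec n (($) v)) (v $ n)"
  using assms by (intro eq_vecI) (auto simp: vsnoc_index less_Suc_eq)

text \<open>
  A point of the simplex in dimension \<open>n + 1\<close> is a point of the simplex in dimension \<open>n\<close> together with a
  parameter on the segment above it; the lattice condition separates in the same way.
\<close>

lemma lattice_points_Suc:
  "lattice_points (Suc n) x \<tau> =
     (\<lambda>(p, t). vsnoc p t) ` (SIGMA p : lattice_points n x \<tau>. lattice_params \<tau> (x n) (1 - vec_total p))"
proof (intro equalityI subsetI)
  fix v assume v: "v \<in> lattice_points (Suc n) x \<tau>"
  define p where "p = vec n (($) v)"
  define t where "t = v $ n"
  have vc: "v \<in> carrier_vec (Suc n)" using v by (auto simp: lattice_points_def std_simplex_def)
  have eq: "v = vsnoc p t" unfolding p_def t_def by (rule vec_eq_vsnoc[OF vc])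
  have pc: "p \<in> carrier_vec n" by (simp add: p_def)
  have pk: "p $ k = v $ k" if "k < n" for k using that by (simp add: p_def)
  have "vsnoc p t \<in> std_simplex (Suc n)" using v eq by (simp add: lattice_points_def)
  hence "p \<in> std_simplex n" "0 \<le> t" "t \<le> 1 - vec_total p" using std_simplex_vsnoc[OF pc] by blast+
  moreover have "\<tau> * t - x n \<in> \<int>" "\<forall>k<n. \<tau> * p $ k - x k \<in> \<int>"
    using v pk by (auto simp: lattice_points_def t_def)
  ultimately show "v \<in> (\<lambda>(p, t). vsnoc p t) ` (SIGMA p : lattice_points n x \<tau>. lattice_params \<tau> (x n) (1 - vec_total p))"
    unfolding eq by (auto simp: lattice_points_def lattice_params_def)
next
  fix v assume "v \<in> (\<lambda>(p, t). vsnoc p t) ` (SIGMA p : lattice_points n x \<tau>. lattice_params \<tau> (x n) (1 - vec_total p))"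
  then obtain p t where pt: "v = vsnoc p t" "p \<in> lattice_points n x \<tau>" "t \<in> lattice_params \<tau> (x n) (1 - vec_total p)" by auto
  have pc: "p \<in> carrier_vec n" using pt(2) by (auto simp: lattice_points_def std_simplex_def)
  have "v \<in> std_simplex (Suc n)"
    unfolding pt(1) std_simplex_vsnoc[OF pc] using pt(2,3) by (auto simp: lattice_points_def lattice_params_def)
  moreover have "\<tau> * v $ k - x k \<in> \<int>" if "k < Suc n" for k
    using that pc pt by (cases "k < n") (auto simp: vsnoc_index lattice_points_def lattice_params_def less_Suc_eq)
  ultimately show "v \<in> lattice_points (Suc n) x \<tau>" by (simp add: lattice_points_def)
qed

lemma lattice_points_0: "lattice_points 0 x \<tau> = {vNil}"
  by (auto simp: lattice_points_def std_simplex_def vec_total_def)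

lemma vsnoc_inj: "vsnoc p t = vsnoc p' t' \<Longrightarrow> p = p' \<and> t = t'"
proof -
  assume eq: "vsnoc p t = vsnoc p' t'"
  have d: "dim_vec p = dim_vec p'" using arg_cong[OF eq, of dim_vec] by simp
  hence k: "k < Suc (dim_vec p) \<Longrightarrow> (if k < dim_vec p then p $ k else t) = (if k < dim_vec p then p' $ k else t')" for k
    using vsnoc_index[of k p t] vsnoc_index[of k p' t'] d eq by simp
  show ?thesis
  proof
    show "p = p'"
    proof (rule eq_vecI)
      fix i assume "i < dim_vec p'"
      thus "p $ i = p' $ i" using k[of i] d by simp
    qed (rule d)
    show "t = t'" using k[of "dim_vec p"] by simp
  qed
qed

lemma finite_lattice_points: "\<tau> > 0 \<Longrightarrow> finite (lattice_points n x \<tau>)"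
  by (induction n) (auto simp: lattice_points_0 lattice_points_Suc finite_lattice_params intro!: finite_imageI finite_SigmaI)

lemma sum_lattice_points_Suc:
  assumes "\<tau> > 0"
  shows "(\<Sum>p\<in>lattice_points (Suc n) x \<tau>. g p) =
     (\<Sum>p\<in>lattice_points n x \<tau>. \<Sum>t\<in>lattice_params \<tau> (x n) (1 - vec_total p). g (vsnoc p t))"
proof -
  have "(\<Sum>p\<in>lattice_points (Suc n) x \<tau>. g p) =
    (\<Sum>(p, t)\<in>(SIGMA p : lattice_points n x \<tau>. lattice_params \<tau> (x n) (1 - vec_total p)). g (vsnoc p t))"
    unfolding lattice_points_Suc
    by (subst sum.reindex) (auto simp: inj_on_def case_prod_unfold dest!: vsnoc_inj)
  also have "\<dots> = (\<Sum>p\<in>lattice_points n x \<tau>. \<Sum>t\<in>lattice_params \<tau> (x n) (1 - vec_total p). g (vsnoc p t))"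
    by (rule sum.Sigma[symmetric]) (auto simp: finite_lattice_points finite_lattice_params assms)
  finally show ?thesis .
qed

lemma card_lattice_points:
  assumes "\<tau> > 0"
  shows "real (card (lattice_points n x \<tau>)) \<le> (\<tau> + 1) ^ n"
proof (induction n)
  case (Suc n)
  have "real (card (lattice_points (Suc n) x \<tau>)) = (\<Sum>p\<in>lattice_points (Suc n) x \<tau>. 1)" by simp
  also have "\<dots> = (\<Sum>p\<in>lattice_points n x \<tau>. real (card (lattice_params \<tau> (x n) (1 - vec_total p))))"
    by (subst sum_lattice_points_Suc[OF assms]) simp
  also have "\<dots> \<le> (\<Sum>p\<in>lattice_points n x \<tau>. \<tau> + 1)"
  proof (rule sum_mono)
    fix p assume "p \<in> lattice_points n x \<tau>"
    hence s: "0 \<le> 1 - vec_total p" "1 - vec_total p \<le> 1"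
      using std_simplex_total by (auto simp: lattice_points_def)
    have "real (card (lattice_params \<tau> (x n) (1 - vec_total p))) \<le> \<tau> * (1 - vec_total p) + 1"
      by (rule card_lattice_params_le[OF assms s(1)])
    also have "\<dots> \<le> \<tau> + 1" using s assms by (simp add: mult_left_le)
    finally show "real (card (lattice_params \<tau> (x n) (1 - vec_total p))) \<le> \<tau> + 1" .
  qed
  also have "\<dots> \<le> (\<tau> + 1) ^ Suc n" using Suc assms by (simp add: mult.commute mult_left_mono)
  finally show ?case .
qed (simp add: lattice_points_0)

section \<open>Recursion of the main term in the dimension\<close>

lemma sum_PiE_Suc:
  assumes "finite A"
  shows "(\<Sum>V\<in>{..<Suc n} \<rightarrow>\<^sub>E A. F V) = (\<Sum>a\<in>A. \<Sum>V\<in>{..<n} \<rightarrow>\<^sub>E A. F (V(n := a)))"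
proof -
  have "(\<Sum>V\<in>{..<Suc n} \<rightarrow>\<^sub>E A. F V) = (\<Sum>(a, V)\<in>A \<times> ({..<n} \<rightarrow>\<^sub>E A). F (V(n := a)))"
  proof (rule sum.reindex_bij_witness[of _ "\<lambda>(a, V). V(n := a)" "\<lambda>V. (V n, restrict V {..<n})"])
    fix V assume V: "V \<in> {..<Suc n} \<rightarrow>\<^sub>E A"
    have eq: "(restrict V {..<n})(n := V n) = V"
      using V by (auto simp: PiE_iff extensional_def fun_eq_iff)
    show "(case (V n, restrict V {..<n}) of (a, V) \<Rightarrow> V(n := a)) = V" by (simp only: prod.case eq)
    show "(case (V n, restrict V {..<n}) of (a, V) \<Rightarrow> F (V(n := a))) = F V" by (simp only: prod.case eq)
    show "(V n, restrict V {..<n}) \<in> A \<times> ({..<n} \<rightarrow>\<^sub>E A)"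
      by (simp add: restrict_PiE_iff PiE_mem[OF V])
  next
    fix b assume "b \<in> A \<times> ({..<n} \<rightarrow>\<^sub>E A)"
    then obtain a V where b: "b = (a, V)" "a \<in> A" "V \<in> {..<n} \<rightarrow>\<^sub>E A" by blast
    show "(case b of (a, V) \<Rightarrow> V(n := a)) \<in> {..<Suc n} \<rightarrow>\<^sub>E A"
      using PiE_fun_upd[OF b(2,3), of n] unfolding b(1) lessThan_Suc by simp
    have "restrict (V(n := a)) {..<n} = V"
      by (rule extensionalityI[of _ "{..<n}"]) (use PiE_iff[of V] b(3) in auto)
    thus "((case b of (a, V) \<Rightarrow> V(n := a)) n, restrict (case b of (a, V) \<Rightarrow> V(n := a)) {..<n}) = b"
      by (simp add: b(1))
  qed
  thus ?thesis by (simp add: sum.cartesian_product)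
qed

lemma finite_em_exponents: "finite (em_exponents n w I)"
proof (rule finite_subset)
  show "em_exponents n w I \<subseteq> {..<n} \<rightarrow>\<^sub>E {..w}"
  proof
    fix J assume J: "J \<in> em_exponents n w I"
    have "J k \<le> w" if "k < n" for k
    proof -
      have "J k \<le> msize n J" unfolding msize_def using that by (intro member_le_sum) auto
      thus ?thesis using J by (simp add: em_exponents_def)
    qed
    thus "J \<in> {..<n} \<rightarrow>\<^sub>E {..w}" using J by (auto simp: em_exponents_def PiE_iff)
  qed
qed (simp add: finite_PiE)

text \<open>
  The admissible last entries of \<open>J\<close> when the last entry of \<open>I\<close> is \<open>i\<close>, apart from the bound on the sum,
  which passes to the order \<open>w - j\<close> for the remaining entries.
\<close>

definition last_exponents :: "nat \<Rightarrow> nat \<Rightarrow> nat set" where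
  "last_exponents w i = (if i = 0 then {0} else {..w})"

lemma upd_restrict: "J \<in> em_exponents (Suc n) w I \<Longrightarrow> (restrict J {..<n})(n := J n) = J"
  by (auto simp: em_exponents_def PiE_iff extensional_def fun_eq_iff)

lemma sum_em_exponents_Suc:
  "(\<Sum>J\<in>em_exponents (Suc n) w (I(n := i)). F J) =
   (\<Sum>j\<in>last_exponents w i. \<Sum>J\<in>em_exponents n (w - j) I. F (J(n := j)))"
proof -
  have "(\<Sum>J\<in>em_exponents (Suc n) w (I(n := i)). F J) =
     (\<Sum>(j, J)\<in>(SIGMA j : last_exponents w i. em_exponents n (w - j) I). F (J(n := j)))"
  proof (rule sum.reindex_bij_witness[of _ "\<lambda>(j, J). J(n := j)" "\<lambda>J. (J n, restrict J {..<n})"])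
    fix J assume J: "J \<in> em_exponents (Suc n) w (I(n := i))"
    show "(case (J n, restrict J {..<n}) of (j, J) \<Rightarrow> J(n := j)) = J"
      by (simp only: prod.case upd_restrict[OF J])
    show "(case (J n, restrict J {..<n}) of (j, J) \<Rightarrow> F (J(n := j))) = F J"
      by (simp only: prod.case upd_restrict[OF J])
    show "(J n, restrict J {..<n}) \<in> (SIGMA j : last_exponents w i. em_exponents n (w - j) I)"
      using J by (auto simp: PiE_iff em_exponents_def msize_def subindex_def last_exponents_def less_Suc_eq)
  next
    fix b assume b: "b \<in> (SIGMA j : last_exponents w i. em_exponents n (w - j) I)"
    thus "(case b of (j, J) \<Rightarrow> J(n := j)) \<in> em_exponents (Suc n) w (I(n := i))"
      by (auto simp: PiE_iff extensional_def em_exponents_def msize_def subindex_def last_exponents_def less_Suc_eq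
            split: if_splits)
    show "((case b of (j, J) \<Rightarrow> J(n := j)) n, restrict (case b of (j, J) \<Rightarrow> J(n := j)) {..<n}) = b"
      using b by (auto simp: PiE_iff extensional_def fun_eq_iff em_exponents_def)
  qed
  also have "\<dots> = (\<Sum>j\<in>last_exponents w i. \<Sum>J\<in>em_exponents n (w - j) I. F (J(n := j)))"
    by (rule sum.Sigma[symmetric]) (auto simp: finite_em_exponents last_exponents_def)
  finally show ?thesis .
qed

lemma mu_cong:
  "(\<And>k. k < n \<Longrightarrow> V k = V' k \<and> I k = I' k \<and> J k = J' k) \<Longrightarrow> mu n V I J g = mu n V' I' J' g"
  by (induction n arbitrary: g) auto

lemma em_term_Suc:
  assumes "\<tau> > 0"
  shows "em_term (Suc n) g x \<tau> (V(n := v)) (I(n := i)) (J(n := j)) =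
    \<tau> powi (1 - int i - int j) * bernoulli_fun (j + i) (em_coord (\<lambda>_. v) x \<tau> n) * em_term n (T_op v i j g) x \<tau> V I J"
proof -
  have "mu n (V(n := v)) (I(n := i)) (J(n := j)) (T_op v i j g) = mu n V I J (T_op v i j g)"
    by (rule mu_cong) auto
  moreover have "(\<Prod>k<n. bernoulli_fun ((J(n := j)) k + (I(n := i)) k) (em_coord (V(n := v)) x \<tau> k)) =
      (\<Prod>k<n. bernoulli_fun (J k + I k) (em_coord V x \<tau> k))"
    by (rule prod.cong) (auto simp: em_coord_def)
  moreover have "msize (Suc n) (I(n := i)) = msize n I + i" "msize (Suc n) (J(n := j)) = msize n J + j"
    by (simp_all add: msize_def)
  moreover have "\<tau> powi (int (Suc n) - int (msize n I + i) - int (msize n J + j)) =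
      \<tau> powi (1 - int i - int j) * \<tau> powi (int n - int (msize n I) - int (msize n J))"
    using assms by (subst power_int_add[symmetric]) (auto simp: algebra_simps)
  ultimately show ?thesis
    by (simp add: em_term_def em_coord_def)
qed

text \<open>
  The sum over the last entries of \<open>V\<close>, \<open>I\<close> and \<open>J\<close> comes out, and what remains is the main term, of order
  \<open>w - j\<close>, for the function \<open>T g\<close> in one dimension less.
\<close>

lemma em_main_Suc:
  assumes "\<tau> > 0"
  shows "em_main (Suc n) w g x \<tau> = (\<Sum>v\<in>{1, 2}. \<Sum>i\<in>{0, 1}. \<Sum>j\<in>last_exponents w i.
    \<tau> powi (1 - int i - int j) * bernoulli_fun (j + i) (em_coord (\<lambda>_. v) x \<tau> n) * em_main n (w - j) (T_op v i j g) x \<tau>)"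
proof -
  let ?P = "\<lambda>n A. {..<n} \<rightarrow>\<^sub>E A :: (nat \<Rightarrow> nat) set"
  have "em_main (Suc n) w g x \<tau> = (\<Sum>v\<in>{1, 2}. \<Sum>V\<in>?P n {1, 2}. \<Sum>i\<in>{0, 1}. \<Sum>I\<in>?P n {0, 1}. \<Sum>j\<in>last_exponents w i.
     \<Sum>J\<in>em_exponents n (w - j) I. em_term (Suc n) g x \<tau> (V(n := v)) (I(n := i)) (J(n := j)))"
    unfolding em_main_def by (simp only: sum_PiE_Suc finite.intros sum_em_exponents_Suc)
  also have "\<dots> = (\<Sum>v\<in>{1, 2}. \<Sum>V\<in>?P n {1, 2}. \<Sum>i\<in>{0, 1}. \<Sum>j\<in>last_exponents w i. \<Sum>I\<in>?P n {0, 1}.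
     \<Sum>J\<in>em_exponents n (w - j) I. em_term (Suc n) g x \<tau> (V(n := v)) (I(n := i)) (J(n := j)))"
    by (rule sum.cong[OF refl], rule sum.cong[OF refl], rule sum.cong[OF refl], rule sum.swap)
  also have "\<dots> = (\<Sum>v\<in>{1, 2}. \<Sum>i\<in>{0, 1}. \<Sum>V\<in>?P n {1, 2}. \<Sum>j\<in>last_exponents w i. \<Sum>I\<in>?P n {0, 1}.
     \<Sum>J\<in>em_exponents n (w - j) I. em_term (Suc n) g x \<tau> (V(n := v)) (I(n := i)) (J(n := j)))"
    by (rule sum.cong[OF refl], rule sum.swap)
  also have "\<dots> = (\<Sum>v\<in>{1, 2}. \<Sum>i\<in>{0, 1}. \<Sum>j\<in>last_exponents w i. \<Sum>V\<in>?P n {1, 2}. \<Sum>I\<in>?P n {0, 1}.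
     \<Sum>J\<in>em_exponents n (w - j) I. em_term (Suc n) g x \<tau> (V(n := v)) (I(n := i)) (J(n := j)))"
    by (rule sum.cong[OF refl], rule sum.cong[OF refl], rule sum.swap)
  also have "\<dots> = (\<Sum>v\<in>{1, 2}. \<Sum>i\<in>{0, 1}. \<Sum>j\<in>last_exponents w i.
    \<tau> powi (1 - int i - int j) * bernoulli_fun (j + i) (em_coord (\<lambda>_. v) x \<tau> n) * em_main n (w - j) (T_op v i j g) x \<tau>)"
    unfolding em_term_Suc[OF assms] em_main_def by (simp only: sum_distrib_left)
  finally show ?thesis .
qed

section \<open>The expansion over the standard simplex at generic points\<close>

text \<open>
  The one-dimensional formula on the segment over \<open>p\<close>. Its upper end has the phase
  \<open>x\<^sub>n - \<tau> (1 - vec_total p)\<close>, which differs from \<open>(\<Sum>i\<le>n. x i) - \<tau>\<close> by the sum of the integers \<open>\<tau> p\<^sub>k - x\<^sub>k\<close>. The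
  Bernoulli functions do not see the difference, and so their values do not depend on \<open>p\<close>.
\<close>

lemma em_last_coordinate:
  assumes \<tau>: "\<tau> > 0" and g: "C_k_vec (Suc n) (Suc w) g" and gen: "x n \<notin> \<int>" "(\<Sum>i\<le>n. x i) - \<tau> \<notin> \<int>"
    and p: "p \<in> lattice_points n x \<tau>"
    and K: "\<And>y. y \<in> std_simplex (Suc n) \<Longrightarrow> \<bar>word_partial (replicate (Suc w) n) g y\<bar> \<le> K"
    and B: "\<And>u. \<bar>bernoulli_fun (Suc w) u\<bar> \<le> B" "\<And>u. u \<in> {0..1} \<Longrightarrow> \<bar>poly (bernoulli_poly (Suc w)) u\<bar> \<le> B"
  shows "\<bar>(\<Sum>t\<in>lattice_params \<tau> (x n) (1 - vec_total p). g (vsnoc p t)) -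
    (\<Sum>v\<in>{1, 2}. \<Sum>i\<in>{0, 1}. \<Sum>j\<in>last_exponents w i.
      \<tau> powi (1 - int i - int j) * bernoulli_fun (j + i) (em_coord (\<lambda>_. v) x \<tau> n) * T_op v i j g p)\<bar> \<le> (1 / \<tau>) ^ w * (K * B)"
proof -
  define s where "s = 1 - vec_total p"
  define h where "h = (\<lambda>j t. word_partial (replicate j n) g (vsnoc p t))"
  have ps: "p \<in> std_simplex n" and pk: "\<And>k. k < n \<Longrightarrow> \<tau> * p $ k - x k \<in> \<int>"
    using p by (auto simp: lattice_points_def)
  note pc = std_simplex_carrier[OF ps]
  have s: "0 \<le> s" "s \<le> 1" using std_simplex_total[OF ps] by (auto simp: s_def)
  have Ck: "C_k_vec (Suc n) (Suc w - j) (word_partial (replicate j n) g)" if "j \<le> Suc w" for j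
    by (rule C_k_vec_word_partial) (use g that in \<open>auto simp: set_replicate_conv_if\<close>)
  have h: "(h j has_real_derivative h (Suc j) t) (at t)" if "j \<le> w" for j t
  proof -
    have eq: "vsnoc p 0 + t \<cdot>\<^sub>v unit_vec (Suc n) n = vsnoc p t" for t
      using pc by (intro eq_vecI) (auto simp: vsnoc_index less_Suc_eq)
    have C: "C_k_vec (Suc n) (Suc (w - j)) (word_partial (replicate j n) g)" using Ck[of j] that by (simp add: Suc_diff_le)
    have "((\<lambda>t. word_partial (replicate j n) g (vsnoc p t)) has_real_derivative partial n (word_partial (replicate j n) g) (vsnoc p t)) (at t)"
      using has_partial[OF C, of n "vsnoc p 0" t] pc unfolding eq by simp
    moreover have "partial n (word_partial (replicate j n) g) = word_partial (replicate (Suc j) n) g"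
      by (simp add: word_partial_replicate funpow_swap1)
    ultimately show ?thesis by (simp add: h_def)
  qed
  have cont: "continuous_on UNIV (h (Suc w))"
    unfolding h_def by (rule continuous_on_slice[OF C_k_vec_continuous[OF Ck] pc]) simp
  \<comment> \<open>The phases at the upper end and in the expansion agree modulo integers.\<close>
  have int: "x n - \<tau> * s - ((\<Sum>i\<le>n. x i) - \<tau>) \<in> \<int>"
  proof -
    have "x n - \<tau> * s - ((\<Sum>i\<le>n. x i) - \<tau>) = (\<Sum>k<n. \<tau> * p $ k - x k)"
    proof -
      have "(\<Sum>i\<le>n. x i) = (\<Sum>i<n. x i) + x n" by (simp flip: lessThan_Suc_atMost)
      moreover have "(\<Sum>k<n. \<tau> * p $ k - x k) = \<tau> * vec_total p - (\<Sum>k<n. x k)"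
        using pc by (simp add: vec_total_def sum_subtractf sum_distrib_left)
      ultimately show ?thesis by (simp add: s_def right_diff_distrib)
    qed
    also have "\<dots> \<in> \<int>" by (intro Ints_sum pk) auto
    finally show ?thesis .
  qed
  have xs: "x n - \<tau> * s \<notin> \<int>"
  proof
    assume "x n - \<tau> * s \<in> \<int>"
    from Ints_diff[OF this int] gen(2) show False by simp
  qed
  have Btop: "bernoulli_frac m (x n - \<tau> * s) = bernoulli_fun m ((\<Sum>i\<le>n. x i) - \<tau>)" for m
    using bernoulli_fun_add_Int[OF int, of m "(\<Sum>i\<le>n. x i) - \<tau>"] bernoulli_fun_nonint[OF xs, of m] by (simp add: bernoulli_frac_def)
  have Bbot: "bernoulli_frac m (x n) = bernoulli_fun m (x n)" for m
    by (simp add: bernoulli_frac_def bernoulli_fun_nonint[OF gen(1)])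
  have hK: "\<bar>h (Suc w) t\<bar> \<le> K" if "t \<in> {0..s}" for t
    unfolding h_def by (rule K) (use that ps in \<open>auto simp: std_simplex_vsnoc[OF pc] s_def\<close>)
  have bK: "\<bar>bernoulli_frac (Suc w) u\<bar> \<le> B" for u
    unfolding bernoulli_frac_def by (rule B(2)) (use frac_ge_0[of u] frac_lt_1[of u] in auto)
  have main: "\<bar>(\<Sum>t\<in>lattice_params \<tau> (x n) s. h 0 t) - (\<tau> * integral {0..s} (h 0) + (\<Sum>j\<le>w. (1/\<tau>) ^ j *
        (h j s * bernoulli_frac (Suc j) (x n - \<tau> * s) - h j 0 * bernoulli_frac (Suc j) (x n))))\<bar> \<le> (1/\<tau>) ^ w * (K * B)"
    by (rule euler_maclaurin_bound[OF \<tau> s gen(1) xs h cont hK bK])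
  have I0: "T_op (Suc 0) 0 0 g p = integral {0..s} (h 0)"
    using oriented_integral_rescale(2)[OF continuous_on_slice[OF C_k_vec_continuous[OF g] pc] s(1)]
    by (simp add: T_op_integral slice_integral_def s_def h_def)
  have pow: "\<tau> powi (1 - int (Suc 0) - int j) = (1 / \<tau>) ^ j" for j
  proof -
    have "\<tau> powi (1 - int (Suc 0) - int j) = \<tau> powi (- int j)" by simp
    also have "\<dots> = inverse (\<tau> ^ j)" unfolding power_int_minus power_int_of_nat ..
    also have "\<dots> = (1 / \<tau>) ^ j" by (simp add: power_one_over inverse_eq_divide)
    finally show ?thesis .
  qed
  have e: "em_coord (\<lambda>_. Suc 0) x \<tau> n = x n" "em_coord (\<lambda>_. 2) x \<tau> n = (\<Sum>i\<le>n. x i) - \<tau>"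
    by (simp_all add: em_coord_def)
  let ?S = "\<lambda>v i. \<Sum>j\<in>last_exponents w i.
      \<tau> powi (1 - int i - int j) * bernoulli_fun (j + i) (em_coord (\<lambda>_. v) x \<tau> n) * T_op v i j g p"
  have "?S (Suc 0) 0 = \<tau> * integral {0..s} (h 0)"
    by (simp add: last_exponents_def I0)
  moreover have "?S 2 0 = 0" by (simp add: last_exponents_def T_op_integral(2))
  moreover have "?S (Suc 0) (Suc 0) = (\<Sum>j\<le>w. (1/\<tau>) ^ j * (- (h j 0 * bernoulli_fun (Suc j) (x n))))"
  proof (rule sum.cong)
    fix j assume "j \<in> {..w}"
    show "\<tau> powi (1 - int (Suc 0) - int j) * bernoulli_fun (j + Suc 0) (em_coord (\<lambda>_. Suc 0) x \<tau> n) * T_op (Suc 0) (Suc 0) j g p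
      = (1/\<tau>) ^ j * (- (h j 0 * bernoulli_fun (Suc j) (x n)))"
      unfolding pow e T_op_ends[OF pc] by (simp add: h_def mult_ac)
  qed (simp add: last_exponents_def)
  moreover have "?S 2 (Suc 0) = (\<Sum>j\<le>w. (1/\<tau>) ^ j * (h j s * bernoulli_fun (Suc j) ((\<Sum>i\<le>n. x i) - \<tau>)))"
  proof (rule sum.cong)
    fix j assume "j \<in> {..w}"
    show "\<tau> powi (1 - int (Suc 0) - int j) * bernoulli_fun (j + Suc 0) (em_coord (\<lambda>_. 2) x \<tau> n) * T_op 2 (Suc 0) j g p
      = (1/\<tau>) ^ j * (h j s * bernoulli_fun (Suc j) ((\<Sum>i\<le>n. x i) - \<tau>))"
      unfolding pow e T_op_ends[OF pc] by (simp add: h_def s_def mult_ac)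
  qed (simp add: last_exponents_def)
  ultimately have "(\<Sum>v\<in>{1, 2}. \<Sum>i\<in>{0, 1}. ?S v i) =
      \<tau> * integral {0..s} (h 0) + (\<Sum>j\<le>w. (1/\<tau>) ^ j * (- (h j 0 * bernoulli_fun (Suc j) (x n))))
       + (\<Sum>j\<le>w. (1/\<tau>) ^ j * (h j s * bernoulli_fun (Suc j) ((\<Sum>i\<le>n. x i) - \<tau>)))"
    by simp
  also have "\<dots> = \<tau> * integral {0..s} (h 0) + (\<Sum>j\<le>w. (1/\<tau>) ^ j *
        (h j s * bernoulli_frac (Suc j) (x n - \<tau> * s) - h j 0 * bernoulli_frac (Suc j) (x n)))"
    unfolding Btop Bbot by (simp add: right_diff_distrib sum_subtractf sum_negf)
  finally show ?thesis using main by (simp add: h_def s_def)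
qed

text \<open>
  The bookkeeping of one term in the induction below. The functions \<open>T g\<close> have derivatives bounded by
  \<open>2\<^sup>w\<^sup>-\<^sup>j\<^sup>+\<^sup>1 K\<close>, so that the base \<open>2\<^sup>n / 2\<close> becomes \<open>2\<^sup>n\<^sup>+\<^sup>1 / 2\<close>, while the Bernoulli factor supplies the missing
  powers of \<open>\<rho>\<close>. For \<open>i = 1\<close> a spare factor \<open>1 / \<tau>\<close> appears, which is bounded since \<open>\<tau> > \<tau>\<^sub>0\<close>.
\<close>

lemma em_step_arith:
  fixes \<tau> :: real
  assumes \<tau>: "\<tau> > \<tau>\<^sub>0" "\<tau>\<^sub>0 > 0" and \<rho>: "\<rho> > 0" and A: "A \<ge> 0" and C: "C \<ge> 0" and K: "K \<ge> 0"
    and j: "j \<le> w" and i: "i \<in> {0, 1 :: nat}" and b: "\<bar>b\<bar> \<le> A * \<rho> ^ (j + i)"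
    and R: "\<bar>R\<bar> \<le> C * real (w - j + 1) ^ n * \<tau> powi (int n - int (w - j) - 1) * (2 ^ n / 2 * \<rho>) ^ (w - j + 1) * (2 ^ (w - j + 1) * K)"
  shows "\<bar>\<tau> powi (1 - int i - int j) * b * R\<bar> \<le>
    A * (1 + \<rho>) * (1 + 1 / \<tau>\<^sub>0) * C * real (w + 1) ^ n * \<tau> powi (int (Suc n) - int w - 1) * (2 ^ Suc n / 2 * \<rho>) ^ (w + 1) * K"
proof -
  have t0: "\<tau> > 0" using \<tau> by simp
  have "\<bar>\<tau> powi (1 - int i - int j) * b * R\<bar> = \<tau> powi (1 - int i - int j) * \<bar>b\<bar> * \<bar>R\<bar>"
    using t0 by (simp add: abs_mult power_int_abs)
  also have "\<dots> \<le> \<tau> powi (1 - int i - int j) * (A * \<rho> ^ (j + i)) *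
      (C * real (w - j + 1) ^ n * \<tau> powi (int n - int (w - j) - 1) * (2 ^ n / 2 * \<rho>) ^ (w - j + 1) * (2 ^ (w - j + 1) * K))"
    using t0 A \<rho> by (intro mult_mono b R order_refl mult_nonneg_nonneg) auto
  also have "\<dots> = A * C * K * (real (w - j + 1) ^ n) * (\<tau> powi (1 - int i - int j) * \<tau> powi (int n - int (w - j) - 1))
      * (\<rho> ^ (j + i) * ((2 ^ n / 2 * \<rho>) ^ (w - j + 1) * 2 ^ (w - j + 1)))"
    by (simp only: mult_ac)
  also have "\<tau> powi (1 - int i - int j) * \<tau> powi (int n - int (w - j) - 1) = \<tau> powi (int (Suc n) - int w - 1) * \<tau> powi (- int i)"
  proof -
    have "1 - int i - int j + (int n - int (w - j) - 1) = (int (Suc n) - int w - 1) + (- int i)"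
      using j by (simp add: of_nat_diff)
    hence "\<tau> powi (1 - int i - int j + (int n - int (w - j) - 1)) = \<tau> powi ((int (Suc n) - int w - 1) + (- int i))"
      by (rule arg_cong)
    moreover have nz: "\<tau> \<noteq> 0" using t0 by simp
    ultimately show ?thesis by (simp only: power_int_add[OF disjI1[OF nz]])
  qed
  also have "\<rho> ^ (j + i) * ((2 ^ n / 2 * \<rho>) ^ (w - j + 1) * 2 ^ (w - j + 1)) = \<rho> ^ i * (\<rho> ^ (w + 1) * (2 ^ n) ^ (w - j + 1))"
  proof -
    have "(2 ^ n / 2 * \<rho>) ^ (w - j + 1) * 2 ^ (w - j + 1) = (2 ^ n * \<rho>) ^ (w - j + 1)"
      unfolding power_mult_distrib[symmetric] by simp
    hence "\<rho> ^ (j + i) * ((2 ^ n / 2 * \<rho>) ^ (w - j + 1) * 2 ^ (w - j + 1)) = \<rho> ^ (j + i) * (2 ^ n * \<rho>) ^ (w - j + 1)"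
      by simp
    also have "\<dots> = (\<rho> ^ (j + i) * \<rho> ^ (w - j + 1)) * (2 ^ n) ^ (w - j + 1)"
      by (simp only: power_mult_distrib mult_ac)
    also have "\<rho> ^ (j + i) * \<rho> ^ (w - j + 1) = \<rho> ^ i * \<rho> ^ (w + 1)"
      unfolding power_add[symmetric] using j by simp
    finally show ?thesis by (simp only: mult_ac)
  qed
  also have "A * C * K * (real (w - j + 1) ^ n) * (\<tau> powi (int (Suc n) - int w - 1) * \<tau> powi (- int i)) * (\<rho> ^ i * (\<rho> ^ (w + 1) * (2 ^ n) ^ (w - j + 1)))
    \<le> A * C * K * (real (w + 1) ^ n) * (\<tau> powi (int (Suc n) - int w - 1) * (1 + 1 / \<tau>\<^sub>0)) * ((1 + \<rho>) * (\<rho> ^ (w + 1) * (2 ^ n) ^ (w + 1)))"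
  proof -
    have 1: "\<tau> powi (- int i) \<le> 1 + 1 / \<tau>\<^sub>0"
    proof (cases "i = 0")
      case True
      thus ?thesis using \<tau> by simp
    next
      case False
      hence "i = 1" using i by simp
      moreover have "1 / \<tau> \<le> 1 / \<tau>\<^sub>0" using \<tau> by (simp add: frac_le)
      ultimately show ?thesis by (simp add: power_int_minus inverse_eq_divide)
    qed
    have 2: "\<rho> ^ i \<le> 1 + \<rho>" using i \<rho> by auto
    have 3: "(2 ^ n :: real) ^ (w - j + 1) \<le> (2 ^ n) ^ (w + 1)" by (rule power_increasing) auto
    have 4: "real (w - j + 1) ^ n \<le> real (w + 1) ^ n" by (rule power_mono) auto
    show ?thesis
      using A C K \<rho> t0 \<tau> by (intro mult_mono 1 2 3 4 order_refl mult_nonneg_nonneg) auto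
  qed
  also have "\<dots> = A * (1 + \<rho>) * (1 + 1 / \<tau>\<^sub>0) * C * real (w + 1) ^ n * \<tau> powi (int (Suc n) - int w - 1) * (2 ^ Suc n / 2 * \<rho>) ^ (w + 1) * K"
  proof -
    have "(2 ^ Suc n / 2 * \<rho>) ^ (w + 1) = \<rho> ^ (w + 1) * (2 ^ n) ^ (w + 1)"
      unfolding power_mult_distrib[symmetric] by (simp add: mult.commute)
    thus ?thesis by (simp only: mult_ac)
  qed
  finally show ?thesis .
qed

text \<open>
  Induction on the dimension. The error has two parts: the error of the one-dimensional formula for the
  last coordinate, summed over the at most \<open>(\<tau> + 1)\<^sup>n\<close> lattice points below, and the errors
  of the expansions in dimension \<open>n\<close> for the functions \<open>T g\<close>. The number of the latter is proportional to
  \<open>w + 1\<close>, hence the power of \<open>w + 1\<close> in the bound. The words of derivatives may be up to \<open>n - 1\<close> shorter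
  than \<open>w + 1\<close>, one for each coordinate that may be integrated; for \<open>n = 1\<close> only the order \<open>w + 1\<close>
  enters, as in the classical formula.
\<close>

lemma em_bound:
  assumes \<tau>0: "\<tau>\<^sub>0 > 0" and \<rho>: "\<rho> > 1 / (2 * pi)"
  shows "\<exists>C\<ge>0. \<forall>w g x \<tau> K. C_k_vec n (Suc w) g \<longrightarrow> \<tau> > \<tau>\<^sub>0 \<longrightarrow> em_generic n x \<tau> \<longrightarrow> K \<ge> 0 \<longrightarrow>
     (\<forall>ks y. set ks \<subseteq> {..<n} \<longrightarrow> length ks \<le> w + 1 \<longrightarrow> w + 2 \<le> length ks + n \<longrightarrow> y \<in> std_simplex n \<longrightarrow> \<bar>word_partial ks g y\<bar> \<le> K) \<longrightarrow>
     \<bar>(\<Sum>p\<in>lattice_points n x \<tau>. g p) - em_main n w g x \<tau>\<bar> \<le>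
       C * real (w + 1) ^ n * \<tau> powi (int n - int w - 1) * (2 ^ n / 2 * \<rho>) ^ (w + 1) * K"
proof (induction n)
  case 0
  have "(\<Sum>p\<in>lattice_points 0 x \<tau>. g p) - em_main 0 w g x \<tau> = 0" for w g x \<tau>
  proof -
    have "em_exponents 0 w (\<lambda>_. undefined) = {\<lambda>_. undefined}"
      by (auto simp: em_exponents_def msize_def subindex_def)
    thus ?thesis by (simp add: lattice_points_0 em_main_def em_term_def msize_def)
  qed
  thus ?case by (intro exI[of _ 0]) simp
next
  case (Suc n)
  have \<rho>0: "\<rho> > 0" using \<rho> by (smt (verit) divide_pos_pos pi_gt_zero)
  obtain A where A: "A \<ge> 1" "\<And>m u. u \<in> {0..1} \<Longrightarrow> \<bar>poly (bernoulli_poly m) u\<bar> \<le> A * \<rho> ^ m"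
    using bernoulli_poly_bound[OF \<rho>] by blast
  have Af: "\<bar>bernoulli_fun m u\<bar> \<le> A * \<rho> ^ m" for m u
    by (rule bernoulli_fun_bound) (use A(2) in blast)
  obtain C where C: "C \<ge> 0" and IH: "\<And>w g x \<tau> K. C_k_vec n (Suc w) g \<Longrightarrow> \<tau> > \<tau>\<^sub>0 \<Longrightarrow> em_generic n x \<tau> \<Longrightarrow> K \<ge> 0 \<Longrightarrow>
     (\<And>ks y. set ks \<subseteq> {..<n} \<Longrightarrow> length ks \<le> w + 1 \<Longrightarrow> w + 2 \<le> length ks + n \<Longrightarrow> y \<in> std_simplex n \<Longrightarrow> \<bar>word_partial ks g y\<bar> \<le> K) \<Longrightarrow>
     \<bar>(\<Sum>p\<in>lattice_points n x \<tau>. g p) - em_main n w g x \<tau>\<bar> \<le>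
       C * real (w + 1) ^ n * \<tau> powi (int n - int w - 1) * (2 ^ n / 2 * \<rho>) ^ (w + 1) * K"
    using Suc by blast
  \<comment> \<open>\<open>E\<close> comes from the last coordinate and \<open>Q\<close> from one term of the recursion.\<close>
  define E where "E = (1 + 1 / \<tau>\<^sub>0) ^ n * A"
  define Q where "Q = A * (1 + \<rho>) * (1 + 1 / \<tau>\<^sub>0) * C"
  have EQ: "E \<ge> 0" "Q \<ge> 0" using A C \<rho>0 \<tau>0 by (auto simp: E_def Q_def)
  have "\<bar>(\<Sum>p\<in>lattice_points (Suc n) x \<tau>. g p) - em_main (Suc n) w g x \<tau>\<bar> \<le>
       (E + 4 * Q) * real (w + 1) ^ Suc n * \<tau> powi (int (Suc n) - int w - 1) * (2 ^ Suc n / 2 * \<rho>) ^ (w + 1) * K"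
    if g: "C_k_vec (Suc n) (Suc w) g" and \<tau>: "\<tau> > \<tau>\<^sub>0" and gen: "em_generic (Suc n) x \<tau>" and K: "K \<ge> 0"
      and bnd: "\<And>ks y. set ks \<subseteq> {..<Suc n} \<Longrightarrow> length ks \<le> w + 1 \<Longrightarrow> w + 2 \<le> length ks + Suc n \<Longrightarrow> y \<in> std_simplex (Suc n) \<Longrightarrow> \<bar>word_partial ks g y\<bar> \<le> K"
    for w g x \<tau> K
  proof -
    have t0: "\<tau> > 0" using \<tau> \<tau>0 by simp
    have gen': "em_generic n x \<tau>" "x n \<notin> \<int>" "(\<Sum>i\<le>n. x i) - \<tau> \<notin> \<int>"
      using gen by (auto simp: em_generic_def)
    define coef where "coef = (\<lambda>v i j. \<tau> powi (1 - int i - int j) * bernoulli_fun (j + i) (em_coord (\<lambda>_. v) x \<tau> n))"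
    define X where "X = \<tau> powi (int (Suc n) - int w - 1) * (2 ^ Suc n / 2 * \<rho>) ^ (w + 1) * K"
    have X: "X \<ge> 0" using t0 \<rho>0 K by (simp add: X_def)
    let ?S = "\<lambda>F. \<Sum>v\<in>{1, 2 :: nat}. \<Sum>i\<in>{0, 1 :: nat}. \<Sum>j\<in>last_exponents w i. F v i j :: real"
    let ?L = "\<lambda>h. \<Sum>p\<in>lattice_points n x \<tau>. h p"
    define e where "e = (\<lambda>p. (\<Sum>t\<in>lattice_params \<tau> (x n) (1 - vec_total p). g (vsnoc p t)) - ?S (\<lambda>v i j. coef v i j * T_op v i j g p))"
    have "?L (\<lambda>p. ?S (\<lambda>v i j. coef v i j * T_op v i j g p)) = ?S (\<lambda>v i j. coef v i j * ?L (T_op v i j g))"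
      by (simp only: sum_distrib_left) (subst sum.swap, rule sum.cong[OF refl], subst sum.swap, rule sum.cong[OF refl], rule sum.swap)
    hence lhs: "(\<Sum>p\<in>lattice_points (Suc n) x \<tau>. g p) = ?L e + ?S (\<lambda>v i j. coef v i j * ?L (T_op v i j g))"
      unfolding sum_lattice_points_Suc[OF t0] e_def by (simp only: sum_subtractf)
    have rhs: "em_main (Suc n) w g x \<tau> = ?S (\<lambda>v i j. coef v i j * em_main n (w - j) (T_op v i j g) x \<tau>)"
      unfolding em_main_Suc[OF t0] coef_def ..
    have diff: "(\<Sum>p\<in>lattice_points (Suc n) x \<tau>. g p) - em_main (Suc n) w g x \<tau> =
        ?L e + ?S (\<lambda>v i j. coef v i j * (?L (T_op v i j g) - em_main n (w - j) (T_op v i j g) x \<tau>))"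
      unfolding lhs rhs by (simp only: right_diff_distrib sum_subtractf)
    \<comment> \<open>The powers of \<open>\<tau>\<close>: at most of the order \<open>\<tau>\<^sup>n\<close> points with an error of the order \<open>\<tau>\<^sup>-\<^sup>w\<close> each.\<close>
    have e: "\<bar>?L e\<bar> \<le> E * X"
    proof -
      have "\<bar>e p\<bar> \<le> (1 / \<tau>) ^ w * (K * (A * \<rho> ^ (w + 1)))" if "p \<in> lattice_points n x \<tau>" for p
        unfolding e_def coef_def
      proof (rule em_last_coordinate[OF t0 g gen'(2,3) that])
        show "\<bar>word_partial (replicate (Suc w) n) g y\<bar> \<le> K" if "y \<in> std_simplex (Suc n)" for y
          by (rule bnd) (use that in auto)
      qed (use Af[of "Suc w"] A(2)[of _ "Suc w"] in auto)
      hence "\<bar>?L e\<bar> \<le> real (card (lattice_points n x \<tau>)) * ((1 / \<tau>) ^ w * (K * (A * \<rho> ^ (w + 1))))"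
        using sum_norm_bound[of "lattice_points n x \<tau>" e] by simp
      also have "\<dots> \<le> ((1 + 1 / \<tau>\<^sub>0) * \<tau>) ^ n * ((1 / \<tau>) ^ w * (K * (A * \<rho> ^ (w + 1))))"
      proof (rule mult_right_mono)
        have "\<tau> + 1 \<le> (1 + 1 / \<tau>\<^sub>0) * \<tau>" using \<tau> \<tau>0 by (simp add: field_simps)
        hence "(\<tau> + 1) ^ n \<le> ((1 + 1 / \<tau>\<^sub>0) * \<tau>) ^ n" using t0 by (intro power_mono) auto
        thus "real (card (lattice_points n x \<tau>)) \<le> ((1 + 1 / \<tau>\<^sub>0) * \<tau>) ^ n"
          using card_lattice_points[OF t0, of n x] by linarith
      qed (use t0 K A \<rho>0 in auto)
      also have "\<dots> = E * (\<tau> ^ n * (1 / \<tau>) ^ w * \<rho> ^ (w + 1) * K)"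
        by (simp add: E_def power_mult_distrib)
      also have "\<tau> ^ n * (1 / \<tau>) ^ w = \<tau> powi (int (Suc n) - int w - 1)"
        using t0 by (simp add: power_int_diff power_one_over)
      also have "E * (\<tau> powi (int (Suc n) - int w - 1) * \<rho> ^ (w + 1) * K) \<le> E * X"
        unfolding X_def using t0 \<rho>0 K EQ
        by (intro mult_left_mono mult_right_mono power_mono) auto
      finally show ?thesis .
    qed
    \<comment> \<open>The induction hypothesis, with derivative bound \<open>2\<^sup>w\<^sup>-\<^sup>j\<^sup>+\<^sup>1 K\<close> for the function \<open>T g\<close>.\<close>
    have t: "\<bar>coef v i j * (?L (T_op v i j g) - em_main n (w - j) (T_op v i j g) x \<tau>)\<bar> \<le> Q * real (w + 1) ^ n * X"
      if v: "v \<in> {1, 2}" and i: "i \<in> {0, 1}" and j: "j \<in> last_exponents w i" for v i j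
    proof -
      have jw: "j \<le> w" "i = 0 \<Longrightarrow> j = 0" using j by (auto simp: last_exponents_def split: if_splits)
      have g': "C_k_vec n (Suc (w - j)) (T_op v i j g)"
        by (rule C_k_vec_T_op[OF _ v i]) (use g jw in \<open>simp add: Suc_diff_le del: C_k_vec.simps\<close>)
      have "\<bar>?L (T_op v i j g) - em_main n (w - j) (T_op v i j g) x \<tau>\<bar> \<le>
         C * real (w - j + 1) ^ n * \<tau> powi (int n - int (w - j) - 1) * (2 ^ n / 2 * \<rho>) ^ (w - j + 1) * (2 ^ (w - j + 1) * K)"
      proof (rule IH[OF g' \<tau> gen'(1)])
        fix ks y assume ks: "set ks \<subseteq> {..<n}" "length ks \<le> w - j + 1" "w - j + 2 \<le> length ks + n" and y: "y \<in> std_simplex n"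
        have "\<bar>word_partial ks (T_op v i j g) y\<bar> \<le> 2 ^ length ks * K"
        proof (rule word_partial_T_op_bound[OF _ v i jw(2) ks(1) y K])
          show "C_k_vec (Suc n) (length ks + j) g" by (rule C_k_vec_mono[OF g]) (use ks(2) jw in linarith)
          show "\<bar>word_partial ls g z\<bar> \<le> K" if "set ls \<subseteq> {..<Suc n}" "length ls \<le> length ks + j"
            "length ks + j + i \<le> Suc (length ls)" "z \<in> std_simplex (Suc n)" for ls z
            by (rule bnd[OF that(1) _ _ that(4)]) (use that(2,3) ks jw in linarith)+
        qed
        also have "\<dots> \<le> 2 ^ (w - j + 1) * K"
          using K ks(2) by (intro mult_right_mono power_increasing) auto
        finally show "\<bar>word_partial ks (T_op v i j g) y\<bar> \<le> 2 ^ (w - j + 1) * K" .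
      qed (use K in simp)
      from em_step_arith[OF \<tau> \<tau>0 \<rho>0 _ C K jw(1) i Af this, of "em_coord (\<lambda>_. v) x \<tau> n"] A(1)
      show ?thesis unfolding coef_def Q_def X_def by (simp add: mult.assoc)
    qed
    have "\<bar>?S (\<lambda>v i j. coef v i j * (?L (T_op v i j g) - em_main n (w - j) (T_op v i j g) x \<tau>))\<bar>
       \<le> ?S (\<lambda>v i j. Q * real (w + 1) ^ n * X)"
      by (rule order_trans[OF sum_abs], rule sum_mono, rule order_trans[OF sum_abs], rule sum_mono,
          rule order_trans[OF sum_abs], rule sum_mono, rule t)
    \<comment> \<open>For each of the two values of \<open>v\<close> there is one term with \<open>i = 0\<close> and there are \<open>w + 1\<close> with \<open>i = 1\<close>.\<close>
    also have "\<dots> = 2 * (real w + 2) * (Q * real (w + 1) ^ n * X)"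
      by (simp add: last_exponents_def algebra_simps)
    also have "\<dots> \<le> (4 * real (w + 1)) * (Q * real (w + 1) ^ n * X)"
      using EQ X by (intro mult_right_mono) auto
    finally have S: "\<bar>?S (\<lambda>v i j. coef v i j * (?L (T_op v i j g) - em_main n (w - j) (T_op v i j g) x \<tau>))\<bar>
       \<le> 4 * Q * real (w + 1) ^ Suc n * X" by (simp only: power_Suc mult_ac)
    have "E * X \<le> E * real (w + 1) ^ Suc n * X"
    proof -
      have "1 \<le> real (w + 1) ^ Suc n" by (rule one_le_power) simp
      hence "E * X * 1 \<le> E * X * real (w + 1) ^ Suc n" using EQ X by (intro mult_left_mono) auto
      thus ?thesis by (simp only: mult_ac mult_1)
    qed
    hence "\<bar>(\<Sum>p\<in>lattice_points (Suc n) x \<tau>. g p) - em_main (Suc n) w g x \<tau>\<bar> \<le> E * real (w + 1) ^ Suc n * X + 4 * Q * real (w + 1) ^ Suc n * X"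
      unfolding diff using e S by linarith
    thus ?thesis unfolding X_def by (simp only: ring_distribs mult.assoc)
  qed
  moreover have "E + 4 * Q \<ge> 0" using EQ by simp
  ultimately show ?case by blast
qed

section \<open>Representatives of the integer lattice modulo a sublattice\<close>

definition lattice_covering :: "nat \<Rightarrow> int mat \<Rightarrow> int vec set \<Rightarrow> bool" where
  "lattice_covering d M C \<longleftrightarrow> finite C \<and> C \<subseteq> carrier_vec d \<and>
     (\<forall>v\<in>carrier_vec d. \<exists>r\<in>C. \<exists>m\<in>carrier_vec d. v = r + M *\<^sub>v m)"

lemma sum_split_index:
  assumes "j < Suc n"
  shows "(\<Sum>k<Suc n. f k) = f j + (\<Sum>k<n. f (insert_index j k) :: 'a :: comm_monoid_add)"
proof -
  have "(\<Sum>k<Suc n. f k) = f j + (\<Sum>k\<in>{0..<Suc n} - {j}. f k)"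
    using assms by (subst lessThan_atLeast0, subst sum.remove[of _ j]) auto
  also have "(\<Sum>k\<in>{0..<Suc n} - {j}. f k) = (\<Sum>k<n. f (insert_index j k))"
    unfolding insert_index_image[OF assms, symmetric]
    by (subst sum.reindex) (auto simp: insert_index_inj_on lessThan_atLeast0)
  finally show ?thesis .
qed

lemma mult_mat_vec_index:
  assumes "M \<in> carrier_mat n d" "m \<in> carrier_vec d" "i < n"
  shows "(M *\<^sub>v m) $ i = (\<Sum>k<d. M $$ (i, k) * m $ k)"
  using assms by (auto simp: scalar_prod_def lessThan_atLeast0 intro!: sum.cong)

text \<open>
  If the first row of \<open>M\<close> has the single nonzero entry \<open>g\<close>, then modulo \<open>M\<close> the first entry of a vector can
  be brought into \<open>{0..<\<bar>g\<bar>}\<close>, and afterwards only the submatrix without that row and column acts.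
\<close>

lemma lattice_covering_single_entry:
  fixes M :: "int mat"
  assumes M: "M \<in> carrier_mat (Suc n) (Suc n)" and j: "j < Suc n" and g: "M $$ (0, j) \<noteq> 0"
    and z: "\<And>k. k < Suc n \<Longrightarrow> k \<noteq> j \<Longrightarrow> M $$ (0, k) = 0"
    and C: "lattice_covering n (mat_delete M 0 j) C"
  shows "\<exists>C'. lattice_covering (Suc n) M C' \<and> int (card C') \<le> \<bar>M $$ (0, j)\<bar> * int (card C)"
proof -
  define g where "g = M $$ (0, j)"
  define F where "F = (\<lambda>(a, r). vec (Suc n) (\<lambda>i. if i = 0 then a else r $ (i - 1)) :: int vec)"
  define C' where "C' = F ` ({0..<\<bar>g\<bar>} \<times> C)"
  have fin: "finite C" and Cc: "C \<subseteq> carrier_vec n" using C by (auto simp: lattice_covering_def)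
  have "card C' \<le> card ({0..<\<bar>g\<bar>} \<times> C)" unfolding C'_def by (rule card_image_le) (simp add: fin)
  also have "\<dots> = nat \<bar>g\<bar> * card C" by (simp add: card_cartesian_product)
  finally have "int (card C') \<le> int (nat \<bar>g\<bar> * card C)" by (simp only: of_nat_le_iff)
  hence card: "int (card C') \<le> \<bar>g\<bar> * int (card C)" by simp
  have N: "mat_delete M 0 j \<in> carrier_mat n n" using mat_delete_carrier[OF M, of 0 j] by simp
  have "\<exists>r\<in>C'. \<exists>m\<in>carrier_vec (Suc n). v = r + M *\<^sub>v m" if v: "v \<in> carrier_vec (Suc n)" for v
  proof -
    define a where "a = v $ 0 mod \<bar>g\<bar>"
    \<comment> \<open>Division by \<open>g\<close> with the remainder \<open>a\<close> in \<open>{0..<\<bar>g\<bar>}\<close>, also when \<open>g\<close> is negative.\<close>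
    define t where "t = (v $ 0 div \<bar>g\<bar>) * sgn g"
    have vt: "v $ 0 = a + g * t"
    proof -
      have "g * t = \<bar>g\<bar> * (v $ 0 div \<bar>g\<bar>)" by (simp add: t_def abs_sgn mult_ac)
      thus ?thesis by (simp add: a_def)
    qed
    have a: "a \<in> {0..<\<bar>g\<bar>}" using g by (simp add: a_def g_def)
    define v' where "v' = vec n (\<lambda>i. v $ Suc i - t * M $$ (Suc i, j))"
    have "v' \<in> carrier_vec n" by (simp add: v'_def)
    then obtain r m where r: "r \<in> C" and m: "m \<in> carrier_vec n" and eq: "v' = r + mat_delete M 0 j *\<^sub>v m"
      using C unfolding lattice_covering_def by blast
    define m' where "m' = vec (Suc n) (\<lambda>k. if k = j then t else if k < j then m $ k else m $ (k - 1))"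
    have m'j: "m' $ j = t" using j by (simp add: m'_def)
    have m'k: "m' $ insert_index j k = m $ k" if "k < n" for k
      using that j by (auto simp: m'_def insert_index_def)
    have m'c: "m' \<in> carrier_vec (Suc n)" by (simp add: m'_def)
    have "v = F (a, r) + M *\<^sub>v m'"
    proof (rule eq_vecI)
      fix i assume "i < dim_vec (F (a, r) + M *\<^sub>v m')"
      hence i: "i < Suc n" using M by simp
      have Mm: "(M *\<^sub>v m') $ i = M $$ (i, j) * t + (\<Sum>k<n. M $$ (i, insert_index j k) * m $ k)"
        unfolding mult_mat_vec_index[OF M m'c i] sum_split_index[OF j] by (simp add: m'j m'k)
      show "v $ i = (F (a, r) + M *\<^sub>v m') $ i"
      proof (cases i)
        case 0
        have "(\<Sum>k<n. M $$ (0, insert_index j k) * m $ k) = 0"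
        proof (intro sum.neutral ballI)
          fix k assume "k \<in> {..<n}"
          hence "insert_index j k < Suc n" by (auto simp: insert_index_def)
          thus "M $$ (0, insert_index j k) * m $ k = 0" using z by simp
        qed
        thus ?thesis using M vt 0 Mm by (simp add: F_def g_def del: index_mult_mat_vec)
      next
        case (Suc i')
        hence i': "i' < n" using i by simp
        have "(mat_delete M 0 j *\<^sub>v m) $ i' = (\<Sum>k<n. M $$ (i, insert_index j k) * m $ k)"
          unfolding mult_mat_vec_index[OF N m i']
        proof (rule sum.cong[OF refl])
          fix k assume "k \<in> {..<n}"
          hence k: "k < n" by simp
          have "M $$ (insert_index 0 i', insert_index j k) = mat_delete M 0 j $$ (i', k)"
            by (rule mat_delete_index[OF M _ j i' k]) simp
          thus "mat_delete M 0 j $$ (i', k) * m $ k = M $$ (i, insert_index j k) * m $ k" by (simp add: Suc)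
        qed
        moreover have "v' $ i' = r $ i' + (mat_delete M 0 j *\<^sub>v m) $ i'"
          unfolding eq using i' N r Cc by (subst index_add_vec) auto
        ultimately have "v $ i - t * M $$ (i, j) = r $ i' + (\<Sum>k<n. M $$ (i, insert_index j k) * m $ k)"
          using i' by (simp add: v'_def Suc)
        thus ?thesis using M i Mm by (simp add: F_def Suc mult.commute del: index_mult_mat_vec)
      qed
    qed (use v M in simp)
    moreover have "F (a, r) \<in> C'" using a r by (auto simp: C'_def)
    ultimately show ?thesis using m'c by blast
  qed
  moreover have "finite C'" "C' \<subseteq> carrier_vec (Suc n)" by (auto simp: C'_def F_def fin)
  ultimately have "lattice_covering (Suc n) M C'" unfolding lattice_covering_def by blast
  thus ?thesis using card by (auto simp: g_def)
qed

text \<open>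
  Column operations preserve both the determinant and the sublattice. As in the Euclidean algorithm,
  they reduce the first row to a single nonzero entry; then the determinant is that entry times a minor,
  up to sign. As the classes only enter as
  a factor of the error, it is enough to bound their number from above.
\<close>

lemma exists_lattice_covering:
  fixes M :: "int mat"
  shows "M \<in> carrier_mat d d \<Longrightarrow> det M \<noteq> 0 \<Longrightarrow> \<exists>C. lattice_covering d M C \<and> int (card C) \<le> \<bar>det M\<bar>"
proof (induction d arbitrary: M)
  case 0
  have "lattice_covering 0 M {vNil}"
    using 0(1) unfolding lattice_covering_def by (auto intro!: bexI[of _ vNil] eq_vecI)
  moreover have "int (card {vNil :: int vec}) \<le> \<bar>det M\<bar>" using 0 by simp
  ultimately show ?case by blast
next
  case (Suc n)
  from Suc.prems show ?case
  proof (induction "nat (\<Sum>k<Suc n. \<bar>M $$ (0, k)\<bar>)" arbitrary: M rule: less_induct)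
    case less
    note M = less.prems(1)
    show ?case
    proof (cases "\<exists>k l. k < Suc n \<and> l < Suc n \<and> k \<noteq> l \<and> M $$ (0, k) \<noteq> 0 \<and> M $$ (0, l) \<noteq> 0")
      case True
      then obtain k l where kl: "k < Suc n" "l < Suc n" "k \<noteq> l" "M $$ (0, k) \<noteq> 0" "M $$ (0, l) \<noteq> 0"
        "\<bar>M $$ (0, l)\<bar> \<le> \<bar>M $$ (0, k)\<bar>"
        by (metis nle_le)
      \<comment> \<open>Adding or subtracting a column makes the larger of two nonzero entries smaller in absolute value.\<close>
      define a where "a = (if sgn (M $$ (0, k)) = sgn (M $$ (0, l)) then - 1 else 1 :: int)"
      define M' where "M' = addcol a k l M"
      have M': "M' \<in> carrier_mat (Suc n) (Suc n)" using M unfolding M'_def mat_addcol_def by auto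
      have detM': "det M' = det M" unfolding M'_def by (rule det_addcol[OF kl(2,3) M])
      have M'0: "M' $$ (0, i) = (if i = k then a * M $$ (0, l) + M $$ (0, k) else M $$ (0, i))" if "i < Suc n" for i
        using M that by (auto simp: M'_def)
      have small: "\<bar>a * M $$ (0, l) + M $$ (0, k)\<bar> < \<bar>M $$ (0, k)\<bar>"
        using kl by (auto simp: a_def sgn_if split: if_splits)
      have "(\<Sum>i<Suc n. \<bar>M' $$ (0, i)\<bar>) < (\<Sum>i<Suc n. \<bar>M $$ (0, i)\<bar>)"
        by (rule sum_strict_mono_ex1) (use M'0 small kl(1) in \<open>auto intro!: bexI[of _ k]\<close>)
      moreover have "0 \<le> (\<Sum>i<Suc n. \<bar>M' $$ (0, i)\<bar>)" by (rule sum_nonneg) simp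
      ultimately have "nat (\<Sum>i<Suc n. \<bar>M' $$ (0, i)\<bar>) < nat (\<Sum>i<Suc n. \<bar>M $$ (0, i)\<bar>)" by linarith
      from less.hyps[OF this M'] detM' less.prems(2)
      obtain C where C: "lattice_covering (Suc n) M' C" "int (card C) \<le> \<bar>det M\<bar>" by auto
      define R where "R = addrow_mat (Suc n) a l k"
      have R: "R \<in> carrier_mat (Suc n) (Suc n)" by (simp add: R_def)
      have MR: "M' = M * R" unfolding M'_def R_def by (rule addcol_mat[OF M kl(2)])
      have "\<exists>r\<in>C. \<exists>m\<in>carrier_vec (Suc n). v = r + M *\<^sub>v m" if v: "v \<in> carrier_vec (Suc n)" for v
      proof -
        obtain r m where rm: "r \<in> C" "m \<in> carrier_vec (Suc n)" "v = r + M' *\<^sub>v m"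
          using C(1) v unfolding lattice_covering_def by blast
        have "M' *\<^sub>v m = M *\<^sub>v (R *\<^sub>v m)" unfolding MR by (rule assoc_mult_mat_vec[OF M R rm(2)])
        moreover have "R *\<^sub>v m \<in> carrier_vec (Suc n)" using R rm(2) by (rule mult_mat_vec_carrier)
        ultimately show ?thesis using rm by auto
      qed
      hence "lattice_covering (Suc n) M C" using C(1) unfolding lattice_covering_def by blast
      thus ?thesis using C(2) by blast
    next
      case False
      have lap: "det M = (\<Sum>j<Suc n. M $$ (0, j) * cofactor M 0 j)"
        by (rule laplace_expansion_row[OF M]) simp
      hence "\<exists>j<Suc n. M $$ (0, j) \<noteq> 0"
        using less.prems(2) by (metis (no_types, lifting) lessThan_iff mult_zero_left sum.neutral)
      then obtain j where j: "j < Suc n" "M $$ (0, j) \<noteq> 0" by blast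
      have z: "M $$ (0, k) = 0" if "k < Suc n" "k \<noteq> j" for k using False j that by blast
      have "det M = M $$ (0, j) * cofactor M 0 j"
        unfolding lap by (subst sum.remove[of _ j]) (use j z in auto)
      hence detM: "\<bar>det M\<bar> = \<bar>M $$ (0, j)\<bar> * \<bar>det (mat_delete M 0 j)\<bar>"
        by (simp add: cofactor_def abs_mult power_abs)
      have "mat_delete M 0 j \<in> carrier_mat n n" using mat_delete_carrier[OF M, of 0 j] by simp
      moreover have "det (mat_delete M 0 j) \<noteq> 0" using detM less.prems(2) by auto
      ultimately obtain C where C: "lattice_covering n (mat_delete M 0 j) C" "int (card C) \<le> \<bar>det (mat_delete M 0 j)\<bar>"
        using Suc.IH by blast
      obtain C' where C': "lattice_covering (Suc n) M C'" "int (card C') \<le> \<bar>M $$ (0, j)\<bar> * int (card C)"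
        using lattice_covering_single_entry[OF M j z C(1)] by blast
      have "\<bar>M $$ (0, j)\<bar> * int (card C) \<le> \<bar>det M\<bar>" unfolding detM using C(2) by (simp add: mult_left_mono)
      thus ?thesis using C' by fastforce
    qed
  qed
qed

definition lattice_transversal :: "nat \<Rightarrow> int mat \<Rightarrow> int vec set \<Rightarrow> bool" where
  "lattice_transversal d M C \<longleftrightarrow> lattice_covering d M C \<and>
     (\<forall>r\<in>C. \<forall>r'\<in>C. \<forall>m\<in>carrier_vec d. r = r' + M *\<^sub>v m \<longrightarrow> r = r')"

text \<open>
  A covering of minimal size cannot contain two vectors of the same class.
\<close>

lemma exists_lattice_transversal:
  fixes M :: "int mat"
  assumes M: "M \<in> carrier_mat d d" and "det M \<noteq> 0"
  shows "\<exists>C. lattice_transversal d M C \<and> int (card C) \<le> \<bar>det M\<bar>"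
proof -
  obtain C0 where C0: "lattice_covering d M C0" "int (card C0) \<le> \<bar>det M\<bar>"
    using exists_lattice_covering[OF assms] by blast
  obtain C where C: "lattice_covering d M C" and min: "\<And>C'. lattice_covering d M C' \<Longrightarrow> card C \<le> card C'"
    using ex_has_least_nat[of "lattice_covering d M" C0 card] C0(1) by blast
  have Cc: "C \<subseteq> carrier_vec d" and fin: "finite C" using C by (auto simp: lattice_covering_def)
  have "r = r'" if r: "r \<in> C" and r': "r' \<in> C" and m: "m \<in> carrier_vec d" and eq: "r = r' + M *\<^sub>v m" for r r' m
  proof (rule ccontr)
    assume ne: "r \<noteq> r'"
    have "\<exists>s\<in>C - {r}. \<exists>k\<in>carrier_vec d. v = s + M *\<^sub>v k" if v: "v \<in> carrier_vec d" for v
    proof -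
      obtain s k where sk: "s \<in> C" "k \<in> carrier_vec d" "v = s + M *\<^sub>v k"
        using C v unfolding lattice_covering_def by blast
      show ?thesis
      proof (cases "s = r")
        case True
        have "v = r' + M *\<^sub>v (m + k)"
          unfolding sk(3) True eq mult_add_distrib_mat_vec[OF M m sk(2)]
          using r' Cc m sk(2) M by (intro assoc_add_vec[of _ d]) auto
        thus ?thesis using r' ne m sk(2) by (intro bexI[of _ r'] bexI[of _ "m + k"]) auto
      qed (use sk in blast)
    qed
    hence "lattice_covering d M (C - {r})" using C by (auto simp: lattice_covering_def)
    from min[OF this] show False using r fin by (metis card_Diff1_less leD)
  qed
  hence "lattice_transversal d M C" using C by (auto simp: lattice_transversal_def)
  moreover have "int (card C) \<le> \<bar>det M\<bar>" using min[OF C0(1)] C0(2) by linarith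
  ultimately show ?thesis by blast
qed

section \<open>Coordinates with respect to the bases\<close>

lemma length_basis_V: "length (basis_V n V) = n"
  by (induction n) auto

lemma basis_V_carrier: "b \<in> set (basis_V n V) \<Longrightarrow> b \<in> carrier_vec n"
  by (induction n arbitrary: b) auto

lemma basis_V_nth_carrier: "k < n \<Longrightarrow> basis_V n V ! k \<in> carrier_vec n"
  by (rule basis_V_carrier[of _ n V]) (simp add: length_basis_V)

lemma basis_V_Suc_nth:
  "k < n \<Longrightarrow> basis_V (Suc n) V ! k = vsnoc (basis_V n V ! k) (if V n = 1 then 0 else - vec_total (basis_V n V ! k))"
  "basis_V (Suc n) V ! n = unit_vec (Suc n) n"
  by (auto simp: nth_append length_basis_V)

lemma D_V_carrier: "D_V d V \<in> carrier_mat d d"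
  using mat_of_cols_carrier(1)[of d "basis_V d V"] unfolding D_V_def length_basis_V .

lemma D_V_index: "i < d \<Longrightarrow> k < d \<Longrightarrow> D_V d V $$ (i, k) = basis_V d V ! k $ i"
  by (simp add: D_V_def length_basis_V mat_of_cols_index)

text \<open>
  Each step of the recursion appends one entry to the old vectors and adds the last unit vector, so that
  the matrix of the basis is lower triangular with ones on the diagonal.
\<close>

lemma basis_V_triangular: "k < n \<Longrightarrow> i \<le> k \<Longrightarrow> basis_V n V ! k $ i = (if i = k then 1 else 0)"
proof (induction n)
  case (Suc n)
  show ?case
  proof (cases "k = n")
    case True
    then show ?thesis using Suc.prems by (simp add: basis_V_Suc_nth del: basis_V.simps)
  next
    case False
    hence k: "k < n" using Suc.prems by simp
    have "dim_vec (basis_V n V ! k) = n" using basis_V_nth_carrier[OF k] by simp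
    thus ?thesis using Suc.IH[OF k Suc.prems(2)] Suc.prems k by (simp add: basis_V_Suc_nth(1)[OF k] vsnoc_index del: basis_V.simps)
  qed
qed simp

lemma det_D_V: "det (D_V d V) = 1"
proof -
  have "det (D_V d V) = prod_list (diag_mat (D_V d V))"
    by (rule det_lower_triangular[OF _ D_V_carrier]) (simp add: D_V_index basis_V_triangular)
  also have "diag_mat (D_V d V) = map (\<lambda>_. 1) [0..<d]"
    using D_V_carrier[of d V] unfolding diag_mat_def by (auto simp: D_V_index basis_V_triangular)
  also have "prod_list \<dots> = 1" by (induction d) auto
  finally show ?thesis .
qed

lemma basis_combination_Suc:
  "i < n \<Longrightarrow> (\<Sum>k<Suc n. basis_V (Suc n) V ! k $ i * c k) = (\<Sum>k<n. basis_V n V ! k $ i * c k)"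
  "(\<Sum>k<Suc n. basis_V (Suc n) V ! k $ n * c k) =
     c n - (if V n = 1 then 0 else (\<Sum>i<n. \<Sum>k<n. basis_V n V ! k $ i * c k))"
proof -
  have dim: "dim_vec (basis_V n V ! k) = n" if "k < n" for k using basis_V_nth_carrier[OF that] by simp
  show "(\<Sum>k<Suc n. basis_V (Suc n) V ! k $ i * c k) = (\<Sum>k<n. basis_V n V ! k $ i * c k)" if "i < n"
    using that by (simp add: basis_V_Suc_nth vsnoc_index dim del: basis_V.simps)
  have "(\<Sum>i<n. \<Sum>k<n. basis_V n V ! k $ i * c k) = (\<Sum>k<n. vec_total (basis_V n V ! k) * c k)"
    by (subst sum.swap) (simp add: vec_total_def dim sum_distrib_right)
  thus "(\<Sum>k<Suc n. basis_V (Suc n) V ! k $ n * c k) =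
     c n - (if V n = 1 then 0 else (\<Sum>i<n. \<Sum>k<n. basis_V n V ! k $ i * c k))"
    by (simp add: basis_V_Suc_nth vsnoc_index dim sum_negf del: basis_V.simps)
qed

lemma lambda_V_carrier: "lambda_V n V \<in> carrier_vec n"
  by (induction n) auto

text \<open>
  For \<open>v_d = 2\<close> the last entry of each earlier basis vector is minus the sum of the others. Solving
  for the last coefficient therefore adds up all entries, and the constants in \<open>\<lambda>\<^sub>V\<close> add up to \<open>\<tau>\<close>.
\<close>

lemma basis_coordinates:
  assumes "\<And>i. i < n \<Longrightarrow> (\<Sum>k<n. basis_V n V ! k $ i * c k) = y i - \<tau> * lambda_V n V $ i"
  shows "k < n \<Longrightarrow> c k = em_coord V y \<tau> k"
  using assms
proof (induction n arbitrary: k)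
  case (Suc n)
  have dl: "dim_vec (lambda_V n V) = n" using lambda_V_carrier[of n V] by simp
  have E: "(\<Sum>k<n. basis_V n V ! k $ i * c k) = y i - \<tau> * lambda_V n V $ i" if "i < n" for i
    using Suc.prems(2)[of i] that unfolding basis_combination_Suc(1)[OF that] by (simp add: vsnoc_index dl)
  show ?case
  proof (cases "k < n")
    case True
    thus ?thesis using Suc.IH[OF True E] by simp
  next
    case False
    hence k: "k = n" using Suc.prems(1) by simp
    have E2: "(\<Sum>i<n. \<Sum>k<n. basis_V n V ! k $ i * c k) = (\<Sum>i<n. y i - \<tau> * lambda_V n V $ i)"
      by (rule sum.cong) (simp_all add: E)
    have "c n - (if V n = 1 then 0 else (\<Sum>i<n. y i - \<tau> * lambda_V n V $ i)) =
        y n - \<tau> * (if V n = 1 then 0 else 1 - vec_total (lambda_V n V))"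
      using Suc.prems(2)[of n] unfolding basis_combination_Suc(2) E2 by (simp add: vsnoc_index dl)
    moreover have "(\<Sum>i<n. y i - \<tau> * lambda_V n V $ i) = (\<Sum>i<n. y i) - \<tau> * vec_total (lambda_V n V)"
      by (simp add: vec_total_def dl sum_subtractf sum_distrib_left)
    moreover have "(\<Sum>i\<le>n. y i) = (\<Sum>i<n. y i) + y n" by (simp flip: lessThan_Suc_atMost)
    ultimately show ?thesis unfolding k em_coord_def
      by (cases "V n = 1") (simp_all add: right_diff_distrib)
  qed
qed simp

section \<open>Translates in the unit cube\<close>

lemma em_coord_shift:
  "em_coord V (\<lambda>i. z i + m i) \<tau> k = em_coord V z \<tau> k + (if V k = 1 then m k else (\<Sum>i\<le>k. m i))"
  by (simp add: em_coord_def sum.distrib)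

text \<open>
  The entry \<open>m k\<close> enters the coordinate \<open>k\<close> with coefficient \<open>1\<close> and no earlier coordinate, so the entries
  can be chosen one after the other.
\<close>

lemma exists_unit_cube_shift:
  "\<exists>m :: nat \<Rightarrow> int. \<forall>k<d. 0 \<le> em_coord V (\<lambda>i. z i + of_int (m i)) \<tau> k \<and> em_coord V (\<lambda>i. z i + of_int (m i)) \<tau> k < 1"
proof (induction d)
  case (Suc d)
  then obtain m :: "nat \<Rightarrow> int" where m: "\<And>k. k < d \<Longrightarrow> 0 \<le> em_coord V (\<lambda>i. z i + of_int (m i)) \<tau> k \<and> em_coord V (\<lambda>i. z i + of_int (m i)) \<tau> k < 1"
    by blast
  define b where "b = em_coord V (\<lambda>i. z i + of_int ((m(d := 0)) i)) \<tau> d"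
  define m' where "m' = m(d := - \<lfloor>b\<rfloor>)"
  have "em_coord V (\<lambda>i. z i + of_int (m' i)) \<tau> k = em_coord V (\<lambda>i. z i + of_int (m i)) \<tau> k" if "k < d" for k
    using that by (auto simp: em_coord_def m'_def intro!: sum.cong)
  moreover have "em_coord V (\<lambda>i. z i + of_int (m' i)) \<tau> d = b - of_int \<lfloor>b\<rfloor>"
  proof -
    have "(\<Sum>i<d. z i + of_int (m' i)) = (\<Sum>i<d. z i + of_int ((m(d := 0)) i))"
      by (rule sum.cong) (auto simp: m'_def)
    thus ?thesis by (auto simp: em_coord_def b_def m'_def simp flip: lessThan_Suc_atMost)
  qed
  moreover have "0 \<le> b - of_int \<lfloor>b\<rfloor>" "b - of_int \<lfloor>b\<rfloor> < 1" by linarith+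
  ultimately have "\<forall>k<Suc d. 0 \<le> em_coord V (\<lambda>i. z i + of_int (m' i)) \<tau> k \<and> em_coord V (\<lambda>i. z i + of_int (m' i)) \<tau> k < 1"
    using m by (auto simp: less_Suc_eq)
  thus ?case by blast
qed simp

lemma unit_cube_shift_unique:
  fixes m :: "nat \<Rightarrow> int"
  assumes z: "\<And>k. k < d \<Longrightarrow> 0 \<le> em_coord V z \<tau> k \<and> em_coord V z \<tau> k < 1"
    and zm: "\<And>k. k < d \<Longrightarrow> 0 \<le> em_coord V (\<lambda>i. z i + of_int (m i)) \<tau> k \<and> em_coord V (\<lambda>i. z i + of_int (m i)) \<tau> k < 1"
  shows "k < d \<Longrightarrow> m k = 0"
proof (induction k rule: less_induct)
  case (less k)
  have "(\<Sum>i\<le>k. m i) = m k"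
    using less by (simp flip: lessThan_Suc_atMost)
  hence "em_coord V (\<lambda>i. z i + of_int (m i)) \<tau> k = em_coord V z \<tau> k + of_int (m k)"
    unfolding em_coord_shift by (simp flip: of_int_sum)
  thus ?case using z[OF less.prems] zm[OF less.prems] by linarith
qed

section \<open>Periodic Bernoulli functions as finite sums\<close>

abbreviation real_mat :: "int mat \<Rightarrow> real mat" where
  "real_mat \<equiv> map_mat real_of_int"

abbreviation real_vec :: "int vec \<Rightarrow> real vec" where
  "real_vec \<equiv> map_vec real_of_int"

lemma exists_inverse_mat:
  fixes A :: "real mat"
  assumes A: "A \<in> carrier_mat d d" and "det A \<noteq> 0"
  shows "\<exists>W\<in>carrier_mat d d. A * W = 1\<^sub>m d \<and> W * A = 1\<^sub>m d"
  using det_non_zero_imp_unit[OF assms, of "()"] unfolding Units_def ring_mat_def by auto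

text \<open>
  Since \<open>D_V\<close> has determinant \<open>1\<close>, the matrix \<open>L\<close> has the determinant of \<open>M\<close>, and
  applying its transposed inverse means to go back to the standard simplex by \<open>W\<close> and then to the
  coordinates of the basis.
\<close>

lemma inverse_coordinates:
  fixes M :: "int mat" and V :: "nat \<Rightarrow> nat" and d :: nat
  defines "L \<equiv> transpose_mat (real_mat M * D_V d V)"
  assumes M: "M \<in> carrier_mat d d" and dM: "det M \<noteq> 0"
    and W: "W \<in> carrier_mat d d" "W * real_mat M = 1\<^sub>m d" and y: "y \<in> carrier_vec d"
  shows "\<bar>det L\<bar> = real_of_int \<bar>det M\<bar>"
    and "k < d \<Longrightarrow> (transpose_mat (the (mat_inverse L)) *\<^sub>v (y - \<tau> \<cdot>\<^sub>v (real_mat M *\<^sub>v lambda_V d V))) $ k =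
      em_coord V (\<lambda>i. (W *\<^sub>v y) $ i) \<tau> k"
proof -
  note D = D_V_carrier[of d V] and l = lambda_V_carrier[of d V]
  have Mr: "real_mat M \<in> carrier_mat d d" using M by simp
  have MD: "real_mat M * D_V d V \<in> carrier_mat d d" using Mr D by simp
  have L: "L \<in> carrier_mat d d" using MD by (simp add: L_def)
  have "det L = det (real_mat M * D_V d V)" unfolding L_def by (rule det_transpose[OF MD])
  also have "\<dots> = real_of_int (det M)" by (subst det_mult[OF Mr D]) (simp add: det_D_V)
  finally have detL: "det L = real_of_int (det M)" .
  thus "\<bar>det L\<bar> = real_of_int \<bar>det M\<bar>" by simp
  have "det L \<noteq> 0" using detL dM by simp
  hence "L \<in> Units (ring_mat TYPE(real) d ())" by (rule det_non_zero_imp_unit[OF L])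
  hence "mat_inverse L \<noteq> None" using mat_inverse(1)[OF L, of "()"] by blast
  then obtain B where Bs: "mat_inverse L = Some B" by blast
  have B: "L * B = 1\<^sub>m d" "B * L = 1\<^sub>m d" "B \<in> carrier_mat d d" using mat_inverse(2)[OF L Bs] by auto
  define Z where "Z = transpose_mat B"
  have Z: "Z \<in> carrier_mat d d" using B by (simp add: Z_def)
  have LZ: "(real_mat M * D_V d V) * Z = 1\<^sub>m d"
    using transpose_mult[OF B(3) L] B(2) unfolding Z_def L_def by simp
  define u where "u = y - \<tau> \<cdot>\<^sub>v (real_mat M *\<^sub>v lambda_V d V)"
  have u: "u \<in> carrier_vec d" using y Mr l by (simp add: u_def)
  define c where "c = Z *\<^sub>v u"
  have c: "c \<in> carrier_vec d" using Z u by (simp add: c_def)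
  have Dc: "D_V d V *\<^sub>v c \<in> carrier_vec d" using D c by simp
  have "u = ((real_mat M * D_V d V) * Z) *\<^sub>v u" using u by (simp add: LZ)
  also have "\<dots> = (real_mat M * D_V d V) *\<^sub>v c" unfolding c_def by (rule assoc_mult_mat_vec[OF MD Z u])
  also have "\<dots> = real_mat M *\<^sub>v (D_V d V *\<^sub>v c)" by (rule assoc_mult_mat_vec[OF Mr D c])
  finally have "W *\<^sub>v u = (W * real_mat M) *\<^sub>v (D_V d V *\<^sub>v c)"
    using assoc_mult_mat_vec[OF W(1) Mr Dc] by simp
  hence Dc_eq: "D_V d V *\<^sub>v c = W *\<^sub>v u" using W(2) Dc by simp
  have "W *\<^sub>v u = W *\<^sub>v y - W *\<^sub>v (\<tau> \<cdot>\<^sub>v (real_mat M *\<^sub>v lambda_V d V))"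
    unfolding u_def using W(1) y Mr l by (intro mult_minus_distrib_mat_vec[of _ d d]) auto
  also have "W *\<^sub>v (\<tau> \<cdot>\<^sub>v (real_mat M *\<^sub>v lambda_V d V)) = \<tau> \<cdot>\<^sub>v (W *\<^sub>v (real_mat M *\<^sub>v lambda_V d V))"
    using W(1) Mr l by (intro mult_mat_vec[of _ d d]) auto
  also have "W *\<^sub>v (real_mat M *\<^sub>v lambda_V d V) = lambda_V d V"
    using assoc_mult_mat_vec[OF W(1) Mr l] W(2) l by simp
  finally have Wu: "W *\<^sub>v u = W *\<^sub>v y - \<tau> \<cdot>\<^sub>v lambda_V d V" .
  have E: "(\<Sum>k<d. basis_V d V ! k $ i * c $ k) = (W *\<^sub>v y) $ i - \<tau> * lambda_V d V $ i" if "i < d" for i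
  proof -
    have "(\<Sum>k<d. basis_V d V ! k $ i * c $ k) = (D_V d V *\<^sub>v c) $ i"
      unfolding mult_mat_vec_index[OF D c that] using that by (simp add: D_V_index)
    also have "\<dots> = (W *\<^sub>v y) $ i - \<tau> * lambda_V d V $ i"
      unfolding Dc_eq Wu using that W(1) l by (simp del: index_mult_mat_vec)
    finally show ?thesis .
  qed
  have "c $ k = em_coord V (\<lambda>i. (W *\<^sub>v y) $ i) \<tau> k" if "k < d"
    using basis_coordinates[of d V "\<lambda>k. c $ k" "\<lambda>i. (W *\<^sub>v y) $ i" \<tau> k, OF E that] .
  thus "k < d \<Longrightarrow> (transpose_mat (the (mat_inverse L)) *\<^sub>v (y - \<tau> \<cdot>\<^sub>v (real_mat M *\<^sub>v lambda_V d V))) $ k =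
      em_coord V (\<lambda>i. (W *\<^sub>v y) $ i) \<tau> k"
    unfolding Bs option.sel Z_def[symmetric] u_def[symmetric] c_def[symmetric] .
qed

text \<open>
  Translations by the sublattice \<open>M \<int>\<^sup>d\<close> become translations by integer vectors after applying the
  inverse \<open>W\<close> of \<open>M\<close>.
\<close>

lemma inverse_image_shift:
  fixes M :: "int mat"
  assumes M: "M \<in> carrier_mat d d" and W: "W \<in> carrier_mat d d" "W * real_mat M = 1\<^sub>m d"
    and x: "x \<in> carrier_vec d" and r: "r \<in> carrier_vec d" and m: "m \<in> carrier_vec d"
  shows "W *\<^sub>v (x + real_vec (r + M *\<^sub>v m)) = W *\<^sub>v (x + real_vec r) + real_vec m"
proof -
  have Mr: "real_mat M \<in> carrier_mat d d" using M by simp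
  have "real_vec (M *\<^sub>v m) = real_mat M *\<^sub>v real_vec m"
    by (rule of_int_hom.mult_mat_vec_hom[OF M m])
  moreover have "x + real_vec (r + w) = (x + real_vec r) + real_vec w" if "w \<in> carrier_vec d" for w
    using x r that by (intro eq_vecI) auto
  moreover have "M *\<^sub>v m \<in> carrier_vec d" using M m by simp
  ultimately have "x + real_vec (r + M *\<^sub>v m) = (x + real_vec r) + real_mat M *\<^sub>v real_vec m"
    by simp
  moreover have "W *\<^sub>v ((x + real_vec r) + real_mat M *\<^sub>v real_vec m) = W *\<^sub>v (x + real_vec r) + W *\<^sub>v (real_mat M *\<^sub>v real_vec m)"
    using W Mr x r m by (intro mult_add_distrib_mat_vec[of _ d d]) auto
  moreover have "W *\<^sub>v (real_mat M *\<^sub>v real_vec m) = real_vec m"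
    using assoc_mult_mat_vec[OF W(1) Mr, of "real_vec m"] W(2) m by simp
  ultimately show ?thesis by simp
qed

lemma vec_add_eq_imp_diff:
  fixes r r' p q :: "'a :: ab_group_add vec"
  assumes "r \<in> carrier_vec d" "r' \<in> carrier_vec d" "p \<in> carrier_vec d" "q \<in> carrier_vec d" and eq: "r + p = r' + q"
  shows "r = r' + (q - p)"
proof (rule eq_vecI)
  fix i assume "i < dim_vec (r' + (q - p))"
  hence i: "i < d" using assms by simp
  have "(r + p) $ i = (r' + q) $ i" unfolding eq ..
  thus "r $ i = (r' + (q - p)) $ i" using i assms(1-4) by (simp add: algebra_simps)
qed (use assms(1-4) in simp)

lemma em_coord_cong: "(\<And>i. i \<le> k \<Longrightarrow> z i = z' i) \<Longrightarrow> em_coord V z \<tau> k = em_coord V z' \<tau> k"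
  by (auto simp: em_coord_def intro!: sum.cong)

text \<open>
  The function \<open>B_{J,L}\<close> is supported on a half-open cell, whose coordinates are those of a unit cube. In
  each class modulo \<open>M \<int>\<^sup>d\<close> exactly one translate of \<open>x\<close> lies in the cell, and the product of the periodic
  functions takes the same value at all translates of the class.
\<close>

lemma bernoulli_lattice_sum:
  fixes M :: "int mat" and V :: "nat \<Rightarrow> nat"
  assumes M: "M \<in> carrier_mat d d" and dM: "det M \<noteq> 0"
    and W: "W \<in> carrier_mat d d" "W * real_mat M = 1\<^sub>m d"
    and C: "lattice_transversal d M C" and x: "x \<in> carrier_vec d"
  shows "(\<Sum>\<^sub>\<infinity>n\<in>carrier_vec d. bernoulli_L d K (transpose_mat (real_mat M * D_V d V))
       ((x - \<tau> \<cdot>\<^sub>v (real_mat M *\<^sub>v lambda_V d V)) + real_vec n)) =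
     1 / real_of_int \<bar>det M\<bar> * (\<Sum>r\<in>C. \<Prod>k<d. bernoulli_fun (K k) (em_coord V (\<lambda>i. (W *\<^sub>v (x + real_vec r)) $ i) \<tau> k))"
proof -
  define z where "z = (\<lambda>n i. (W *\<^sub>v (x + real_vec n)) $ i)"
  define P where "P = (\<lambda>n. \<forall>k<d. 0 \<le> em_coord V (z n) \<tau> k \<and> em_coord V (z n) \<tau> k < 1)"
  define F where "F = (\<lambda>n. \<Prod>k<d. bernoulli_fun (K k) (em_coord V (z n) \<tau> k))"
  have Cc: "C \<subseteq> carrier_vec d" and fin: "finite C" and cov: "\<And>v. v \<in> carrier_vec d \<Longrightarrow> \<exists>r\<in>C. \<exists>m\<in>carrier_vec d. v = r + M *\<^sub>v m"
    and tr: "\<And>r r' m. r \<in> C \<Longrightarrow> r' \<in> C \<Longrightarrow> m \<in> carrier_vec d \<Longrightarrow> r = r' + M *\<^sub>v m \<Longrightarrow> r = r'"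
    using C unfolding lattice_transversal_def lattice_covering_def by blast+
  have L: "bernoulli_L d K (transpose_mat (real_mat M * D_V d V)) ((x - \<tau> \<cdot>\<^sub>v (real_mat M *\<^sub>v lambda_V d V)) + real_vec n) =
      1 / real_of_int \<bar>det M\<bar> * (if P n then F n else 0)" if n: "n \<in> carrier_vec d" for n
  proof -
    have y: "x + real_vec n \<in> carrier_vec d" using x n by simp
    have eq: "(x - \<tau> \<cdot>\<^sub>v (real_mat M *\<^sub>v lambda_V d V)) + real_vec n = (x + real_vec n) - \<tau> \<cdot>\<^sub>v (real_mat M *\<^sub>v lambda_V d V)"
      using x n M by (intro eq_vecI) auto
    note co = inverse_coordinates[OF M dM W y, where V = V]
    define c where "c = transpose_mat (the (mat_inverse (transpose_mat (real_mat M * D_V d V)))) *\<^sub>v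
        ((x + real_vec n) - \<tau> \<cdot>\<^sub>v (real_mat M *\<^sub>v lambda_V d V))"
    have e: "c $ k = em_coord V (z n) \<tau> k" if "k < d" for k
      unfolding c_def z_def by (rule co(2)[OF that])
    have "(\<Prod>k<d. bernoulli_fun (K k) (c $ k)) = F n"
      unfolding F_def by (rule prod.cong) (simp_all add: e)
    moreover have "(\<forall>k<d. 0 \<le> c $ k \<and> c $ k < 1) = P n"
      unfolding P_def using e by simp
    ultimately show ?thesis
      unfolding bernoulli_L_def bernoulli_multi_def eq co(1) c_def[symmetric] by (simp add: inverse_eq_divide)
  qed
  have zs: "z (r + M *\<^sub>v m) i = z r i + of_int (m $ i)" if "r \<in> carrier_vec d" "m \<in> carrier_vec d" "i < d" for r m i
    unfolding z_def inverse_image_shift[OF M W x that(1,2)] using that W(1) by (simp del: index_mult_mat_vec)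
  have ec: "em_coord V (z (r + M *\<^sub>v m)) \<tau> k = em_coord V (\<lambda>i. z r i + of_int (m $ i)) \<tau> k"
    if "r \<in> carrier_vec d" "m \<in> carrier_vec d" "k < d" for r m k
    by (rule em_coord_cong) (use zs[OF that(1,2)] that(3) in simp)
  have "\<forall>r\<in>C. \<exists>m. m \<in> carrier_vec d \<and> P (r + M *\<^sub>v m)"
  proof
    fix r assume r: "r \<in> C"
    obtain f :: "nat \<Rightarrow> int" where f: "\<And>k. k < d \<Longrightarrow> 0 \<le> em_coord V (\<lambda>i. z r i + of_int (f i)) \<tau> k \<and> em_coord V (\<lambda>i. z r i + of_int (f i)) \<tau> k < 1"
      using exists_unit_cube_shift by blast
    have "em_coord V (z (r + M *\<^sub>v vec d f)) \<tau> k = em_coord V (\<lambda>i. z r i + of_int (f i)) \<tau> k" if "k < d" for k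
      by (rule em_coord_cong) (use zs[of r "vec d f"] r Cc that in auto)
    hence "P (r + M *\<^sub>v vec d f)" using f by (simp add: P_def)
    thus "\<exists>m. m \<in> carrier_vec d \<and> P (r + M *\<^sub>v m)" by (intro exI[of _ "vec d f"]) simp
  qed
  from bchoice[OF this] obtain \<mu> where \<mu>: "\<And>r. r \<in> C \<Longrightarrow> \<mu> r \<in> carrier_vec d" "\<And>r. r \<in> C \<Longrightarrow> P (r + M *\<^sub>v \<mu> r)"
    by blast
  \<comment> \<open>The unique translate in the class of \<open>r\<close> that lies in the cell.\<close>
  define \<psi> where "\<psi> = (\<lambda>r. r + M *\<^sub>v \<mu> r)"
  have diffeq: "r + M *\<^sub>v a = r' + M *\<^sub>v b \<Longrightarrow> r = r' + M *\<^sub>v (b - a)"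
    if "r \<in> carrier_vec d" "r' \<in> carrier_vec d" "a \<in> carrier_vec d" "b \<in> carrier_vec d" for r r' a b
  proof -
    assume eq: "r + M *\<^sub>v a = r' + M *\<^sub>v b"
    have Mab: "M *\<^sub>v (b - a) = M *\<^sub>v b - M *\<^sub>v a" by (rule mult_minus_distrib_mat_vec[OF M that(4,3)])
    have Mc: "M *\<^sub>v a \<in> carrier_vec d" "M *\<^sub>v b \<in> carrier_vec d" using M that by auto
    show "r = r' + M *\<^sub>v (b - a)"
      unfolding Mab by (rule vec_add_eq_imp_diff[OF that(1,2) Mc eq])
  qed
  have bij: "bij_betw \<psi> C {n \<in> carrier_vec d. P n}"
  proof (rule bij_betwI')
    fix r r' assume r: "r \<in> C" "r' \<in> C"
    show "\<psi> r = \<psi> r' \<longleftrightarrow> r = r'"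
    proof
      assume "\<psi> r = \<psi> r'"
      hence "r = r' + M *\<^sub>v (\<mu> r' - \<mu> r)" unfolding \<psi>_def by (intro diffeq) (use r Cc \<mu>(1) in auto)
      thus "r = r'" by (rule tr[OF r, rotated]) (use \<mu>(1) r in auto)
    qed simp
  next
    fix r assume "r \<in> C"
    thus "\<psi> r \<in> {n \<in> carrier_vec d. P n}" using \<mu> Cc M by (auto simp: \<psi>_def)
  next
    fix n assume "n \<in> {n \<in> carrier_vec d. P n}"
    hence n: "n \<in> carrier_vec d" "P n" by auto
    obtain r m where r: "r \<in> C" and m: "m \<in> carrier_vec d" and eq: "n = r + M *\<^sub>v m" using cov[OF n(1)] by blast
    have rc: "r \<in> carrier_vec d" using r Cc by auto
    have "(m - \<mu> r) $ k = 0" if k: "k < d" for k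
    proof (rule unit_cube_shift_unique[of d V "z (\<psi> r)" \<tau> "\<lambda>i. (m - \<mu> r) $ i", OF _ _ k])
      show "0 \<le> em_coord V (z (\<psi> r)) \<tau> k \<and> em_coord V (z (\<psi> r)) \<tau> k < 1" if "k < d" for k
        using \<mu>(2)[OF r] that by (simp add: P_def \<psi>_def)
      fix k assume k: "k < d"
      have "em_coord V (\<lambda>i. z (\<psi> r) i + of_int ((m - \<mu> r) $ i)) \<tau> k = em_coord V (z n) \<tau> k"
        by (rule em_coord_cong) (use zs[OF rc \<mu>(1)[OF r]] zs[OF rc m] k \<mu>(1)[OF r] m in \<open>auto simp: \<psi>_def eq\<close>)
      thus "0 \<le> em_coord V (\<lambda>i. z (\<psi> r) i + of_int ((m - \<mu> r) $ i)) \<tau> k \<and> em_coord V (\<lambda>i. z (\<psi> r) i + of_int ((m - \<mu> r) $ i)) \<tau> k < 1"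
        using n(2) k by (simp add: P_def)
    qed
    hence "m = \<mu> r" using m \<mu>(1)[OF r] by (intro eq_vecI) auto
    hence "n = \<psi> r" by (simp add: eq \<psi>_def)
    thus "\<exists>r\<in>C. n = \<psi> r" using r by blast
  qed
  have finP: "finite {n \<in> carrier_vec d. P n}" using bij_betw_finite[OF bij] fin by simp
  have "(\<Sum>\<^sub>\<infinity>n\<in>carrier_vec d. bernoulli_L d K (transpose_mat (real_mat M * D_V d V))
       ((x - \<tau> \<cdot>\<^sub>v (real_mat M *\<^sub>v lambda_V d V)) + real_vec n)) =
      (\<Sum>\<^sub>\<infinity>n\<in>{n \<in> carrier_vec d. P n}. 1 / real_of_int \<bar>det M\<bar> * F n)"
    by (rule infsum_cong_neutral) (auto simp: L)
  also have "\<dots> = (\<Sum>n\<in>{n \<in> carrier_vec d. P n}. 1 / real_of_int \<bar>det M\<bar> * F n)"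
    by (rule infsum_finite[OF finP])
  also have "\<dots> = (\<Sum>r\<in>C. 1 / real_of_int \<bar>det M\<bar> * F (\<psi> r))"
    by (rule sum.reindex_bij_betw[OF bij, symmetric])
  also have "\<dots> = 1 / real_of_int \<bar>det M\<bar> * (\<Sum>r\<in>C. F (\<psi> r))"
    by (simp only: sum_distrib_left)
  also have "(\<Sum>r\<in>C. F (\<psi> r)) = (\<Sum>r\<in>C. F r)"
  proof (rule sum.cong[OF refl])
    fix r assume r: "r \<in> C"
    have rc: "r \<in> carrier_vec d" using r Cc by auto
    show "F (\<psi> r) = F r"
      unfolding F_def
    proof (rule prod.cong[OF refl])
      fix k assume "k \<in> {..<d}"
      hence k: "k < d" by simp
      have "em_coord V (z (\<psi> r)) \<tau> k = em_coord V (z r) \<tau> k + (if V k = 1 then of_int (\<mu> r $ k) else (\<Sum>i\<le>k. of_int (\<mu> r $ i)))"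
        unfolding \<psi>_def ec[OF rc \<mu>(1)[OF r] k] em_coord_shift ..
      moreover have "(if V k = 1 then of_int (\<mu> r $ k) else (\<Sum>i\<le>k. of_int (\<mu> r $ i))) \<in> (\<int> :: real set)"
        by (auto intro: Ints_sum)
      ultimately show "bernoulli_fun (K k) (em_coord V (z (\<psi> r)) \<tau> k) = bernoulli_fun (K k) (em_coord V (z r) \<tau> k)"
        by (simp only: bernoulli_fun_add_Int)
    qed
  qed
  finally show ?thesis unfolding F_def z_def .
qed

section \<open>Lattice points of the dilated simplex\<close>

text \<open>
  Induction on the number \<open>m\<close> of columns with a nonzero coefficient: splitting off one column with
  coefficient \<open>a\<close> leaves a point with fewer columns, scaled by \<open>1 - a\<close>. The missing mass belongs to the
  vertex \<open>0\<close>.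
\<close>

lemma convex_vec_contains_combination:
  assumes M: "M \<in> carrier_mat d d" and T: "convex_vec d T" and T0: "0\<^sub>v d \<in> T" and Tc: "\<And>j. j < d \<Longrightarrow> col M j \<in> T"
  shows "m \<le> d \<Longrightarrow> y \<in> std_simplex d \<Longrightarrow> (\<And>k. m \<le> k \<Longrightarrow> k < d \<Longrightarrow> y $ k = 0) \<Longrightarrow> M *\<^sub>v y \<in> T"
proof (induction m arbitrary: y)
  case 0
  have "M *\<^sub>v y = 0\<^sub>v d"
  proof (rule eq_vecI)
    fix i assume "i < dim_vec (0\<^sub>v d :: real vec)"
    hence "(M *\<^sub>v y) $ i = (\<Sum>k<d. M $$ (i, k) * y $ k)"
      using mult_mat_vec_index[OF M std_simplex_carrier[OF 0(2)]] by simp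
    thus "(M *\<^sub>v y) $ i = 0\<^sub>v d $ i" using 0(3) \<open>i < dim_vec (0\<^sub>v d :: real vec)\<close> by simp
  qed (use M in simp)
  thus ?case using T0 by simp
next
  case (Suc m)
  define a where "a = y $ m"
  have m: "m < d" using Suc.prems by simp
  have yc: "y \<in> carrier_vec d" and ynn: "\<And>k. k < d \<Longrightarrow> 0 \<le> y $ k" and yt: "(\<Sum>k<d. y $ k) \<le> 1"
    using Suc.prems(2) by (auto simp: std_simplex_def vec_total_def)
  define y' where "y' = vec d (\<lambda>k. if k = m then 0 else y $ k)"
  have rest: "(\<Sum>k<d. y' $ k) = (\<Sum>k<d. y $ k) - a"
    using m by (subst (1 2) sum.remove[of _ m]) (auto simp: y'_def a_def)
  have y'nn: "0 \<le> y' $ k" if "k < d" for k using ynn that by (simp add: y'_def)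
  have a: "0 \<le> a" "a \<le> 1" using ynn[OF m] rest yt sum_nonneg[of "{..<d}" "\<lambda>k. y' $ k"] y'nn by (auto simp: a_def)
  have My: "M *\<^sub>v y = M *\<^sub>v y' + a \<cdot>\<^sub>v col M m"
  proof (rule eq_vecI)
    fix i assume "i < dim_vec (M *\<^sub>v y' + a \<cdot>\<^sub>v col M m)"
    hence i: "i < d" using M by simp
    have "(\<Sum>k<d. M $$ (i, k) * y $ k) = (\<Sum>k<d. M $$ (i, k) * y' $ k) + a * M $$ (i, m)"
      using m by (subst (1 2) sum.remove[of _ m]) (auto simp: y'_def a_def)
    thus "(M *\<^sub>v y) $ i = (M *\<^sub>v y' + a \<cdot>\<^sub>v col M m) $ i"
      using mult_mat_vec_index[OF M yc i] mult_mat_vec_index[OF M, of y' i] i m M by (simp add: y'_def del: index_mult_mat_vec)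
  qed (use M in simp)
  show ?case
  proof (cases "a = 1")
    case True
    hence "(\<Sum>k<d. y' $ k) \<le> 0" using rest yt by simp
    hence "y' $ k = 0" if "k < d" for k
      using that y'nn sum_nonneg_eq_0_iff[of "{..<d}" "\<lambda>k. y' $ k"] sum_nonneg[of "{..<d}" "\<lambda>k. y' $ k"] by force
    hence "M *\<^sub>v y' = 0\<^sub>v d"
      using mult_mat_vec_index[OF M, of y'] M by (intro eq_vecI) (auto simp: y'_def simp del: index_mult_mat_vec)
    hence "M *\<^sub>v y = col M m" unfolding My True using M m by (intro eq_vecI) auto
    thus ?thesis using Tc[OF m] by simp
  next
    case False
    hence a1: "1 - a > 0" using a by simp
    define y'' where "y'' = (1 / (1 - a)) \<cdot>\<^sub>v y'"
    have "y'' \<in> std_simplex d"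
    proof -
      have "(\<Sum>k<d. y'' $ k) = (\<Sum>k<d. y' $ k) / (1 - a)"
        by (simp add: y''_def y'_def sum_divide_distrib)
      also have "\<dots> \<le> 1" using rest yt a1 by simp
      finally show ?thesis using a1 y'nn by (auto simp: std_simplex_def vec_total_def y''_def y'_def)
    qed
    hence "M *\<^sub>v y'' \<in> T"
    proof (rule Suc.IH[rotated])
      show "y'' $ k = 0" if "m \<le> k" "k < d" for k
        using that Suc.prems(3)[of k] by (cases "k = m") (auto simp: y''_def y'_def)
    qed (use m in simp)
    hence "(1 - a) \<cdot>\<^sub>v (M *\<^sub>v y'') + a \<cdot>\<^sub>v col M m \<in> T"
      using T Tc[OF m] a a1 unfolding convex_vec_def by simp
    moreover have "(1 - a) \<cdot>\<^sub>v (M *\<^sub>v y'') = M *\<^sub>v y'"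
    proof -
      have "(1 - a) \<cdot>\<^sub>v (M *\<^sub>v y'') = M *\<^sub>v ((1 - a) \<cdot>\<^sub>v y'')"
        using M by (intro mult_mat_vec[symmetric, of _ d d]) (auto simp: y''_def y'_def)
      moreover have "(1 - a) \<cdot>\<^sub>v y'' = y'" using a1 by (intro eq_vecI) (auto simp: y''_def)
      ultimately show ?thesis by simp
    qed
    ultimately show ?thesis unfolding My by simp
  qed
qed

lemma lattice_simplex_iff:
  fixes M :: "int mat"
  assumes M: "M \<in> carrier_mat d d"
    and W: "W \<in> carrier_mat d d" "W * real_mat M = 1\<^sub>m d" "real_mat M * W = 1\<^sub>m d"
  shows "p \<in> lattice_simplex d M \<longleftrightarrow> p \<in> carrier_vec d \<and> W *\<^sub>v p \<in> std_simplex d"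
proof
  have Mr: "real_mat M \<in> carrier_mat d d" using M by simp
  have colr: "real_vec (col M j) = col (real_mat M) j" if "j < d" for j
    using M that by (intro eq_vecI) auto
  have cols: "real_vec ` set (cols M) = (\<lambda>j. col (real_mat M) j) ` {..<d}"
    using M colr by (auto simp: cols_def image_image lessThan_atLeast0)
  define T where "T = {p \<in> carrier_vec d. W *\<^sub>v p \<in> std_simplex d}"
  have "convex_vec d T"
    unfolding convex_vec_def
  proof (intro conjI ballI allI impI)
    fix p q :: "real vec" and u v :: real
    assume pq: "p \<in> T" "q \<in> T" and uv: "0 \<le> u" "0 \<le> v" "u + v = 1"
    have pc: "p \<in> carrier_vec d" "q \<in> carrier_vec d" using pq by (auto simp: T_def)
    have lin: "(W *\<^sub>v (u \<cdot>\<^sub>v p + v \<cdot>\<^sub>v q)) $ k = u * (W *\<^sub>v p) $ k + v * (W *\<^sub>v q) $ k" if "k < d" for k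
      using pc that by (subst (1 2 3) mult_mat_vec_index[OF W(1)]) (auto simp: sum.distrib sum_distrib_left algebra_simps)
    have s: "(\<Sum>k<d. (W *\<^sub>v p) $ k) \<le> 1" "(\<Sum>k<d. (W *\<^sub>v q) $ k) \<le> 1"
      and nn: "\<And>k. k < d \<Longrightarrow> 0 \<le> (W *\<^sub>v p) $ k" "\<And>k. k < d \<Longrightarrow> 0 \<le> (W *\<^sub>v q) $ k"
      using pq W(1) unfolding T_def std_simplex_def vec_total_def by (auto simp del: index_mult_mat_vec)
    have "(\<Sum>k<d. (W *\<^sub>v (u \<cdot>\<^sub>v p + v \<cdot>\<^sub>v q)) $ k) = u * (\<Sum>k<d. (W *\<^sub>v p) $ k) + v * (\<Sum>k<d. (W *\<^sub>v q) $ k)"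
      by (simp add: lin sum.distrib sum_distrib_left del: index_mult_mat_vec)
    also have "\<dots> \<le> u * 1 + v * 1" using s uv by (intro add_mono mult_left_mono) auto
    finally have "vec_total (W *\<^sub>v (u \<cdot>\<^sub>v p + v \<cdot>\<^sub>v q)) \<le> 1"
      using uv W(1) by (simp add: vec_total_def del: index_mult_mat_vec)
    moreover have "\<forall>k<d. 0 \<le> (W *\<^sub>v (u \<cdot>\<^sub>v p + v \<cdot>\<^sub>v q)) $ k"
      using nn uv by (simp add: lin del: index_mult_mat_vec)
    ultimately show "u \<cdot>\<^sub>v p + v \<cdot>\<^sub>v q \<in> T"
      using pc W(1) by (simp add: T_def std_simplex_def del: index_mult_mat_vec)
  qed (auto simp: T_def)
  moreover have "0\<^sub>v d \<in> T"
  proof -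
    have "W *\<^sub>v 0\<^sub>v d = 0\<^sub>v d" using W(1) by (intro eq_vecI) auto
    moreover have "0\<^sub>v d \<in> std_simplex d" by (simp add: std_simplex_def vec_total_def)
    ultimately show ?thesis by (simp add: T_def)
  qed
  moreover have "col (real_mat M) j \<in> T" if j: "j < d" for j
  proof -
    have "W *\<^sub>v col (real_mat M) j = col (W * real_mat M) j" using W(1) Mr j by (intro eq_vecI) auto
    also have "\<dots> = unit_vec d j" using j by (simp add: W(2))
    finally have "W *\<^sub>v col (real_mat M) j = unit_vec d j" .
    moreover have "vec_total (unit_vec d j) = 1"
      using vec_total_add_unit[of "0\<^sub>v d" d j 1] j by (simp add: vec_total_def)
    ultimately show ?thesis using Mr j by (auto simp: T_def std_simplex_def)
  qed
  ultimately have "lattice_simplex d M \<subseteq> T"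
    unfolding lattice_simplex_def cols by (intro hull_minimal) auto
  thus "p \<in> lattice_simplex d M \<Longrightarrow> p \<in> carrier_vec d \<and> W *\<^sub>v p \<in> std_simplex d"
    by (auto simp: T_def)
  assume p: "p \<in> carrier_vec d \<and> W *\<^sub>v p \<in> std_simplex d"
  have eq: "p = real_mat M *\<^sub>v (W *\<^sub>v p)"
    using assoc_mult_mat_vec[OF Mr W(1), of p] W(3) p by simp
  have "p \<in> S" if S: "convex_vec d S" "insert (0\<^sub>v d) (real_vec ` set (cols M)) \<subseteq> S" for S
  proof -
    have "real_mat M *\<^sub>v (W *\<^sub>v p) \<in> S"
      by (rule convex_vec_contains_combination[OF Mr S(1), of d]) (use S(2) p in \<open>auto simp: cols\<close>)
    thus ?thesis using eq by simp
  qed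
  thus "p \<in> lattice_simplex d M" unfolding lattice_simplex_def hull_def by blast
qed

lemma dilated_simplex_iff:
  fixes M :: "int mat"
  assumes M: "M \<in> carrier_mat d d" and \<tau>: "\<tau> > 0"
    and W: "W \<in> carrier_mat d d" "W * real_mat M = 1\<^sub>m d" "real_mat M * W = 1\<^sub>m d"
  shows "p \<in> (\<lambda>p. \<tau> \<cdot>\<^sub>v p) ` lattice_simplex d M \<longleftrightarrow> p \<in> carrier_vec d \<and> (1 / \<tau>) \<cdot>\<^sub>v (W *\<^sub>v p) \<in> std_simplex d"
proof -
  have "p \<in> (\<lambda>p. \<tau> \<cdot>\<^sub>v p) ` lattice_simplex d M \<longleftrightarrow> (1 / \<tau>) \<cdot>\<^sub>v p \<in> lattice_simplex d M"
  proof
    assume "p \<in> (\<lambda>p. \<tau> \<cdot>\<^sub>v p) ` lattice_simplex d M"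
    then obtain p' where p': "p' \<in> lattice_simplex d M" "p = \<tau> \<cdot>\<^sub>v p'" by blast
    have "(1 / \<tau>) \<cdot>\<^sub>v p = p'" using \<tau> unfolding p'(2) by (intro eq_vecI) auto
    thus "(1 / \<tau>) \<cdot>\<^sub>v p \<in> lattice_simplex d M" using p' by simp
  next
    assume "(1 / \<tau>) \<cdot>\<^sub>v p \<in> lattice_simplex d M"
    moreover have "p = \<tau> \<cdot>\<^sub>v ((1 / \<tau>) \<cdot>\<^sub>v p)" using \<tau> by (intro eq_vecI) auto
    ultimately show "p \<in> (\<lambda>p. \<tau> \<cdot>\<^sub>v p) ` lattice_simplex d M" by blast
  qed
  moreover have "(1 / \<tau>) \<cdot>\<^sub>v p \<in> carrier_vec d \<longleftrightarrow> p \<in> carrier_vec d" by (simp only: carrier_dim_vec index_smult_vec(2))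
  moreover have "W *\<^sub>v ((1 / \<tau>) \<cdot>\<^sub>v p) = (1 / \<tau>) \<cdot>\<^sub>v (W *\<^sub>v p)" if "p \<in> carrier_vec d"
    by (rule mult_mat_vec[OF W(1) that])
  ultimately show ?thesis unfolding lattice_simplex_iff[OF M W] by auto
qed

text \<open>
  In the class of \<open>r\<close> modulo \<open>M \<int>\<^sup>d\<close>, the translate by \<open>r + M m\<close> lies in the dilated simplex if and only if
  its preimage under \<open>\<tau> M\<close> is a lattice point \<open>p\<close> of the standard simplex; \<open>m\<close> is recovered from \<open>p\<close> by
  rounding. The finite set \<open>N\<close> is arbitrary as long as it catches all translates in the simplex, so that
  it can be kept fixed when \<open>x\<close> varies in a small ball.
\<close>

lemma weighted_lattice_sum:
  fixes M :: "int mat"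
  assumes M: "M \<in> carrier_mat d d" and \<tau>: "\<tau> > 0"
    and W: "W \<in> carrier_mat d d" "W * real_mat M = 1\<^sub>m d" "real_mat M * W = 1\<^sub>m d"
    and C: "lattice_transversal d M C" and x: "x \<in> carrier_vec d"
    and N: "finite N" "N \<subseteq> carrier_vec d"
      "\<And>n. n \<in> carrier_vec d \<Longrightarrow> x + real_vec n \<in> (\<lambda>p. \<tau> \<cdot>\<^sub>v p) ` lattice_simplex d M \<Longrightarrow> n \<in> N"
  shows "(\<Sum>n\<in>N. indicat_real ((\<lambda>p. \<tau> \<cdot>\<^sub>v p) ` lattice_simplex d M) (x + real_vec n) * q (x + real_vec n)) =
    (\<Sum>r\<in>C. \<Sum>p\<in>lattice_points d (\<lambda>i. (W *\<^sub>v (x + real_vec r)) $ i) \<tau>. dilated q \<tau> M p)"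
proof -
  define S where "S = (\<lambda>p. \<tau> \<cdot>\<^sub>v p) ` lattice_simplex d M"
  define z where "z = (\<lambda>n. W *\<^sub>v (x + real_vec n))"
  have Mr: "real_mat M \<in> carrier_mat d d" using M by simp
  have Cc: "C \<subseteq> carrier_vec d" and fin: "finite C" and cov: "\<And>v. v \<in> carrier_vec d \<Longrightarrow> \<exists>r\<in>C. \<exists>m\<in>carrier_vec d. v = r + M *\<^sub>v m"
    and tr: "\<And>r r' m. r \<in> C \<Longrightarrow> r' \<in> C \<Longrightarrow> m \<in> carrier_vec d \<Longrightarrow> r = r' + M *\<^sub>v m \<Longrightarrow> r = r'"
    using C unfolding lattice_transversal_def lattice_covering_def by blast+
  have zc: "z n \<in> carrier_vec d" if "n \<in> carrier_vec d" for n using W(1) x that by (simp add: z_def)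
  have zs: "z (r + M *\<^sub>v m) = z r + real_vec m" if "r \<in> carrier_vec d" "m \<in> carrier_vec d" for r m
    unfolding z_def by (rule inverse_image_shift[OF M W(1,2) x that])
  have Sz: "x + real_vec n \<in> S \<longleftrightarrow> (1 / \<tau>) \<cdot>\<^sub>v z n \<in> std_simplex d" if "n \<in> carrier_vec d" for n
    unfolding S_def dilated_simplex_iff[OF M \<tau> W] using x that by (simp add: z_def)
  have Mz: "real_mat M *\<^sub>v z n = x + real_vec n" if "n \<in> carrier_vec d" for n
    using assoc_mult_mat_vec[OF Mr W(1), of "x + real_vec n"] W(3) x that by (simp add: z_def)
  define N' where "N' = {n \<in> carrier_vec d. x + real_vec n \<in> S}"
  define D where "D = (SIGMA r : C. lattice_points d (\<lambda>i. z r $ i) \<tau>)"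
  \<comment> \<open>The lattice vector that takes \<open>x\<close> to the image of \<open>p\<close> under \<open>\<tau> M\<close>; the floor is exact here.\<close>
  define \<nu> where "\<nu> = (\<lambda>(r, p). r + M *\<^sub>v vec d (\<lambda>i. \<lfloor>\<tau> * p $ i - z r $ i\<rfloor>))"
  have z\<nu>: "z (\<nu> (r, p)) = \<tau> \<cdot>\<^sub>v p" if "r \<in> C" "p \<in> lattice_points d (\<lambda>i. z r $ i) \<tau>" for r p
  proof -
    have rc: "r \<in> carrier_vec d" using that Cc by auto
    have pc: "p \<in> carrier_vec d" using that(2) by (auto simp: lattice_points_def std_simplex_def)
    have "z (\<nu> (r, p)) = z r + real_vec (vec d (\<lambda>i. \<lfloor>\<tau> * p $ i - z r $ i\<rfloor>))"
      unfolding \<nu>_def prod.case by (rule zs[OF rc]) simp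
    also have "\<dots> = \<tau> \<cdot>\<^sub>v p"
    proof (rule eq_vecI)
      fix i assume "i < dim_vec (\<tau> \<cdot>\<^sub>v p)"
      hence i: "i < d" using pc by simp
      hence "\<tau> * p $ i - z r $ i \<in> \<int>" using that(2) by (simp add: lattice_points_def)
      then obtain k where k: "\<tau> * p $ i - z r $ i = of_int k" by (rule Ints_cases)
      have "(z r + real_vec (vec d (\<lambda>i. \<lfloor>\<tau> * p $ i - z r $ i\<rfloor>))) $ i = z r $ i + of_int \<lfloor>\<tau> * p $ i - z r $ i\<rfloor>"
        using i zc[OF rc] by simp
      also have "\<dots> = z r $ i + (\<tau> * p $ i - z r $ i)" unfolding k floor_of_int ..
      also have "\<dots> = (\<tau> \<cdot>\<^sub>v p) $ i" using i pc by simp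
      finally show "(z r + real_vec (vec d (\<lambda>i. \<lfloor>\<tau> * p $ i - z r $ i\<rfloor>))) $ i = (\<tau> \<cdot>\<^sub>v p) $ i" .
    qed (use pc zc[OF rc] in simp)
    finally show ?thesis .
  qed
  have \<nu>c: "\<nu> (r, p) \<in> carrier_vec d" if "r \<in> C" for r p
    using that Cc M by (auto simp: \<nu>_def)
  have scale: "(1 / \<tau>) \<cdot>\<^sub>v (\<tau> \<cdot>\<^sub>v p) = p" for p :: "real vec" using \<tau> by (intro eq_vecI) auto
  have bij: "bij_betw \<nu> D N'"
  proof (rule bij_betwI')
    fix a b assume ab: "a \<in> D" "b \<in> D"
    obtain r p r' p' where e: "a = (r, p)" "b = (r', p')" by (cases a, cases b) auto
    have r: "r \<in> C" "r' \<in> C" and p: "p \<in> lattice_points d (\<lambda>i. z r $ i) \<tau>" "p' \<in> lattice_points d (\<lambda>i. z r' $ i) \<tau>"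
      using ab by (auto simp: D_def e)
    show "\<nu> a = \<nu> b \<longleftrightarrow> a = b"
    proof
      assume eq: "\<nu> a = \<nu> b"
      have "p = p'" using z\<nu>[OF r(1) p(1)] z\<nu>[OF r(2) p(2)] eq scale[of p] scale[of p'] unfolding e by simp
      define m where "m = vec d (\<lambda>i. \<lfloor>\<tau> * p $ i - z r $ i\<rfloor>)"
      define m' where "m' = vec d (\<lambda>i. \<lfloor>\<tau> * p' $ i - z r' $ i\<rfloor>)"
      have mc: "m \<in> carrier_vec d" "m' \<in> carrier_vec d" by (simp_all add: m_def m'_def)
      have eqm: "r + M *\<^sub>v m = r' + M *\<^sub>v m'" using eq unfolding e \<nu>_def m_def m'_def by simp
      have rc: "r \<in> carrier_vec d" "r' \<in> carrier_vec d" using r Cc by auto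
      have Mab: "M *\<^sub>v (m' - m) = M *\<^sub>v m' - M *\<^sub>v m" by (rule mult_minus_distrib_mat_vec[OF M mc(2,1)])
      have Mc: "M *\<^sub>v m \<in> carrier_vec d" "M *\<^sub>v m' \<in> carrier_vec d" using M mc by auto
      have "r = r' + M *\<^sub>v (m' - m)"
        unfolding Mab by (rule vec_add_eq_imp_diff[OF rc Mc eqm])
      hence "r = r'" by (rule tr[OF r, rotated]) (use mc in auto)
      thus "a = b" using \<open>p = p'\<close> e by simp
    qed simp
  next
    fix a assume a: "a \<in> D"
    obtain r p where e: "a = (r, p)" by (cases a) auto
    have r: "r \<in> C" and p: "p \<in> lattice_points d (\<lambda>i. z r $ i) \<tau>" using a by (auto simp: D_def e)
    have "x + real_vec (\<nu> (r, p)) \<in> S"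
      unfolding Sz[OF \<nu>c[OF r]] z\<nu>[OF r p] scale using p by (simp add: lattice_points_def)
    thus "\<nu> a \<in> N'" using \<nu>c[OF r] by (simp add: N'_def e)
  next
    fix n assume "n \<in> N'"
    hence n: "n \<in> carrier_vec d" "x + real_vec n \<in> S" by (auto simp: N'_def)
    obtain r m where r: "r \<in> C" and m: "m \<in> carrier_vec d" and eq: "n = r + M *\<^sub>v m" using cov[OF n(1)] by blast
    have rc: "r \<in> carrier_vec d" using r Cc by auto
    define p where "p = (1 / \<tau>) \<cdot>\<^sub>v z n"
    have pS: "p \<in> std_simplex d" using n Sz[OF n(1)] by (simp add: p_def)
    have pm: "\<tau> * p $ i - z r $ i = of_int (m $ i)" if "i < d" for i
      using that zc[OF n(1)] zc[OF rc] m \<tau> unfolding p_def by (simp add: eq zs[OF rc m])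
    have "p \<in> lattice_points d (\<lambda>i. z r $ i) \<tau>" using pS pm by (simp add: lattice_points_def)
    moreover have "vec d (\<lambda>i. \<lfloor>\<tau> * p $ i - z r $ i\<rfloor>) = m" using m by (intro eq_vecI) (auto simp: pm)
    hence "\<nu> (r, p) = n" by (simp add: \<nu>_def eq)
    ultimately show "\<exists>a\<in>D. n = \<nu> a" using r by (intro bexI[of _ "(r, p)"]) (auto simp: D_def)
  qed
  have "(\<Sum>n\<in>N. indicat_real S (x + real_vec n) * q (x + real_vec n)) = (\<Sum>n\<in>N'. q (x + real_vec n))"
    by (rule sum.mono_neutral_cong_right) (use N in \<open>auto simp: N'_def S_def indicator_def\<close>)
  also have "\<dots> = (\<Sum>a\<in>D. q (x + real_vec (\<nu> a)))"
    by (rule sum.reindex_bij_betw[OF bij, symmetric])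
  also have "\<dots> = (\<Sum>(r, p)\<in>D. dilated q \<tau> M p)"
  proof (rule sum.cong[OF refl])
    fix a assume a: "a \<in> D"
    obtain r p where e: "a = (r, p)" by (cases a) auto
    have r: "r \<in> C" and p: "p \<in> lattice_points d (\<lambda>i. z r $ i) \<tau>" using a by (auto simp: D_def e)
    have pc: "p \<in> carrier_vec d" using p by (auto simp: lattice_points_def std_simplex_def)
    have "x + real_vec (\<nu> (r, p)) = real_mat M *\<^sub>v (\<tau> \<cdot>\<^sub>v p)" using Mz[OF \<nu>c[OF r, of p]] unfolding z\<nu>[OF r p] by (rule sym)
    also have "\<dots> = \<tau> \<cdot>\<^sub>v (real_mat M *\<^sub>v p)" by (rule mult_mat_vec[OF Mr pc])
    finally show "q (x + real_vec (\<nu> a)) = (case a of (r, p) \<Rightarrow> dilated q \<tau> M p)" by (simp add: e dilated_def)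
  qed
  also have "\<dots> = (\<Sum>r\<in>C. \<Sum>p\<in>lattice_points d (\<lambda>i. z r $ i) \<tau>. dilated q \<tau> M p)"
    unfolding D_def by (rule sum.Sigma[symmetric]) (auto simp: fin finite_lattice_points \<tau>)
  finally show ?thesis unfolding S_def z_def .
qed

section \<open>The unit ball and null sets\<close>

lemma product_sigma_finite_lborel: "product_sigma_finite (\<lambda>_ :: nat. lborel :: real measure)"
  by (simp add: product_sigma_finite_def sigma_finite_lborel)

lemma euclidean_unit_ball_abs_le:
  assumes "y \<in> euclidean_unit_ball d" "k < d"
  shows "\<bar>y k\<bar> \<le> 1"
proof -
  have "(y k)\<^sup>2 \<le> (\<Sum>k<d. (y k)\<^sup>2)" using assms(2) by (intro member_le_sum) auto
  hence "(y k)\<^sup>2 \<le> 1" using assms(1) by (simp add: euclidean_unit_ball_def)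
  thus ?thesis by (simp add: abs_square_le_1)
qed

lemma euclidean_unit_ball_sets: "euclidean_unit_ball d \<in> sets (lebesgue_prod d)"
proof -
  have "euclidean_unit_ball d = {y \<in> space (lebesgue_prod d). (\<Sum>k<d. (y k)\<^sup>2) \<le> 1}"
    by (auto simp: euclidean_unit_ball_def space_PiM)
  also have "\<dots> \<in> sets (lebesgue_prod d)" by measurable
  finally show ?thesis .
qed

lemma euclidean_unit_ball_finite: "emeasure (lebesgue_prod d) (euclidean_unit_ball d) < \<infinity>"
proof -
  interpret product_sigma_finite "\<lambda>_ :: nat. lborel :: real measure" by (rule product_sigma_finite_lborel)
  have "emeasure (lebesgue_prod d) (euclidean_unit_ball d) \<le> emeasure (lebesgue_prod d) (Pi\<^sub>E {..<d} (\<lambda>_. {-1..1}))"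
  proof (rule emeasure_mono)
    show "euclidean_unit_ball d \<subseteq> Pi\<^sub>E {..<d} (\<lambda>_. {-1..1})"
    proof
      fix y assume y: "y \<in> euclidean_unit_ball d"
      have "y \<in> extensional {..<d}" using y by (simp add: euclidean_unit_ball_def PiE_iff)
      moreover have "y k \<in> {-1..1}" if "k < d" for k
        using euclidean_unit_ball_abs_le[OF y that] by (simp add: abs_le_iff)
      ultimately show "y \<in> Pi\<^sub>E {..<d} (\<lambda>_. {-1..1})" by (simp add: PiE_iff)
    qed
    show "Pi\<^sub>E {..<d} (\<lambda>_. {-1..1}) \<in> sets (lebesgue_prod d)"
      by (rule sets_PiM_I_finite) simp_all
  qed
  also have "\<dots> = (\<Prod>k<d. emeasure lborel {-1..1 :: real})" by (rule emeasure_PiM) auto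
  also have "\<dots> = ennreal 2 ^ d" by simp
  also have "\<dots> = ennreal (2 ^ d)" by (rule ennreal_power) simp
  also have "\<dots> < \<infinity>" by simp
  finally show ?thesis .
qed

text \<open>
  By Fubini, with the coordinate \<open>k\<close> innermost: its coefficient does not vanish, so each line in this
  direction meets the hyperplane in one point.
\<close>

lemma AE_not_on_hyperplane:
  assumes k: "k < d" and w: "w k \<noteq> (0 :: real)"
  shows "AE y in lebesgue_prod d. (\<Sum>i<d. w i * y i) \<noteq> c"
proof -
  interpret product_sigma_finite "\<lambda>_ :: nat. lborel :: real measure" by (rule product_sigma_finite_lborel)
  define I where "I = {..<d} - {k}"
  have ins: "{..<d} = insert k I" "k \<notin> I" "finite I" using k by (auto simp: I_def)
  define H where "H = {y \<in> space (lebesgue_prod d). (\<Sum>i<d. w i * y i) = c}"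
  have H: "H \<in> sets (lebesgue_prod d)" unfolding H_def by measurable
  have inner: "(\<integral>\<^sup>+ t. indicator H (x(k := t)) \<partial>lborel) = (0 :: ennreal)" for x
  proof -
    define b where "b = (\<Sum>i\<in>I. w i * x i)"
    have "(indicator H (x(k := t)) :: ennreal) \<le> indicator {(c - b) / w k} t" for t
    proof (cases "x(k := t) \<in> H")
      case True
      have "(\<Sum>i\<in>I. w i * (x(k := t)) i) = b"
        unfolding b_def by (rule sum.cong) (use ins(2) in auto)
      hence "(\<Sum>i<d. w i * (x(k := t)) i) = w k * t + b"
        unfolding ins(1) using ins(2,3) by simp
      hence "w k * t + b = c" using True by (simp add: H_def)
      hence "t = (c - b) / w k" using w by (simp add: field_simps)
      thus ?thesis by (simp add: indicator_def)
    qed simp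
    hence "(\<integral>\<^sup>+ t. indicator H (x(k := t)) \<partial>lborel) \<le> (\<integral>\<^sup>+ t. indicator {(c - b) / w k} t \<partial>lborel)"
      by (rule nn_integral_mono)
    also have "\<dots> = 0" by simp
    finally show ?thesis by simp
  qed
  have "emeasure (lebesgue_prod d) H = (\<integral>\<^sup>+ y. indicator H y \<partial>lebesgue_prod d)"
    using H by simp
  also have "\<dots> = (\<integral>\<^sup>+ x. (\<integral>\<^sup>+ t. indicator H (x(k := t)) \<partial>lborel) \<partial>Pi\<^sub>M I (\<lambda>_. lborel))"
    using H unfolding ins(1) by (intro product_nn_integral_insert[OF ins(3,2)]) auto
  also have "\<dots> = 0" by (simp add: inner)
  finally have "emeasure (lebesgue_prod d) H = 0" .
  thus ?thesis by (intro AE_I[OF _ _ H]) (auto simp: H_def)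
qed

lemma AE_not_integer:
  assumes k: "k < d" and w: "w k \<noteq> (0 :: real)"
  shows "AE y in lebesgue_prod d. c + (\<Sum>i<d. w i * y i) \<notin> \<int>"
proof -
  have "AE y in lebesgue_prod d. \<forall>n :: int. (\<Sum>i<d. w i * y i) \<noteq> of_int n - c"
    unfolding AE_all_countable by (rule allI, rule AE_not_on_hyperplane[where w = w, OF k], rule w)
  thus ?thesis by (rule AE_mp) (auto elim!: Ints_cases simp: eq_diff_eq add.commute intro!: AE_I2)
qed

section \<open>Convergence of averages over small balls\<close>

text \<open>
  Bounded measurable functions with one-sided limits along every ray. The class is closed under sums and
  products, and it contains the indicator functions of half-spaces and the Bernoulli functions of
  linear functionals, from which both sides of the expansion are composed.
\<close>

definition radially_regular :: "nat \<Rightarrow> (real vec \<Rightarrow> real) \<Rightarrow> bool" where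
  "radially_regular d f \<longleftrightarrow> (\<exists>B. \<forall>x\<in>carrier_vec d. \<bar>f x\<bar> \<le> B) \<and>
     (\<forall>x\<in>carrier_vec d. \<forall>\<epsilon>. (\<lambda>y. f (x - \<epsilon> \<cdot>\<^sub>v vec d y)) \<in> borel_measurable (lebesgue_prod d)) \<and>
     (\<forall>x\<in>carrier_vec d. \<forall>y. \<exists>l. ((\<lambda>\<epsilon>. f (x - \<epsilon> \<cdot>\<^sub>v vec d y)) \<longlongrightarrow> l) (at_right 0))"

lemma radially_regularD:
  assumes "radially_regular d f"
  shows "\<exists>B. \<forall>x\<in>carrier_vec d. \<bar>f x\<bar> \<le> B"
    and "x \<in> carrier_vec d \<Longrightarrow> (\<lambda>y. f (x - \<epsilon> \<cdot>\<^sub>v vec d y)) \<in> borel_measurable (lebesgue_prod d)"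
    and "x \<in> carrier_vec d \<Longrightarrow> \<exists>l. ((\<lambda>\<epsilon>. f (x - \<epsilon> \<cdot>\<^sub>v vec d y)) \<longlongrightarrow> l) (at_right 0)"
  using assms by (simp_all add: radially_regular_def)

lemma radially_regular_cong:
  assumes "\<And>x. x \<in> carrier_vec d \<Longrightarrow> f x = g x"
  shows "radially_regular d f = radially_regular d g"
proof -
  have "f (x - \<epsilon> \<cdot>\<^sub>v vec d y) = g (x - \<epsilon> \<cdot>\<^sub>v vec d y)" if "x \<in> carrier_vec d" for x \<epsilon> y
    using that by (intro assms) auto
  thus ?thesis using assms unfolding radially_regular_def by (simp cong: ball_cong)
qed

lemma radially_regular_const: "radially_regular d (\<lambda>_. c)"
  unfolding radially_regular_def by (auto intro: exI[of _ "\<bar>c\<bar>"] exI[of _ c])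

lemma radially_regular_mult:
  assumes "radially_regular d f" "radially_regular d g"
  shows "radially_regular d (\<lambda>x. f x * g x)"
  unfolding radially_regular_def
proof (intro conjI ballI allI)
  obtain B where B: "\<And>x. x \<in> carrier_vec d \<Longrightarrow> \<bar>f x\<bar> \<le> B" using radially_regularD(1)[OF assms(1)] by blast
  obtain C where C: "\<And>x. x \<in> carrier_vec d \<Longrightarrow> \<bar>g x\<bar> \<le> C" using radially_regularD(1)[OF assms(2)] by blast
  have "\<bar>f x * g x\<bar> \<le> B * C" if "x \<in> carrier_vec d" for x
    unfolding abs_mult using B[OF that] C[OF that] by (intro mult_mono) (auto intro: order_trans[OF abs_ge_zero])
  thus "\<exists>B. \<forall>x\<in>carrier_vec d. \<bar>f x * g x\<bar> \<le> B" by blast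
  fix x :: "real vec" assume x: "x \<in> carrier_vec d"
  show "(\<lambda>y. f (x - \<epsilon> \<cdot>\<^sub>v vec d y) * g (x - \<epsilon> \<cdot>\<^sub>v vec d y)) \<in> borel_measurable (lebesgue_prod d)" for \<epsilon>
    by (rule borel_measurable_times) (rule radially_regularD(2)[OF assms(1) x] radially_regularD(2)[OF assms(2) x])+
  fix y
  obtain l where 1: "((\<lambda>\<epsilon>. f (x - \<epsilon> \<cdot>\<^sub>v vec d y)) \<longlongrightarrow> l) (at_right 0)"
    using radially_regularD(3)[OF assms(1) x] by blast
  obtain l' where 2: "((\<lambda>\<epsilon>. g (x - \<epsilon> \<cdot>\<^sub>v vec d y)) \<longlongrightarrow> l') (at_right 0)"
    using radially_regularD(3)[OF assms(2) x] by blast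
  from tendsto_mult[OF 1 2] show "\<exists>l. ((\<lambda>\<epsilon>. f (x - \<epsilon> \<cdot>\<^sub>v vec d y) * g (x - \<epsilon> \<cdot>\<^sub>v vec d y)) \<longlongrightarrow> l) (at_right 0)"
    by blast
qed

lemma radially_regular_add:
  assumes "radially_regular d f" "radially_regular d g"
  shows "radially_regular d (\<lambda>x. f x + g x)"
  unfolding radially_regular_def
proof (intro conjI ballI allI)
  obtain B where B: "\<And>x. x \<in> carrier_vec d \<Longrightarrow> \<bar>f x\<bar> \<le> B" using radially_regularD(1)[OF assms(1)] by blast
  obtain C where C: "\<And>x. x \<in> carrier_vec d \<Longrightarrow> \<bar>g x\<bar> \<le> C" using radially_regularD(1)[OF assms(2)] by blast
  have "\<bar>f x + g x\<bar> \<le> B + C" if "x \<in> carrier_vec d" for x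
    using B[OF that] C[OF that] by linarith
  thus "\<exists>B. \<forall>x\<in>carrier_vec d. \<bar>f x + g x\<bar> \<le> B" by blast
  fix x :: "real vec" assume x: "x \<in> carrier_vec d"
  show "(\<lambda>y. f (x - \<epsilon> \<cdot>\<^sub>v vec d y) + g (x - \<epsilon> \<cdot>\<^sub>v vec d y)) \<in> borel_measurable (lebesgue_prod d)" for \<epsilon>
    by (rule borel_measurable_add) (rule radially_regularD(2)[OF assms(1) x] radially_regularD(2)[OF assms(2) x])+
  fix y
  obtain l where 1: "((\<lambda>\<epsilon>. f (x - \<epsilon> \<cdot>\<^sub>v vec d y)) \<longlongrightarrow> l) (at_right 0)"
    using radially_regularD(3)[OF assms(1) x] by blast
  obtain l' where 2: "((\<lambda>\<epsilon>. g (x - \<epsilon> \<cdot>\<^sub>v vec d y)) \<longlongrightarrow> l') (at_right 0)"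
    using radially_regularD(3)[OF assms(2) x] by blast
  from tendsto_add[OF 1 2] show "\<exists>l. ((\<lambda>\<epsilon>. f (x - \<epsilon> \<cdot>\<^sub>v vec d y) + g (x - \<epsilon> \<cdot>\<^sub>v vec d y)) \<longlongrightarrow> l) (at_right 0)"
    by blast
qed

lemma radially_regular_sum:
  "finite A \<Longrightarrow> (\<And>a. a \<in> A \<Longrightarrow> radially_regular d (f a)) \<Longrightarrow> radially_regular d (\<lambda>x. \<Sum>a\<in>A. f a x)"
  by (induction A rule: finite_induct) (auto intro: radially_regular_const radially_regular_add)

lemma radially_regular_prod:
  "finite A \<Longrightarrow> (\<And>a. a \<in> A \<Longrightarrow> radially_regular d (f a)) \<Longrightarrow> radially_regular d (\<lambda>x. \<Prod>a\<in>A. f a x)"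
  by (induction A rule: finite_induct) (auto intro: radially_regular_const radially_regular_mult)

text \<open>
  Along a ray a linear functional is constant or approaches its value strictly from one side.
\<close>

lemma radially_regular_affine:
  fixes g :: "real \<Rightarrow> real"
  assumes m: "g \<in> borel_measurable borel" and b: "\<And>t. \<bar>g t\<bar> \<le> B"
    and L: "\<And>t. \<exists>l. (g \<longlongrightarrow> l) (at_left t)" and R: "\<And>t. \<exists>l. (g \<longlongrightarrow> l) (at_right t)"
  shows "radially_regular d (\<lambda>x. g ((\<Sum>i<d. w i * x $ i) + c))"
  unfolding radially_regular_def
proof (intro conjI ballI allI)
  show "\<exists>B. \<forall>x\<in>carrier_vec d. \<bar>g ((\<Sum>i<d. w i * x $ i) + c)\<bar> \<le> B" using b by blast
  fix x :: "real vec" assume x: "x \<in> carrier_vec d"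
  define a where "a = (\<Sum>i<d. w i * x $ i) + c"
  have eq: "(\<Sum>i<d. w i * (x - \<epsilon> \<cdot>\<^sub>v vec d y) $ i) + c = a - \<epsilon> * (\<Sum>i<d. w i * y i)" for \<epsilon> y
    using x by (simp add: a_def sum_subtractf sum_distrib_left algebra_simps)
  show "(\<lambda>y. g ((\<Sum>i<d. w i * (x - \<epsilon> \<cdot>\<^sub>v vec d y) $ i) + c)) \<in> borel_measurable (lebesgue_prod d)" for \<epsilon>
    unfolding eq by (rule measurable_compose[OF _ m]) measurable
  fix y
  define s where "s = (\<Sum>i<d. w i * y i)"
  have lim: "((\<lambda>\<epsilon>. a - \<epsilon> * s) \<longlongrightarrow> a) (at_right 0)"
    by (rule tendsto_eq_intros refl | simp)+
  have pos: "eventually (\<lambda>\<epsilon>::real. 0 < \<epsilon>) (at_right 0)" by (simp add: eventually_at_right_less)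
  consider "s = 0" | "s > 0" | "s < 0" by linarith
  hence "\<exists>l. ((\<lambda>\<epsilon>. g (a - \<epsilon> * s)) \<longlongrightarrow> l) (at_right 0)"
  proof cases
    case 1
    thus ?thesis by auto
  next
    case 2
    have "filterlim (\<lambda>\<epsilon>. a - \<epsilon> * s) (at_left a) (at_right 0)"
      using lim pos 2 by (auto simp: filterlim_at elim!: eventually_mono)
    thus ?thesis using L[of a] filterlim_compose by blast
  next
    case 3
    have "filterlim (\<lambda>\<epsilon>. a - \<epsilon> * s) (at_right a) (at_right 0)"
      using lim pos 3 by (auto simp: filterlim_at mult_pos_neg elim!: eventually_mono)
    thus ?thesis using R[of a] filterlim_compose by blast
  qed
  thus "\<exists>l. ((\<lambda>\<epsilon>. g ((\<Sum>i<d. w i * (x - \<epsilon> \<cdot>\<^sub>v vec d y) $ i) + c)) \<longlongrightarrow> l) (at_right 0)"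
    unfolding eq s_def .
qed

text \<open>
  By dominated convergence, the average of the radial limits over the unit ball is the limit of
  the averages.
\<close>

lemma ball_mean_tendsto_regularize:
  assumes f: "radially_regular d f" and x: "x \<in> carrier_vec d"
  shows "(ball_mean d f x \<longlongrightarrow> regularize d f x) (at_right 0)"
proof -
  obtain B where B: "\<And>x. x \<in> carrier_vec d \<Longrightarrow> \<bar>f x\<bar> \<le> B"
    using f unfolding radially_regular_def by blast
  have m: "(\<lambda>y. f (x - \<epsilon> \<cdot>\<^sub>v vec d y)) \<in> borel_measurable (lebesgue_prod d)" for \<epsilon>
    using f x unfolding radially_regular_def by blast
  have "\<forall>y. \<exists>l. ((\<lambda>\<epsilon>. f (x - \<epsilon> \<cdot>\<^sub>v vec d y)) \<longlongrightarrow> l) (at_right 0)"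
    using f x unfolding radially_regular_def by blast
  then obtain l where l: "\<And>y. ((\<lambda>\<epsilon>. f (x - \<epsilon> \<cdot>\<^sub>v vec d y)) \<longlongrightarrow> l y) (at_right 0)"
    using choice[of "\<lambda>y l. ((\<lambda>\<epsilon>. f (x - \<epsilon> \<cdot>\<^sub>v vec d y)) \<longlongrightarrow> l) (at_right 0)"] by blast
  define U where "U = euclidean_unit_ball d"
  \<comment> \<open>Dominated convergence is applied along \<open>t = 1 / \<epsilon>\<close> tending to infinity.\<close>
  define s where "s = (\<lambda>t y. indicator U y *\<^sub>R f (x - inverse t \<cdot>\<^sub>v vec d y))"
  have Us: "U \<in> sets (lebesgue_prod d)" unfolding U_def by (rule euclidean_unit_ball_sets)
  have lim: "((\<lambda>t. s t y) \<longlongrightarrow> indicator U y *\<^sub>R l y) at_top" for y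
    unfolding s_def by (intro tendsto_scaleR tendsto_const l[unfolded filterlim_at_right_to_top])
  have sm: "s t \<in> borel_measurable (lebesgue_prod d)" for t
    unfolding s_def using m Us by (intro borel_measurable_scaleR borel_measurable_indicator)
  have lm: "(\<lambda>y. indicator U y *\<^sub>R l y) \<in> borel_measurable (lebesgue_prod d)"
  proof (rule borel_measurable_LIMSEQ_real)
    show "(\<lambda>i. s (real i) y) \<longlonglongrightarrow> indicator U y *\<^sub>R l y" for y
      by (rule filterlim_compose[OF lim filterlim_real_sequentially])
  qed (rule sm)
  have "((\<lambda>t. integral\<^sup>L (lebesgue_prod d) (s t)) \<longlongrightarrow> integral\<^sup>L (lebesgue_prod d) (\<lambda>y. indicator U y *\<^sub>R l y)) at_top"
  proof (rule integral_dominated_convergence_at_top[where w = "\<lambda>y. indicator U y *\<^sub>R B"])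
    show "integrable (lebesgue_prod d) (\<lambda>y. indicator U y *\<^sub>R B)"
      using Us euclidean_unit_ball_finite[of d] unfolding U_def[symmetric] by (intro integrable_scaleR_left integrable_real_indicator) auto
    show "\<forall>\<^sub>F t in at_top. AE y in lebesgue_prod d. norm (s t y) \<le> indicator U y *\<^sub>R B"
      using B x by (intro always_eventually allI AE_I2) (auto simp: s_def indicator_def)
  qed (use lm sm lim in auto)
  hence "((\<lambda>\<epsilon>. LINT y:U|lebesgue_prod d. f (x - \<epsilon> \<cdot>\<^sub>v vec d y)) \<longlongrightarrow> integral\<^sup>L (lebesgue_prod d) (\<lambda>y. indicator U y *\<^sub>R l y)) (at_right 0)"
    unfolding filterlim_at_right_to_top set_lebesgue_integral_def s_def .
  hence "(ball_mean d f x \<longlongrightarrow> 1 / measure (lebesgue_prod d) U * integral\<^sup>L (lebesgue_prod d) (\<lambda>y. indicator U y *\<^sub>R l y)) (at_right 0)"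
    unfolding ball_mean_def U_def by (intro tendsto_mult tendsto_const)
  thus ?thesis unfolding regularize_def using tendsto_Lim[OF trivial_limit_at_right_real] by fastforce
qed

lemma bernoulli_fun_measurable: "bernoulli_fun n \<in> borel_measurable borel"
proof -
  have "bernoulli_fun n = (\<lambda>x. if x \<in> \<int> then (poly (bernoulli_poly n) 0 + poly (bernoulli_poly n) 1) / 2
      else poly (bernoulli_poly n) (x - of_int \<lfloor>x\<rfloor>))"
    by (auto simp: fun_eq_iff bernoulli_fun_int bernoulli_fun_nonint frac_def)
  also have "\<dots> \<in> borel_measurable borel"
  proof (rule measurable_If_set)
    have "(\<lambda>x::real. x - of_int \<lfloor>x\<rfloor>) \<in> borel_measurable borel" by measurable
    moreover have "poly (bernoulli_poly n) \<in> borel_measurable borel"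
      by (intro borel_measurable_continuous_onI continuous_intros)
    ultimately show "(\<lambda>x. poly (bernoulli_poly n) (x - of_int \<lfloor>x\<rfloor>)) \<in> borel_measurable borel"
      by (rule measurable_compose)
    show "\<int> \<inter> space borel \<in> sets (borel :: real measure)"
      by (simp add: countable_int sets.countable)
  qed simp
  finally show ?thesis .
qed

lemma bernoulli_fun_one_sided:
  "\<exists>l. (bernoulli_fun n \<longlongrightarrow> l) (at_right t)" "\<exists>l. (bernoulli_fun n \<longlongrightarrow> l) (at_left t)"
proof -
  let ?p = "poly (bernoulli_poly n)"
  define k where "k = \<lfloor>t\<rfloor>"
  have "eventually (\<lambda>v. v \<in> {t<..<of_int k + 1}) (at_right t)"
    by (rule eventually_at_right_real) (simp add: k_def)
  hence ev: "eventually (\<lambda>v. ?p (v - of_int k) = bernoulli_fun n v) (at_right t)"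
  proof eventually_elim
    case (elim v)
    have v: "of_int k < v" "v < of_int k + 1" using elim unfolding k_def by (auto intro: le_less_trans[OF of_int_floor_le])
    hence fl: "\<lfloor>v\<rfloor> = k" by (simp add: floor_eq_iff)
    have "v \<notin> \<int>" using v fl by (auto elim!: Ints_cases)
    thus ?case using fl by (simp add: bernoulli_fun_nonint frac_def)
  qed
  have "((\<lambda>v. ?p (v - of_int k)) \<longlongrightarrow> ?p (t - of_int k)) (at_right t)" by (intro tendsto_intros)
  thus "\<exists>l. (bernoulli_fun n \<longlongrightarrow> l) (at_right t)" using ev by (blast intro: Lim_transform_eventually)
  define k' where "k' = \<lceil>t\<rceil> - 1"
  have "eventually (\<lambda>v. v \<in> {of_int k'<..<t}) (at_left t)"
    by (rule eventually_at_left_real) (simp add: k'_def, linarith)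
  hence ev: "eventually (\<lambda>v. ?p (v - of_int k') = bernoulli_fun n v) (at_left t)"
  proof eventually_elim
    case (elim v)
    have "v < of_int \<lceil>t\<rceil>" by (rule less_le_trans[OF _ le_of_int_ceiling]) (use elim in simp)
    hence v: "of_int k' < v" "v < of_int k' + 1" using elim by (simp_all add: k'_def)
    hence fl: "\<lfloor>v\<rfloor> = k'" by (simp add: floor_eq_iff)
    have "v \<notin> \<int>" using v fl by (auto elim!: Ints_cases)
    thus ?case using fl by (simp add: bernoulli_fun_nonint frac_def)
  qed
  have "((\<lambda>v. ?p (v - of_int k')) \<longlongrightarrow> ?p (t - of_int k')) (at_left t)" by (intro tendsto_intros)
  thus "\<exists>l. (bernoulli_fun n \<longlongrightarrow> l) (at_left t)" using ev by (blast intro: Lim_transform_eventually)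
qed

lemma bernoulli_fun_bounded: "\<exists>B. \<forall>t. \<bar>bernoulli_fun n t\<bar> \<le> B"
proof -
  obtain A where "\<forall>m. \<forall>u\<in>{0..1}. \<bar>poly (bernoulli_poly m) u\<bar> \<le> A * 1 ^ m"
    using bernoulli_poly_bound[of 1] pi_gt3 by (auto simp: field_simps)
  hence "\<forall>u\<in>{0..1}. \<bar>poly (bernoulli_poly n) u\<bar> \<le> A" by simp
  thus ?thesis using bernoulli_fun_bound by blast
qed

lemma radially_regular_bernoulli: "radially_regular d (\<lambda>x. bernoulli_fun n ((\<Sum>i<d. w i * x $ i) + c))"
  using bernoulli_fun_bounded[of n] radially_regular_affine[OF bernoulli_fun_measurable _ bernoulli_fun_one_sided(2,1)] by blast

lemma radially_regular_halfspace: "radially_regular d (\<lambda>x. indicat_real {0..} ((\<Sum>i<d. w i * x $ i) + c))"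
proof (rule radially_regular_affine)
  show "\<exists>l. (indicat_real {0..} \<longlongrightarrow> l) (at_left t)" for t :: real
  proof -
    have "eventually (\<lambda>v. indicat_real {0<..} t = indicat_real {0..} v) (at_left t)"
    proof (cases "t > 0")
      case True
      have "eventually (\<lambda>v. v \<in> {0<..<t}) (at_left t)" by (rule eventually_at_left_real[OF True])
      thus ?thesis by eventually_elim (use True in \<open>auto simp: indicator_def\<close>)
    next
      case False
      have "eventually (\<lambda>v. v \<in> {t - 1<..<t}) (at_left t)" by (rule eventually_at_left_real) simp
      thus ?thesis by eventually_elim (use False in \<open>auto simp: indicator_def\<close>)
    qed
    thus ?thesis by (intro exI[of _ "indicat_real {0<..} t"]) (rule Lim_transform_eventually[OF tendsto_const])
  qed
  show "\<exists>l. (indicat_real {0..} \<longlongrightarrow> l) (at_right t)" for t :: real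
  proof -
    have "eventually (\<lambda>v. indicat_real {0..} t = indicat_real {0..} v) (at_right t)"
    proof (cases "t \<ge> 0")
      case True
      have "eventually (\<lambda>v. v \<in> {t<..<t+1}) (at_right t)" by (rule eventually_at_right_real) simp
      thus ?thesis by eventually_elim (use True in \<open>auto simp: indicator_def\<close>)
    next
      case False
      have "eventually (\<lambda>v. v \<in> {t<..<0}) (at_right t)" by (rule eventually_at_right_real) (use False in simp)
      thus ?thesis by eventually_elim (use False in \<open>auto simp: indicator_def\<close>)
    qed
    thus ?thesis by (intro exI[of _ "indicat_real {0..} t"]) (rule Lim_transform_eventually[OF tendsto_const])
  qed
qed (auto simp: indicator_def)

section \<open>Continuous functions on small balls and on the simplex\<close>

lemma compact_cube: "compact {y :: nat \<Rightarrow> real. \<forall>k. y k \<in> {a..b}}"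
proof -
  have "compactin (product_topology (\<lambda>_. euclidean) UNIV) (Pi\<^sub>E UNIV (\<lambda>_ :: nat. {a..b :: real}))"
    unfolding compactin_PiE by simp
  moreover have "Pi\<^sub>E UNIV (\<lambda>_ :: nat. {a..b}) = {y. \<forall>k. y k \<in> {a..b}}" by auto
  ultimately show ?thesis unfolding euclidean_product_topology by simp
qed

text \<open>
  By the tube lemma: the function \<open>f (x - \<epsilon> y)\<close> of \<open>(\<epsilon>, y)\<close> is constant on \<open>{0} \<times> K\<close> for the compact cube \<open>K\<close>
  that contains the ball.
\<close>

lemma uniform_on_small_balls:
  assumes f: "continuous_vec d f" and x: "x \<in> carrier_vec d" and e: "e > 0"
  shows "\<forall>\<^sub>F \<epsilon> in at_right 0. \<forall>y\<in>euclidean_unit_ball d. \<bar>f (x - \<epsilon> \<cdot>\<^sub>v vec d y) - f x\<bar> < e"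
proof -
  define K where "K = {y :: nat \<Rightarrow> real. \<forall>k. y k \<in> {-1..1}}"
  define \<psi> where "\<psi> = (\<lambda>z :: real \<times> (nat \<Rightarrow> real). f (x - fst z \<cdot>\<^sub>v vec d (snd z)))"
  have pr: "continuous_on UNIV (\<lambda>z :: real \<times> (nat \<Rightarrow> real). snd z k)" for k
    by (rule continuous_on_compose2[OF continuous_on_product_coordinates[of k] continuous_on_snd[OF continuous_on_id]]) auto
  have \<psi>: "continuous_on UNIV \<psi>"
    unfolding \<psi>_def
  proof (rule continuous_vec_compose[OF f])
    show "continuous_on UNIV (\<lambda>z :: real \<times> (nat \<Rightarrow> real). (x - fst z \<cdot>\<^sub>v vec d (snd z)) $ k)" if "k < d" for k
      using that x by (simp, intro continuous_intros pr)
  qed (use x in auto)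
  have "open ((\<lambda>z. \<bar>\<psi> z - f x\<bar>) -` {..<e})"
    by (rule open_vimage) (auto intro!: continuous_intros \<psi>)
  moreover have "{0} \<times> K \<subseteq> (\<lambda>z. \<bar>\<psi> z - f x\<bar>) -` {..<e}"
  proof -
    have "x - 0 \<cdot>\<^sub>v vec d y = x" for y using x by (intro eq_vecI) auto
    thus ?thesis using e by (auto simp: \<psi>_def)
  qed
  ultimately obtain X where X: "0 \<in> X" "open X" "X \<times> K \<subseteq> (\<lambda>z. \<bar>\<psi> z - f x\<bar>) -` {..<e}"
    using Elementary_Topology.tube_lemma[of K "(\<lambda>z. \<bar>\<psi> z - f x\<bar>) -` {..<e}" 0] compact_cube[of "-1" 1] unfolding K_def by blast
  have "eventually (\<lambda>\<epsilon>. \<epsilon> \<in> X) (nhds 0)" using X(1,2) by (auto simp: eventually_nhds)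
  hence "eventually (\<lambda>\<epsilon>. \<epsilon> \<in> X) (at_right 0)" by (simp add: eventually_at_filter eventually_mono)
  thus ?thesis
  proof eventually_elim
    case (elim \<epsilon>)
    show ?case
    proof
      fix y assume y: "y \<in> euclidean_unit_ball d"
      define y' where "y' = (\<lambda>k. if k < d then y k else 0)"
      have "y' \<in> K" using euclidean_unit_ball_abs_le[OF y] by (auto simp: K_def y'_def abs_le_iff)
      hence "(\<epsilon>, y') \<in> (\<lambda>z. \<bar>\<psi> z - f x\<bar>) -` {..<e}" using X(3) elim by blast
      moreover have "vec d y' = vec d y" by (intro eq_vecI) (auto simp: y'_def)
      ultimately show "\<bar>f (x - \<epsilon> \<cdot>\<^sub>v vec d y) - f x\<bar> < e" by (simp add: \<psi>_def)
    qed
  qed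
qed

lemma continuous_vec_bounded_on_simplex:
  assumes f: "continuous_vec d f"
  shows "bdd_above ((\<lambda>y. \<bar>f y\<bar>) ` std_simplex d)"
proof -
  define K where "K = {y :: nat \<Rightarrow> real. \<forall>k. y k \<in> {0..1}}"
  have "compact ((\<lambda>y. \<bar>f (vec d y)\<bar>) ` K)"
    unfolding K_def using f compact_cube[of 0 1] unfolding continuous_vec_def
    by (intro compact_continuous_image continuous_intros) (auto intro: continuous_on_subset)
  hence "bdd_above ((\<lambda>y. \<bar>f (vec d y)\<bar>) ` K)" by (intro bounded_imp_bdd_above compact_imp_bounded)
  moreover have "(\<lambda>y. \<bar>f y\<bar>) ` std_simplex d \<subseteq> (\<lambda>y. \<bar>f (vec d y)\<bar>) ` K"
  proof
    fix b assume "b \<in> (\<lambda>y. \<bar>f y\<bar>) ` std_simplex d"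
    then obtain x where x: "x \<in> std_simplex d" "b = \<bar>f x\<bar>" by blast
    define y where "y = (\<lambda>k. if k < d then x $ k else 0)"
    have xc: "x \<in> carrier_vec d" by (rule std_simplex_carrier[OF x(1)])
    have "x $ k \<le> 1" if "k < d" for k
    proof -
      have "x $ k \<le> (\<Sum>k<d. x $ k)" using x(1) that by (intro member_le_sum) (auto simp: std_simplex_def)
      thus ?thesis using x(1) xc by (simp add: std_simplex_def vec_total_def)
    qed
    hence "y \<in> K" using x(1) by (auto simp: K_def y_def std_simplex_def)
    moreover have "vec d y = x" using xc by (intro eq_vecI) (auto simp: y_def)
    ultimately show "b \<in> (\<lambda>y. \<bar>f (vec d y)\<bar>) ` K" using x(2) by force
  qed
  ultimately show ?thesis by (rule bdd_above_mono)
qed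

section \<open>Generic points and regularity for a lattice simplex\<close>

lemma C_k_vec_dilated:
  fixes M :: "int mat"
  assumes M: "M \<in> carrier_mat d d" and q: "C_k_vec d m q"
  shows "C_k_vec d m (dilated q \<tau> M)"
proof -
  have Mr: "real_mat M \<in> carrier_mat d d" using M by simp
  have "affine_map d d (\<lambda>x. \<tau> \<cdot>\<^sub>v (real_mat M *\<^sub>v x)) (\<lambda>i. \<tau> \<cdot>\<^sub>v col (real_mat M) i)"
    unfolding affine_map_def
  proof (intro conjI ballI allI impI)
    fix i :: nat and x :: "real vec" and t :: real
    assume i: "i < d" and x: "x \<in> carrier_vec d"
    show "\<tau> \<cdot>\<^sub>v (real_mat M *\<^sub>v (x + t \<cdot>\<^sub>v unit_vec d i)) = \<tau> \<cdot>\<^sub>v (real_mat M *\<^sub>v x) + t \<cdot>\<^sub>v (\<tau> \<cdot>\<^sub>v col (real_mat M) i)"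
    proof (rule eq_vecI)
      fix k assume "k < dim_vec (\<tau> \<cdot>\<^sub>v (real_mat M *\<^sub>v x) + t \<cdot>\<^sub>v (\<tau> \<cdot>\<^sub>v col (real_mat M) i))"
      hence k: "k < d" using M by simp
      have xi: "x + t \<cdot>\<^sub>v unit_vec d i \<in> carrier_vec d" using x by simp
      have "(\<Sum>j<d. real_mat M $$ (k, j) * (x + t \<cdot>\<^sub>v unit_vec d i) $ j) =
          (\<Sum>j<d. real_mat M $$ (k, j) * x $ j + (if j = i then real_mat M $$ (k, j) * t else 0))"
        by (rule sum.cong) (use x i in \<open>auto simp: algebra_simps\<close>)
      also have "\<dots> = (\<Sum>j<d. real_mat M $$ (k, j) * x $ j) + t * real_mat M $$ (k, i)"
        using i by (simp add: sum.distrib)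
      finally have "(real_mat M *\<^sub>v (x + t \<cdot>\<^sub>v unit_vec d i)) $ k = (real_mat M *\<^sub>v x) $ k + t * real_mat M $$ (k, i)"
        unfolding mult_mat_vec_index[OF Mr xi k] mult_mat_vec_index[OF Mr x k] .
      thus "(\<tau> \<cdot>\<^sub>v (real_mat M *\<^sub>v (x + t \<cdot>\<^sub>v unit_vec d i))) $ k = (\<tau> \<cdot>\<^sub>v (real_mat M *\<^sub>v x) + t \<cdot>\<^sub>v (\<tau> \<cdot>\<^sub>v col (real_mat M) i)) $ k"
        using k i M by (simp add: algebra_simps del: index_mult_mat_vec)
    qed (use M in simp)
  next
    fix k assume k: "k < d"
    have "(\<tau> \<cdot>\<^sub>v (real_mat M *\<^sub>v vec d y)) $ k = \<tau> * (\<Sum>j<d. real_mat M $$ (k, j) * vec d y $ j)" for y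
      using k M mult_mat_vec_index[OF Mr _ k, of "vec d y"] by (simp del: index_mult_mat_vec)
    thus "continuous_vec d (\<lambda>x. (\<tau> \<cdot>\<^sub>v (real_mat M *\<^sub>v x)) $ k)"
      unfolding continuous_vec_def by (simp only:) (intro continuous_intros, simp)
  qed (use M in auto)
  from C_k_vec_affine[OF this q] show ?thesis unfolding dilated_def .
qed

text \<open>
  A nonzero row vector times an invertible matrix is nonzero.
\<close>

lemma inverse_row_combination:
  fixes W A :: "real mat"
  assumes W: "W \<in> carrier_mat d d" and A: "A \<in> carrier_mat d d" and WA: "W * A = 1\<^sub>m d" and k: "k < d" and u: "u k \<noteq> 0"
  shows "\<exists>j<d. (\<Sum>i<d. u i * W $$ (i, j)) \<noteq> 0"
proof (rule ccontr)
  assume "\<not> (\<exists>j<d. (\<Sum>i<d. u i * W $$ (i, j)) \<noteq> 0)"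
  hence z: "(\<Sum>i<d. u i * W $$ (i, j)) = 0" if "j < d" for j using that by blast
  have e: "(\<Sum>j<d. W $$ (i, j) * A $$ (j, k)) = (if i = k then 1 else 0)" if "i < d" for i
  proof -
    have "(W * A) $$ (i, k) = (\<Sum>j<d. W $$ (i, j) * A $$ (j, k))"
      using W A that k by (auto simp: scalar_prod_def lessThan_atLeast0 intro!: sum.cong)
    thus ?thesis using that k by (simp add: WA)
  qed
  have "u k = (\<Sum>i<d. if i = k then u i else 0)" using k by simp
  also have "\<dots> = (\<Sum>i<d. u i * (\<Sum>j<d. W $$ (i, j) * A $$ (j, k)))"
    by (rule sum.cong) (simp_all add: e)
  also have "\<dots> = (\<Sum>j<d. (\<Sum>i<d. u i * W $$ (i, j)) * A $$ (j, k))"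
    unfolding sum_distrib_left sum_distrib_right mult.assoc by (rule sum.swap)
  also have "\<dots> = 0" by (simp add: z)
  finally show False using u by simp
qed

lemma functional_along_matrix:
  fixes W :: "real mat"
  assumes W: "W \<in> carrier_mat d d" and x: "x \<in> carrier_vec d" and b: "b \<in> carrier_vec d"
  shows "(\<Sum>i<d. u i * (W *\<^sub>v (x + b)) $ i) = (\<Sum>j<d. (\<Sum>i<d. u i * W $$ (i, j)) * x $ j) + (\<Sum>i<d. u i * (W *\<^sub>v b) $ i)"
proof -
  have "(\<Sum>i<d. u i * (W *\<^sub>v (x + b)) $ i) = (\<Sum>i<d. u i * (\<Sum>j<d. W $$ (i, j) * x $ j) + u i * (W *\<^sub>v b) $ i)"
  proof (rule sum.cong[OF refl])
    fix i assume "i \<in> {..<d}"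
    hence i: "i < d" by simp
    have "(W *\<^sub>v (x + b)) $ i = (\<Sum>j<d. W $$ (i, j) * x $ j) + (W *\<^sub>v b) $ i"
      unfolding mult_mat_vec_index[OF W add_carrier_vec[OF x b] i] mult_mat_vec_index[OF W b i]
      using b by (simp add: distrib_left sum.distrib)
    thus "u i * (W *\<^sub>v (x + b)) $ i = u i * (\<Sum>j<d. W $$ (i, j) * x $ j) + u i * (W *\<^sub>v b) $ i"
      by (simp only: distrib_left)
  qed
  also have "\<dots> = (\<Sum>i<d. u i * (\<Sum>j<d. W $$ (i, j) * x $ j)) + (\<Sum>i<d. u i * (W *\<^sub>v b) $ i)"
    by (simp only: sum.distrib)
  also have "(\<Sum>i<d. u i * (\<Sum>j<d. W $$ (i, j) * x $ j)) = (\<Sum>j<d. (\<Sum>i<d. u i * W $$ (i, j)) * x $ j)"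
    unfolding sum_distrib_left sum_distrib_right mult.assoc by (rule sum.swap)
  finally show ?thesis .
qed

lemma AE_functional_not_integer:
  fixes W A :: "real mat"
  assumes W: "W \<in> carrier_mat d d" and A: "A \<in> carrier_mat d d" and WA: "W * A = 1\<^sub>m d" and k: "k < d" and u: "u k \<noteq> 0"
    and x: "x \<in> carrier_vec d" and b: "b \<in> carrier_vec d" and e: "\<epsilon> \<noteq> 0"
  shows "AE y in lebesgue_prod d. (\<Sum>i<d. u i * (W *\<^sub>v ((x - \<epsilon> \<cdot>\<^sub>v vec d y) + b)) $ i) + c \<notin> \<int>"
proof -
  define v where "v = (\<lambda>j. \<Sum>i<d. u i * W $$ (i, j))"
  have v: "(\<Sum>i<d. u i * W $$ (i, j)) = v j" for j by (simp add: v_def)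
  obtain j where j: "j < d" "v j \<noteq> 0"
    using inverse_row_combination[where u = u, OF W A WA k] u unfolding v by blast
  define c0 where "c0 = (\<Sum>j<d. v j * x $ j) + (\<Sum>i<d. u i * (W *\<^sub>v b) $ i) + c"
  have "AE y in lebesgue_prod d. c0 + (\<Sum>j<d. (- \<epsilon> * v j) * y j) \<notin> \<int>"
    by (rule AE_not_integer[OF j(1)]) (use e j in simp)
  moreover have "(\<Sum>i<d. u i * (W *\<^sub>v ((x - \<epsilon> \<cdot>\<^sub>v vec d y) + b)) $ i) + c = c0 + (\<Sum>j<d. (- \<epsilon> * v j) * y j)" for y
  proof -
    have xy: "x - \<epsilon> \<cdot>\<^sub>v vec d y \<in> carrier_vec d" using x by simp
    have "(\<Sum>j<d. v j * (x - \<epsilon> \<cdot>\<^sub>v vec d y) $ j) = (\<Sum>j<d. v j * x $ j + (- \<epsilon> * v j) * y j)"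
      by (rule sum.cong) (use x in \<open>auto simp: algebra_simps\<close>)
    also have "\<dots> = (\<Sum>j<d. v j * x $ j) + (\<Sum>j<d. (- \<epsilon> * v j) * y j)" by (rule sum.distrib)
    finally show ?thesis unfolding functional_along_matrix[OF W xy b] v c0_def by simp
  qed
  ultimately show ?thesis by simp
qed

text \<open>
  Genericity of the representatives is violated only on countably many hyperplanes, since a nonzero
  functional stays nonzero after composition with the invertible matrix \<open>W\<close>.
\<close>

lemma AE_em_generic:
  fixes M :: "int mat"
  assumes M: "M \<in> carrier_mat d d" and W: "W \<in> carrier_mat d d" "W * real_mat M = 1\<^sub>m d"
    and C: "finite C" "C \<subseteq> carrier_vec d" and x: "x \<in> carrier_vec d" and e: "\<epsilon> \<noteq> 0"
  shows "AE y in lebesgue_prod d. \<forall>r\<in>C. em_generic d (\<lambda>i. (W *\<^sub>v ((x - \<epsilon> \<cdot>\<^sub>v vec d y) + real_vec r)) $ i) \<tau>"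
proof -
  have Mr: "real_mat M \<in> carrier_mat d d" using M by simp
  define z where "z = (\<lambda>r y i. (W *\<^sub>v ((x - \<epsilon> \<cdot>\<^sub>v vec d y) + real_vec r)) $ i)"
  have ae: "AE y in lebesgue_prod d. z r y k \<notin> \<int> \<and> (\<Sum>i\<le>k. z r y i) - \<tau> \<notin> \<int>" if r: "r \<in> C" and k: "k < d" for r k
  proof (rule AE_conjI)
    have rc: "real_vec r \<in> carrier_vec d" using r C by auto
    have "AE y in lebesgue_prod d. (\<Sum>i<d. (if i = k then 1 else 0) * z r y i) + 0 \<notin> \<int>"
      unfolding z_def by (rule AE_functional_not_integer[OF W(1) Mr W(2) k _ x rc e]) simp
    moreover have "(\<Sum>i<d. (if i = k then 1 else 0) * z r y i) + 0 = z r y k" for y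
      using k by (simp add: if_distrib[of "\<lambda>a. a * _"] cong: if_cong)
    ultimately show "AE y in lebesgue_prod d. z r y k \<notin> \<int>" by simp
    have "AE y in lebesgue_prod d. (\<Sum>i<d. (if i \<le> k then 1 else 0) * z r y i) + (- \<tau>) \<notin> \<int>"
      unfolding z_def by (rule AE_functional_not_integer[OF W(1) Mr W(2) k _ x rc e]) simp
    moreover have "(\<Sum>i<d. (if i \<le> k then 1 else 0) * z r y i) = (\<Sum>i\<le>k. z r y i)" for y
    proof -
      have "(\<Sum>i\<le>k. z r y i) = (\<Sum>i\<le>k. (if i \<le> k then 1 else 0) * z r y i)" by (rule sum.cong) auto
      also have "\<dots> = (\<Sum>i<d. (if i \<le> k then 1 else 0) * z r y i)"
        by (rule sum.mono_neutral_left) (use k in auto)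
      finally show ?thesis ..
    qed
    ultimately show "AE y in lebesgue_prod d. (\<Sum>i\<le>k. z r y i) - \<tau> \<notin> \<int>" by simp
  qed
  have aek: "AE y in lebesgue_prod d. \<forall>k\<in>{..<d}. z r y k \<notin> \<int> \<and> (\<Sum>i\<le>k. z r y i) - \<tau> \<notin> \<int>" if "r \<in> C" for r
    by (rule AE_finite_allI[OF finite_lessThan]) (use ae[OF that] in simp)
  have "AE y in lebesgue_prod d. \<forall>r\<in>C. \<forall>k\<in>{..<d}. z r y k \<notin> \<int> \<and> (\<Sum>i\<le>k. z r y i) - \<tau> \<notin> \<int>"
    by (rule AE_finite_allI[OF C(1) aek])
  thus ?thesis unfolding em_generic_def z_def by (simp only: Ball_def lessThan_iff)
qed

lemma em_coord_functional:
  assumes "k < d"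
  shows "em_coord V z \<tau> k = (\<Sum>i<d. (if (if V k = 1 then i = k else i \<le> k) then 1 else 0) * z i) + (if V k = 1 then 0 else - \<tau>)"
proof (cases "V k = 1")
  case True
  thus ?thesis using assms by (simp add: em_coord_def if_distrib[of "\<lambda>a. a * _"] cong: if_cong)
next
  case False
  have "(\<Sum>i\<le>k. z i) = (\<Sum>i\<le>k. (if i \<le> k then 1 else 0) * z i)" by (rule sum.cong) auto
  also have "\<dots> = (\<Sum>i<d. (if i \<le> k then 1 else 0) * z i)"
    by (rule sum.mono_neutral_left) (use assms in auto)
  finally show ?thesis using False by (simp add: em_coord_def)
qed

text \<open>
  Writing the periodic function as a finite sum of products exhibits it as built from Bernoulli functions
  of linear functionals. For \<open>\<tau> = 0\<close> the shift by \<open>\<lambda>\<^sub>V\<close> in \<open>bernoulli_lattice_sum\<close> disappears.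
\<close>

lemma radially_regular_bernoulli_sum:
  fixes M :: "int mat" and V :: "nat \<Rightarrow> nat"
  assumes M: "M \<in> carrier_mat d d" and dM: "det M \<noteq> 0"
    and W: "W \<in> carrier_mat d d" "W * real_mat M = 1\<^sub>m d" and C: "lattice_transversal d M C"
  shows "radially_regular d (\<lambda>u. \<Sum>\<^sub>\<infinity>n\<in>carrier_vec d. bernoulli_L d K (transpose_mat (real_mat M * D_V d V)) (u + real_vec n))"
proof -
  have Cc: "C \<subseteq> carrier_vec d" and fin: "finite C" using C unfolding lattice_transversal_def lattice_covering_def by blast+
  have Mr: "real_mat M \<in> carrier_mat d d" using M by simp
  define l where "l = (0::real) \<cdot>\<^sub>v (real_mat M *\<^sub>v lambda_V d V)"
  have lc: "l \<in> carrier_vec d" using Mr lambda_V_carrier[of d V] by (simp add: l_def)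
  define e where "e = (\<lambda>k i. if (if V k = 1 then i = k else i \<le> k) then 1 else (0::real))"
  have eq: "(\<Sum>\<^sub>\<infinity>n\<in>carrier_vec d. bernoulli_L d K (transpose_mat (real_mat M * D_V d V)) (u + real_vec n)) =
      1 / real_of_int \<bar>det M\<bar> * (\<Sum>r\<in>C. \<Prod>k<d. bernoulli_fun (K k)
        ((\<Sum>j<d. (\<Sum>i<d. e k i * W $$ (i, j)) * u $ j) + (\<Sum>i<d. e k i * (W *\<^sub>v real_vec r) $ i)))" if u: "u \<in> carrier_vec d" for u
  proof -
    have "u - 0 \<cdot>\<^sub>v m = u" if "m \<in> carrier_vec d" for m :: "real vec"
      using u that by (intro eq_vecI) auto
    moreover have "real_mat M *\<^sub>v lambda_V d V \<in> carrier_vec d"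
      using Mr lambda_V_carrier[of d V] by simp
    ultimately have "u - l = u" unfolding l_def by blast
    hence "(\<Sum>\<^sub>\<infinity>n\<in>carrier_vec d. bernoulli_L d K (transpose_mat (real_mat M * D_V d V)) (u + real_vec n)) =
      1 / real_of_int \<bar>det M\<bar> * (\<Sum>r\<in>C. \<Prod>k<d. bernoulli_fun (K k) (em_coord V (\<lambda>i. (W *\<^sub>v (u + real_vec r)) $ i) 0 k))"
      using bernoulli_lattice_sum[OF M dM W C u, of K V 0] unfolding l_def[symmetric] by simp
    also have "(\<Sum>r\<in>C. \<Prod>k<d. bernoulli_fun (K k) (em_coord V (\<lambda>i. (W *\<^sub>v (u + real_vec r)) $ i) 0 k)) =
      (\<Sum>r\<in>C. \<Prod>k<d. bernoulli_fun (K k)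
        ((\<Sum>j<d. (\<Sum>i<d. e k i * W $$ (i, j)) * u $ j) + (\<Sum>i<d. e k i * (W *\<^sub>v real_vec r) $ i)))"
    proof (intro sum.cong prod.cong refl)
      fix r k assume r: "r \<in> C" and "k \<in> {..<d}"
      hence k: "k < d" by simp
      have rc: "real_vec r \<in> carrier_vec d" using r Cc by auto
      have "em_coord V (\<lambda>i. (W *\<^sub>v (u + real_vec r)) $ i) 0 k = (\<Sum>i<d. e k i * (W *\<^sub>v (u + real_vec r)) $ i)"
        unfolding em_coord_functional[OF k] e_def by simp
      also have "\<dots> = (\<Sum>j<d. (\<Sum>i<d. e k i * W $$ (i, j)) * u $ j) + (\<Sum>i<d. e k i * (W *\<^sub>v real_vec r) $ i)"
        by (rule functional_along_matrix[OF W(1) u rc])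
      finally show "bernoulli_fun (K k) (em_coord V (\<lambda>i. (W *\<^sub>v (u + real_vec r)) $ i) 0 k) = bernoulli_fun (K k)
        ((\<Sum>j<d. (\<Sum>i<d. e k i * W $$ (i, j)) * u $ j) + (\<Sum>i<d. e k i * (W *\<^sub>v real_vec r) $ i))" by (rule arg_cong)
    qed
    finally show ?thesis .
  qed
  show ?thesis
    by (subst radially_regular_cong[OF eq], assumption)
       (intro radially_regular_mult radially_regular_const radially_regular_sum radially_regular_prod radially_regular_bernoulli fin finite_lessThan)
qed

text \<open>
  The simplex is the intersection of \<open>d + 1\<close> half-spaces, so that its indicator is a product.
\<close>

lemma radially_regular_simplex:
  fixes M :: "int mat"
  assumes M: "M \<in> carrier_mat d d" and \<tau>: "\<tau> > 0"
    and W: "W \<in> carrier_mat d d" "W * real_mat M = 1\<^sub>m d" "real_mat M * W = 1\<^sub>m d"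
  shows "radially_regular d (indicat_real ((\<lambda>p. \<tau> \<cdot>\<^sub>v p) ` lattice_simplex d M))"
proof -
  let ?S = "(\<lambda>p. \<tau> \<cdot>\<^sub>v p) ` lattice_simplex d M"
  have eq: "indicat_real ?S x = (\<Prod>k<d. indicat_real {0..} ((\<Sum>j<d. W $$ (k, j) * x $ j) + 0)) *
      indicat_real {0..} ((\<Sum>j<d. (\<Sum>i<d. (-1) * W $$ (i, j)) * x $ j) + \<tau>)" if x: "x \<in> carrier_vec d" for x
  proof -
    have Wk: "(W *\<^sub>v x) $ k = (\<Sum>j<d. W $$ (k, j) * x $ j)" if "k < d" for k
      by (rule mult_mat_vec_index[OF W(1) x that])
    have tot: "vec_total ((1 / \<tau>) \<cdot>\<^sub>v (W *\<^sub>v x)) = (\<Sum>k<d. (W *\<^sub>v x) $ k) / \<tau>"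
      using W(1) by (simp add: vec_total_def sum_divide_distrib del: index_mult_mat_vec)
    have neg: "(\<Sum>j<d. (\<Sum>i<d. (-1) * W $$ (i, j)) * x $ j) = - (\<Sum>k<d. (W *\<^sub>v x) $ k)"
    proof -
      have "(\<Sum>k<d. (W *\<^sub>v x) $ k) = (\<Sum>k<d. \<Sum>j<d. W $$ (k, j) * x $ j)" by (rule sum.cong) (simp_all add: Wk del: index_mult_mat_vec)
      also have "\<dots> = (\<Sum>j<d. (\<Sum>i<d. W $$ (i, j)) * x $ j)" unfolding sum_distrib_right by (rule sum.swap)
      finally show ?thesis by (simp add: sum_negf)
    qed
    have "x \<in> ?S \<longleftrightarrow> (\<forall>k<d. 0 \<le> (W *\<^sub>v x) $ k) \<and> (\<Sum>k<d. (W *\<^sub>v x) $ k) \<le> \<tau>"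
      unfolding dilated_simplex_iff[OF M \<tau> W] std_simplex_def mem_Collect_eq tot
      using x W(1) \<tau> by (auto simp: zero_le_divide_iff simp del: index_mult_mat_vec)
    moreover have "(\<Prod>k<d. indicat_real {0..} ((W *\<^sub>v x) $ k)) = (if \<forall>k<d. 0 \<le> (W *\<^sub>v x) $ k then 1 else 0)"
      by (auto simp: indicator_def simp del: index_mult_mat_vec)
    moreover have "(\<Prod>k<d. indicat_real {0..} ((\<Sum>j<d. W $$ (k, j) * x $ j) + 0)) = (\<Prod>k<d. indicat_real {0..} ((W *\<^sub>v x) $ k))"
      by (rule prod.cong) (simp_all add: Wk del: index_mult_mat_vec)
    ultimately show ?thesis
      unfolding neg by (simp add: indicator_def del: index_mult_mat_vec)
  qed
  show ?thesis
    by (subst radially_regular_cong[OF eq], assumption)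
       (intro radially_regular_mult radially_regular_prod radially_regular_halfspace finite_lessThan)
qed

text \<open>
  The functions are averaged over balls around different centers \<open>X a\<close>, but with the same displacement,
  so that a bound for the combination at almost every displacement carries over to the averages.
\<close>

lemma ball_mean_combination_bound:
  assumes A: "finite A" and f: "\<And>a. a \<in> A \<Longrightarrow> radially_regular d (f a)" and X: "\<And>a. a \<in> A \<Longrightarrow> X a \<in> carrier_vec d" and b: "b \<ge> 0"
    and bound: "AE y in lebesgue_prod d. y \<in> euclidean_unit_ball d \<longrightarrow> \<bar>\<Sum>a\<in>A. c a * f a (X a - \<epsilon> \<cdot>\<^sub>v vec d y)\<bar> \<le> b"
  shows "\<bar>\<Sum>a\<in>A. c a * ball_mean d (f a) (X a) \<epsilon>\<bar> \<le> b"
proof -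
  define P where "P = lebesgue_prod d"
  define U where "U = euclidean_unit_ball d"
  have Us: "U \<in> sets P" "emeasure P U < \<infinity>"
    unfolding U_def P_def using euclidean_unit_ball_sets euclidean_unit_ball_finite by auto
  have Ui: "integrable P (\<lambda>y. indicator U y * B :: real)" for B
    using Us by (intro integrable_mult_left integrable_real_indicator) auto
  have int: "integrable P (\<lambda>y. indicator U y *\<^sub>R f a (X a - \<epsilon> \<cdot>\<^sub>v vec d y))" if a: "a \<in> A" for a
  proof -
    obtain B where B: "\<And>x. x \<in> carrier_vec d \<Longrightarrow> \<bar>f a x\<bar> \<le> B" using radially_regularD(1)[OF f[OF a]] by blast
    show ?thesis
    proof (rule Bochner_Integration.integrable_bound[OF Ui[of B]])
      show "(\<lambda>y. indicator U y *\<^sub>R f a (X a - \<epsilon> \<cdot>\<^sub>v vec d y)) \<in> borel_measurable P"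
        using radially_regularD(2)[OF f[OF a] X[OF a], of \<epsilon>] Us unfolding P_def[symmetric]
        by (intro borel_measurable_scaleR borel_measurable_indicator)
      show "AE y in P. norm (indicator U y *\<^sub>R f a (X a - \<epsilon> \<cdot>\<^sub>v vec d y)) \<le> norm (indicator U y * B)"
      proof (rule AE_I2)
        fix y
        have "\<bar>f a (X a - \<epsilon> \<cdot>\<^sub>v vec d y)\<bar> \<le> B" using X[OF a] by (intro B) auto
        thus "norm (indicator U y *\<^sub>R f a (X a - \<epsilon> \<cdot>\<^sub>v vec d y)) \<le> norm (indicator U y * B)"
          by (auto simp: indicator_def)
      qed
    qed
  qed
  define F where "F = (\<lambda>y. \<Sum>a\<in>A. c a * f a (X a - \<epsilon> \<cdot>\<^sub>v vec d y))"
  have eqF: "indicator U y *\<^sub>R F y = (\<Sum>a\<in>A. c a * (indicator U y *\<^sub>R f a (X a - \<epsilon> \<cdot>\<^sub>v vec d y)))" for y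
    unfolding F_def by (simp add: sum_distrib_left mult_ac)
  have intF: "integrable P (\<lambda>y. indicator U y *\<^sub>R F y)"
    unfolding eqF by (intro Bochner_Integration.integrable_sum integrable_mult_right int)
  have "(\<Sum>a\<in>A. c a * ball_mean d (f a) (X a) \<epsilon>) = 1 / measure P U * (\<Sum>a\<in>A. c a * integral\<^sup>L P (\<lambda>y. indicator U y *\<^sub>R f a (X a - \<epsilon> \<cdot>\<^sub>v vec d y)))"
    unfolding ball_mean_def set_lebesgue_integral_def P_def U_def by (simp add: sum_distrib_left mult_ac)
  also have "(\<Sum>a\<in>A. c a * integral\<^sup>L P (\<lambda>y. indicator U y *\<^sub>R f a (X a - \<epsilon> \<cdot>\<^sub>v vec d y))) = integral\<^sup>L P (\<lambda>y. indicator U y *\<^sub>R F y)"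
  proof -
    have "integral\<^sup>L P (\<lambda>y. indicator U y *\<^sub>R F y) = (\<Sum>a\<in>A. integral\<^sup>L P (\<lambda>y. c a * (indicator U y *\<^sub>R f a (X a - \<epsilon> \<cdot>\<^sub>v vec d y))))"
      unfolding eqF by (rule Bochner_Integration.integral_sum) (intro integrable_mult_right int)
    thus ?thesis by (simp only: integral_mult_right_zero)
  qed
  finally have eq: "(\<Sum>a\<in>A. c a * ball_mean d (f a) (X a) \<epsilon>) = 1 / measure P U * integral\<^sup>L P (\<lambda>y. indicator U y *\<^sub>R F y)" .
  have "\<bar>integral\<^sup>L P (\<lambda>y. indicator U y *\<^sub>R F y)\<bar> \<le> integral\<^sup>L P (\<lambda>y. \<bar>indicator U y *\<^sub>R F y\<bar>)"
    by (rule integral_abs_bound)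
  also have "\<dots> \<le> integral\<^sup>L P (\<lambda>y. indicator U y * b)"
  proof (rule integral_mono_AE[OF integrable_abs[OF intF] Ui])
    show "AE y in P. \<bar>indicator U y *\<^sub>R F y\<bar> \<le> indicator U y * b"
      using bound unfolding P_def[symmetric] U_def[symmetric]
      by eventually_elim (auto simp: indicator_def F_def)
  qed
  also have "\<dots> = measure P U * b" using Us by simp
  finally have "\<bar>integral\<^sup>L P (\<lambda>y. indicator U y *\<^sub>R F y)\<bar> \<le> measure P U * b" .
  hence "1 / measure P U * \<bar>integral\<^sup>L P (\<lambda>y. indicator U y *\<^sub>R F y)\<bar> \<le> 1 / measure P U * (measure P U * b)"
    by (intro mult_left_mono) auto
  also have "\<dots> \<le> b" using b by (cases "measure P U = 0") auto
  finally show ?thesis unfolding eq by (simp add: abs_mult)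
qed

lemma finite_bounded_lattice: "finite {n \<in> carrier_vec d :: int vec set. \<forall>i<d. \<bar>n $ i\<bar> \<le> Z}"
proof (rule finite_subset)
  show "{n \<in> carrier_vec d. \<forall>i<d. \<bar>n $ i\<bar> \<le> Z} \<subseteq> vec d ` ({..<d} \<rightarrow>\<^sub>E {- Z..Z})"
  proof
    fix n :: "int vec" assume n: "n \<in> {n \<in> carrier_vec d. \<forall>i<d. \<bar>n $ i\<bar> \<le> Z}"
    have "n = vec d (restrict (\<lambda>i. n $ i) {..<d})" using n by (intro eq_vecI) auto
    moreover have "restrict (\<lambda>i. n $ i) {..<d} \<in> {..<d} \<rightarrow>\<^sub>E {- Z..Z}"
      using n by (auto simp: abs_le_iff minus_le_iff)
    ultimately show "n \<in> vec d ` ({..<d} \<rightarrow>\<^sub>E {- Z..Z})" by blast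
  qed
qed (simp add: finite_PiE)

lemma dilated_simplex_bounded:
  fixes M :: "int mat"
  assumes M: "M \<in> carrier_mat d d" and \<tau>: "\<tau> > 0"
    and W: "W \<in> carrier_mat d d" "W * real_mat M = 1\<^sub>m d" "real_mat M * W = 1\<^sub>m d"
  shows "\<exists>B. \<forall>p\<in>(\<lambda>p. \<tau> \<cdot>\<^sub>v p) ` lattice_simplex d M. \<forall>i<d. \<bar>p $ i\<bar> \<le> B"
proof -
  have Mr: "real_mat M \<in> carrier_mat d d" using M by simp
  have "\<bar>p $ i\<bar> \<le> (\<Sum>i<d. \<Sum>j<d. \<bar>real_mat M $$ (i, j)\<bar> * \<tau>)"
    if p: "p \<in> (\<lambda>p. \<tau> \<cdot>\<^sub>v p) ` lattice_simplex d M" and i: "i < d" for p i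
  proof -
    have pc: "p \<in> carrier_vec d" and S: "(1 / \<tau>) \<cdot>\<^sub>v (W *\<^sub>v p) \<in> std_simplex d" using p unfolding dilated_simplex_iff[OF M \<tau> W] by auto
    have Wc: "W *\<^sub>v p \<in> carrier_vec d" using W(1) pc by simp
    have Wb: "\<bar>(W *\<^sub>v p) $ j\<bar> \<le> \<tau>" if j: "j < d" for j
    proof -
      have nn: "0 \<le> ((1 / \<tau>) \<cdot>\<^sub>v (W *\<^sub>v p)) $ k" if "k < d" for k using S that by (simp add: std_simplex_def)
      have dim: "dim_vec ((1 / \<tau>) \<cdot>\<^sub>v (W *\<^sub>v p)) = d" using carrier_vecD[OF Wc] by (simp only: index_smult_vec(2))
      have "((1 / \<tau>) \<cdot>\<^sub>v (W *\<^sub>v p)) $ j \<le> (\<Sum>k<d. ((1 / \<tau>) \<cdot>\<^sub>v (W *\<^sub>v p)) $ k)"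
        using j nn by (intro member_le_sum) auto
      also have "\<dots> = vec_total ((1 / \<tau>) \<cdot>\<^sub>v (W *\<^sub>v p))" unfolding vec_total_def dim ..
      also have "\<dots> \<le> 1" using S unfolding std_simplex_def by blast
      finally have "((1 / \<tau>) \<cdot>\<^sub>v (W *\<^sub>v p)) $ j \<le> 1" .
      moreover have sc: "((1 / \<tau>) \<cdot>\<^sub>v (W *\<^sub>v p)) $ j = (W *\<^sub>v p) $ j / \<tau>"
        using carrier_vecD[OF Wc] j by (subst index_smult_vec(1)) simp_all
      ultimately have "(W *\<^sub>v p) $ j / \<tau> \<le> 1" by simp
      moreover have "0 \<le> (W *\<^sub>v p) $ j / \<tau>" using nn[OF j] unfolding sc .
      ultimately show ?thesis using \<tau> by (simp add: zero_le_divide_iff del: index_mult_mat_vec)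
    qed
    have "p = real_mat M *\<^sub>v (W *\<^sub>v p)" using assoc_mult_mat_vec[OF Mr W(1) pc] W(3) pc by simp
    hence "p $ i = (\<Sum>j<d. real_mat M $$ (i, j) * (W *\<^sub>v p) $ j)" using mult_mat_vec_index[OF Mr Wc i] by simp
    hence "\<bar>p $ i\<bar> \<le> (\<Sum>j<d. \<bar>real_mat M $$ (i, j) * (W *\<^sub>v p) $ j\<bar>)" by (simp only: sum_abs)
    also have "\<dots> \<le> (\<Sum>j<d. \<bar>real_mat M $$ (i, j)\<bar> * \<tau>)"
      by (intro sum_mono) (auto simp: abs_mult intro!: mult_left_mono Wb simp del: index_mult_mat_vec)
    also have "\<dots> \<le> (\<Sum>i<d. \<Sum>j<d. \<bar>real_mat M $$ (i, j)\<bar> * \<tau>)"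
      using i \<tau> by (intro member_le_sum[of i "{..<d}" "\<lambda>i. \<Sum>j<d. \<bar>real_mat M $$ (i, j)\<bar> * \<tau>"]) (auto intro!: sum_nonneg)
    finally show ?thesis .
  qed
  thus ?thesis by blast
qed

section \<open>The remainder\<close>

text \<open>
  The remainder is a finite linear combination of regularized functions, hence a limit of averages of
  the same combination of the functions themselves. At almost every point of a small ball this
  combination is the remainder of the unregularized expansion, which splits into one error for each
  class modulo \<open>M \<int>\<^sup>d\<close>; there are at most \<open>\<bar>det M\<bar>\<close> of them. The weights \<open>q\<close> are frozen at the center
  of the ball, and their variation is negligible in the limit.
\<close>

lemma remainder_bound:
  fixes M :: "int mat" and q :: "real vec \<Rightarrow> real"
  assumes M: "M \<in> carrier_mat d d" and dM: "det M \<noteq> 0" and \<tau>: "\<tau> > 0"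
    and q: "continuous_vec d q" and x: "x \<in> carrier_vec d" and b: "b \<ge> 0"
    and bound: "\<And>z. em_generic d z \<tau> \<Longrightarrow>
       \<bar>(\<Sum>p\<in>lattice_points d z \<tau>. dilated q \<tau> M p) - em_main d w (dilated q \<tau> M) z \<tau>\<bar> \<le> b"
  shows "\<bar>remainder d M w q \<tau> x\<bar> \<le> real_of_int \<bar>det M\<bar> * b"
proof -
  have Mr: "real_mat M \<in> carrier_mat d d" using M by simp
  have "det (real_mat M) \<noteq> 0" using dM by simp
  then obtain W where W: "W \<in> carrier_mat d d" "W * real_mat M = 1\<^sub>m d" "real_mat M * W = 1\<^sub>m d"
    using exists_inverse_mat[OF Mr] by blast
  obtain C where C: "lattice_transversal d M C" and cardC: "int (card C) \<le> \<bar>det M\<bar>"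
    using exists_lattice_transversal[OF M dM] by blast
  have Cc: "C \<subseteq> carrier_vec d" and fin: "finite C" using C unfolding lattice_transversal_def lattice_covering_def by blast+
  define g where "g = dilated q \<tau> M"
  define S where "S = (\<lambda>p. \<tau> \<cdot>\<^sub>v p) ` lattice_simplex d M"
  define raw where "raw = (\<lambda>V K u. \<Sum>\<^sub>\<infinity>n\<in>carrier_vec d. bernoulli_L d K (transpose_mat (real_mat M * D_V d V)) (u + real_vec n))"
  define xV where "xV = (\<lambda>V x. x - \<tau> \<cdot>\<^sub>v (real_mat M *\<^sub>v lambda_V d V))"
  define coef where "coef = (\<lambda>V I J. \<tau> powi (int d - int (msize d I) - int (msize d J)) * mu d V I J g)"
  define KK where "KK = (\<lambda>I J (k :: nat). J k + I k :: nat)"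
  define T where "T = (SIGMA V : {..<d} \<rightarrow>\<^sub>E {1, 2 :: nat}. SIGMA I : {..<d} \<rightarrow>\<^sub>E {0, 1 :: nat}. em_exponents d w I)"
  have finT: "finite T" unfolding T_def by (intro finite_SigmaI finite_PiE finite_em_exponents) auto
  have sumT: "(\<Sum>V\<in>{..<d} \<rightarrow>\<^sub>E {1, 2}. \<Sum>I\<in>{..<d} \<rightarrow>\<^sub>E {0, 1}. \<Sum>J\<in>em_exponents d w I. h V I J) = (\<Sum>(V, I, J)\<in>T. h V I J)" for h :: "_ \<Rightarrow> _ \<Rightarrow> _ \<Rightarrow> real"
  proof -
    let ?I = "{..<d} \<rightarrow>\<^sub>E {0, 1 :: nat}"
    have "(\<Sum>I\<in>?I. \<Sum>J\<in>em_exponents d w I. h V I J) = (\<Sum>(I, J)\<in>(SIGMA I : ?I. em_exponents d w I). h V I J)" for V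
      by (rule sum.Sigma) (simp_all add: finite_em_exponents finite_PiE)
    hence "(\<Sum>V\<in>{..<d} \<rightarrow>\<^sub>E {1, 2}. \<Sum>I\<in>?I. \<Sum>J\<in>em_exponents d w I. h V I J) =
        (\<Sum>V\<in>{..<d} \<rightarrow>\<^sub>E {1, 2}. \<Sum>a\<in>(SIGMA I : ?I. em_exponents d w I). h V (fst a) (snd a))"
      by (simp only: case_prod_unfold)
    also have "\<dots> = (\<Sum>(V, a)\<in>T. h V (fst a) (snd a))"
      unfolding T_def by (rule sum.Sigma) (auto intro!: finite_PiE finite_SigmaI finite_em_exponents)
    finally show ?thesis by (simp only: case_prod_unfold)
  qed
  have xVc: "xV V u \<in> carrier_vec d" if "u \<in> carrier_vec d" for V u
    using that Mr lambda_V_carrier[of d V] by (simp add: xV_def)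

  \<comment> \<open>For points at distance at most \<open>1\<close> from \<open>x\<close> in each coordinate, all translates in the simplex come
    from one finite set \<open>N\<close>.\<close>
  obtain B where B: "\<And>p i. p \<in> S \<Longrightarrow> i < d \<Longrightarrow> \<bar>p $ i\<bar> \<le> B"
    using dilated_simplex_bounded[OF M \<tau> W] unfolding S_def by blast
  define Z where "Z = \<lceil>B + 1 + (\<Sum>i<d. \<bar>x $ i\<bar>)\<rceil>"
  define N where "N = {n \<in> carrier_vec d :: int vec set. \<forall>i<d. \<bar>n $ i\<bar> \<le> Z}"
  have finN: "finite N" unfolding N_def by (rule finite_bounded_lattice)
  have Nc: "N \<subseteq> carrier_vec d" by (auto simp: N_def)
  have inN: "n \<in> N" if n: "n \<in> carrier_vec d" and x': "x' \<in> carrier_vec d" "\<And>i. i < d \<Longrightarrow> \<bar>x' $ i - x $ i\<bar> \<le> 1" and S': "x' + real_vec n \<in> S" for n x'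
  proof -
    have "\<bar>n $ i\<bar> \<le> Z" if i: "i < d" for i
    proof -
      have "\<bar>(x' + real_vec n) $ i\<bar> \<le> B" by (rule B[OF S' i])
      hence 1: "\<bar>x' $ i + of_int (n $ i)\<bar> \<le> B" using i n x' by simp
      have 2: "\<bar>x $ i\<bar> \<le> (\<Sum>i<d. \<bar>x $ i\<bar>)" using i by (intro member_le_sum) auto
      have "\<bar>real_of_int (n $ i)\<bar> \<le> B + 1 + (\<Sum>i<d. \<bar>x $ i\<bar>)"
        using 1 2 x'(2)[OF i] by linarith
      hence "real_of_int \<bar>n $ i\<bar> \<le> of_int Z" unfolding Z_def by (simp add: order_trans[OF _ le_of_int_ceiling])
      thus ?thesis by (simp only: of_int_le_iff)
    qed
    thus ?thesis using n by (simp add: N_def)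
  qed
  have small: "\<bar>(x - \<epsilon> \<cdot>\<^sub>v vec d y) $ i - x $ i\<bar> \<le> 1" if "0 < \<epsilon>" "\<epsilon> < 1" "y \<in> euclidean_unit_ball d" "i < d" for \<epsilon> y i
  proof -
    have "\<bar>\<epsilon> * y i\<bar> \<le> 1 * 1" unfolding abs_mult
      by (rule mult_mono) (use that euclidean_unit_ball_abs_le[OF that(3,4)] in auto)
    thus ?thesis using that(4) x by simp
  qed
  have shift: "(x + real_vec n) - \<epsilon> \<cdot>\<^sub>v vec d y = (x - \<epsilon> \<cdot>\<^sub>v vec d y) + real_vec n" if "n \<in> carrier_vec d" for n \<epsilon> y
    using x that by (intro eq_vecI) auto
  have shiftV: "xV V x - \<epsilon> \<cdot>\<^sub>v vec d y = xV V (x - \<epsilon> \<cdot>\<^sub>v vec d y)" for V \<epsilon> y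
    using x Mr lambda_V_carrier[of d V] unfolding xV_def by (intro eq_vecI) auto
  have ev01: "eventually (\<lambda>\<epsilon>::real. \<epsilon> \<in> {0<..<1}) (at_right 0)" by (rule eventually_at_right_real) simp

  \<comment> \<open>Outside \<open>N\<close> the small balls miss the simplex, hence the solid angle vanishes.\<close>
  have zero: "solid_angle d S (x + real_vec n) = 0" if n: "n \<in> carrier_vec d" "n \<notin> N" for n
  proof -
    have "eventually (\<lambda>\<epsilon>. ball_mean d (indicat_real S) (x + real_vec n) \<epsilon> = 0) (at_right 0)"
      using ev01
    proof eventually_elim
      case (elim \<epsilon>)
      have "(LINT y:euclidean_unit_ball d|lebesgue_prod d. indicat_real S ((x + real_vec n) - \<epsilon> \<cdot>\<^sub>v vec d y)) =
          (LINT y:euclidean_unit_ball d|lebesgue_prod d. 0)"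
      proof (rule set_lebesgue_integral_cong[OF euclidean_unit_ball_sets], intro allI impI)
        fix y assume y: "y \<in> euclidean_unit_ball d"
        have xy: "x - \<epsilon> \<cdot>\<^sub>v vec d y \<in> carrier_vec d" using x by simp
        have "(x + real_vec n) - \<epsilon> \<cdot>\<^sub>v vec d y \<notin> S"
        proof
          assume "(x + real_vec n) - \<epsilon> \<cdot>\<^sub>v vec d y \<in> S"
          hence "(x - \<epsilon> \<cdot>\<^sub>v vec d y) + real_vec n \<in> S" unfolding shift[OF n(1)] .
          moreover have "\<bar>(x - \<epsilon> \<cdot>\<^sub>v vec d y) $ i - x $ i\<bar> \<le> 1" if "i < d" for i
            using small[OF _ _ y that] elim by simp
          ultimately have "n \<in> N" using inN[OF n(1) xy] by blast
          thus False using n(2) by simp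
        qed
        thus "indicat_real S ((x + real_vec n) - \<epsilon> \<cdot>\<^sub>v vec d y) = 0" by simp
      qed
      thus ?case by (simp add: ball_mean_def)
    qed
    hence "(ball_mean d (indicat_real S) (x + real_vec n) \<longlongrightarrow> 0) (at_right 0)"
      by (rule tendsto_eventually)
    thus ?thesis unfolding solid_angle_def regularize_def by (intro tendsto_Lim) auto
  qed
  have ws: "weighted_sum d S q x = (\<Sum>n\<in>N. regularize d (indicat_real S) (x + real_vec n) * q (x + real_vec n))"
  proof -
    have "weighted_sum d S q x = (\<Sum>\<^sub>\<infinity>n\<in>N. solid_angle d S (x + real_vec n) * q (x + real_vec n))"
      unfolding weighted_sum_def by (rule infsum_cong_neutral) (use zero Nc in auto)
    also have "\<dots> = (\<Sum>n\<in>N. solid_angle d S (x + real_vec n) * q (x + real_vec n))" by (rule infsum_finite[OF finN])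
    finally show ?thesis unfolding solid_angle_def .
  qed

  \<comment> \<open>Both sides as one combination, indexed by the disjoint sum of \<open>N\<close> and the index set of the main term.\<close>
  define f where "f = case_sum (\<lambda>n :: int vec. indicat_real S) (\<lambda>(V, I, J). raw V (KK I J))"
  define X where "X = case_sum (\<lambda>n. x + real_vec n) (\<lambda>(V, I :: nat \<Rightarrow> nat, J :: nat \<Rightarrow> nat). xV V x)"
  define c where "c = case_sum (\<lambda>n. q (x + real_vec n)) (\<lambda>(V, I, J). - (real_of_int \<bar>det M\<bar> * coef V I J))"
  have fA: "radially_regular d (f a)" if "a \<in> N <+> T" for a
    using that radially_regular_simplex[OF M \<tau> W] radially_regular_bernoulli_sum[OF M dM W(1,2) C]
    by (auto simp: f_def S_def raw_def split: sum.splits prod.splits)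
  have XA: "X a \<in> carrier_vec d" if "a \<in> N <+> T" for a
    using that x Nc xVc[OF x] by (auto simp: X_def split: sum.splits prod.splits)
  have sumA: "(\<Sum>a\<in>N <+> T. c a * h (f a) (X a)) =
     (\<Sum>n\<in>N. q (x + real_vec n) * h (indicat_real S) (x + real_vec n)) -
     real_of_int \<bar>det M\<bar> * (\<Sum>(V, I, J)\<in>T. coef V I J * h (raw V (KK I J)) (xV V x))" for h :: "(real vec \<Rightarrow> real) \<Rightarrow> real vec \<Rightarrow> real"
    unfolding sum.Plus[OF finN finT]
    by (simp add: c_def f_def X_def case_prod_unfold sum_negf sum_distrib_left mult.assoc)
  have R: "remainder d M w q \<tau> x = (\<Sum>a\<in>N <+> T. c a * regularize d (f a) (X a))"
  proof -
    have "main_term d M w q \<tau> x = real_of_int \<bar>det M\<bar> * (\<Sum>(V, I, J)\<in>T. coef V I J * regularize d (raw V (KK I J)) (xV V x))"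
      unfolding main_term_def bernoulli_periodic_def sumT[symmetric]
      by (simp add: coef_def raw_def xV_def KK_def g_def em_exponents_def)
    thus ?thesis unfolding remainder_def S_def[symmetric] ws sumA by (simp add: mult.commute)
  qed
  have lim: "((\<lambda>\<epsilon>. \<Sum>a\<in>N <+> T. c a * ball_mean d (f a) (X a) \<epsilon>) \<longlongrightarrow> remainder d M w q \<tau> x) (at_right 0)"
    unfolding R by (intro tendsto_sum tendsto_mult tendsto_const ball_mean_tendsto_regularize fA XA)

  \<comment> \<open>At a generic point each class modulo the sublattice contributes one error of size at most \<open>b\<close>.\<close>
  have generic: "\<bar>(\<Sum>n\<in>N. q (u + real_vec n) * indicat_real S (u + real_vec n)) -
      real_of_int \<bar>det M\<bar> * (\<Sum>(V, I, J)\<in>T. coef V I J * raw V (KK I J) (xV V u))\<bar> \<le> real (card C) * b"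
    if u: "u \<in> carrier_vec d" and near: "\<And>i. i < d \<Longrightarrow> \<bar>u $ i - x $ i\<bar> \<le> 1"
      and gen: "\<forall>r\<in>C. em_generic d (\<lambda>i. (W *\<^sub>v (u + real_vec r)) $ i) \<tau>" for u
  proof -
    define z where "z = (\<lambda>r i. (W *\<^sub>v (u + real_vec r)) $ i)"
    have 1: "(\<Sum>n\<in>N. q (u + real_vec n) * indicat_real S (u + real_vec n)) = (\<Sum>r\<in>C. \<Sum>p\<in>lattice_points d (z r) \<tau>. g p)"
    proof -
      have "(\<Sum>n\<in>N. indicat_real S (u + real_vec n) * q (u + real_vec n)) = (\<Sum>r\<in>C. \<Sum>p\<in>lattice_points d (z r) \<tau>. g p)"
        unfolding S_def g_def z_def
        by (rule weighted_lattice_sum[OF M \<tau> W C u finN Nc]) (use inN[OF _ u near] in \<open>auto simp: S_def\<close>)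
      thus ?thesis by (simp add: mult.commute)
    qed
    have 2: "raw V K (xV V u) = 1 / real_of_int \<bar>det M\<bar> * (\<Sum>r\<in>C. \<Prod>k<d. bernoulli_fun (K k) (em_coord V (z r) \<tau> k))" for V K
      unfolding raw_def xV_def z_def by (rule bernoulli_lattice_sum[OF M dM W(1,2) C u])
    have dpos: "real_of_int \<bar>det M\<bar> \<noteq> 0" using dM by simp
    have "real_of_int \<bar>det M\<bar> * (\<Sum>(V, I, J)\<in>T. coef V I J * raw V (KK I J) (xV V u)) =
        (\<Sum>(V, I, J)\<in>T. \<Sum>r\<in>C. em_term d g (z r) \<tau> V I J)"
      unfolding sum_distrib_left
    proof (rule sum.cong[OF refl])
      fix a assume "a \<in> T"
      obtain V I J where a: "a = (V, I, J)" by (cases a) auto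
      have "real_of_int \<bar>det M\<bar> * (coef V I J * raw V (KK I J) (xV V u)) = coef V I J * (\<Sum>r\<in>C. \<Prod>k<d. bernoulli_fun (KK I J k) (em_coord V (z r) \<tau> k))"
        unfolding 2 using dpos by simp
      also have "\<dots> = (\<Sum>r\<in>C. em_term d g (z r) \<tau> V I J)"
        by (simp add: em_term_def coef_def KK_def sum_distrib_left mult.assoc)
      finally show "real_of_int \<bar>det M\<bar> * (case a of (V, I, J) \<Rightarrow> coef V I J * raw V (KK I J) (xV V u)) = (case a of (V, I, J) \<Rightarrow> \<Sum>r\<in>C. em_term d g (z r) \<tau> V I J)"
        by (simp add: a)
    qed
    also have "\<dots> = (\<Sum>r\<in>C. \<Sum>(V, I, J)\<in>T. em_term d g (z r) \<tau> V I J)"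
      unfolding case_prod_unfold by (rule sum.swap)
    also have "\<dots> = (\<Sum>r\<in>C. em_main d w g (z r) \<tau>)"
      unfolding em_main_def sumT ..
    finally have "(\<Sum>n\<in>N. q (u + real_vec n) * indicat_real S (u + real_vec n)) -
      real_of_int \<bar>det M\<bar> * (\<Sum>(V, I, J)\<in>T. coef V I J * raw V (KK I J) (xV V u)) =
      (\<Sum>r\<in>C. (\<Sum>p\<in>lattice_points d (z r) \<tau>. g p) - em_main d w g (z r) \<tau>)"
      unfolding 1 by (simp only: sum_subtractf)
    also have "\<bar>\<dots>\<bar> \<le> (\<Sum>r\<in>C. b)"
    proof (rule order_trans[OF sum_abs sum_mono])
      fix r assume "r \<in> C"
      hence "em_generic d (z r) \<tau>" using gen by (simp add: z_def)
      thus "\<bar>(\<Sum>p\<in>lattice_points d (z r) \<tau>. g p) - em_main d w g (z r) \<tau>\<bar> \<le> b" unfolding g_def by (rule bound)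
    qed
    finally show ?thesis by simp
  qed

  \<comment> \<open>The error \<open>e\<close> pays for freezing the weights \<open>q\<close> at the centers.\<close>
  have "\<bar>remainder d M w q \<tau> x\<bar> \<le> real (card C) * b + e" if e: "e > 0" for e
  proof -
    define e' where "e' = e / (real (card N) + 1)"
    have e': "e' > 0" using e by (simp add: e'_def)
    have "\<forall>\<^sub>F \<epsilon> in at_right 0. \<forall>n\<in>N. \<forall>y\<in>euclidean_unit_ball d. \<bar>q (x + real_vec n - \<epsilon> \<cdot>\<^sub>v vec d y) - q (x + real_vec n)\<bar> < e'"
      using Nc x by (intro eventually_ball_finite finN ballI uniform_on_small_balls q e') auto
    with ev01 have "\<forall>\<^sub>F \<epsilon> in at_right 0. \<bar>\<Sum>a\<in>N <+> T. c a * ball_mean d (f a) (X a) \<epsilon>\<bar> \<le> real (card C) * b + e"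
    proof eventually_elim
      case (elim \<epsilon>)
      note unif = elim(2)
      have eps: "0 < \<epsilon>" "\<epsilon> < 1" using elim(1) by auto
      show ?case
      proof (rule ball_mean_combination_bound[OF _ fA XA])
        show "finite (N <+> T)" using finN finT by simp
        show "0 \<le> real (card C) * b + e" using b e by simp
        have "AE y in lebesgue_prod d. \<forall>r\<in>C. em_generic d (\<lambda>i. (W *\<^sub>v ((x - \<epsilon> \<cdot>\<^sub>v vec d y) + real_vec r)) $ i) \<tau>"
          by (rule AE_em_generic[OF M W(1,2) fin Cc x]) (use eps in simp)
        thus "AE y in lebesgue_prod d. y \<in> euclidean_unit_ball d \<longrightarrow> \<bar>\<Sum>a\<in>N <+> T. c a * f a (X a - \<epsilon> \<cdot>\<^sub>v vec d y)\<bar> \<le> real (card C) * b + e"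
        proof eventually_elim
          case (elim y)
          show ?case
          proof
            assume y: "y \<in> euclidean_unit_ball d"
            define u where "u = x - \<epsilon> \<cdot>\<^sub>v vec d y"
            have u: "u \<in> carrier_vec d" using x by (simp add: u_def)
            let ?Q = "\<lambda>v. \<Sum>n\<in>N. v n * indicat_real S (u + real_vec n)"
            let ?T = "real_of_int \<bar>det M\<bar> * (\<Sum>(V, I, J)\<in>T. coef V I J * raw V (KK I J) (xV V u))"
            have shN: "(\<Sum>n\<in>N. q (x + real_vec n) * indicat_real S (x + real_vec n - \<epsilon> \<cdot>\<^sub>v vec d y)) = ?Q (\<lambda>n. q (x + real_vec n))"
              by (rule sum.cong) (use shift Nc in \<open>auto simp: u_def\<close>)
            have "(\<Sum>a\<in>N <+> T. c a * f a (X a - \<epsilon> \<cdot>\<^sub>v vec d y)) = ?Q (\<lambda>n. q (x + real_vec n)) - ?T"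
              using sumA[of "\<lambda>f X. f (X - \<epsilon> \<cdot>\<^sub>v vec d y)"] unfolding shN shiftV u_def[symmetric] .
            also have "\<dots> = (?Q (\<lambda>n. q (u + real_vec n)) - ?T) + ?Q (\<lambda>n. q (x + real_vec n) - q (u + real_vec n))"
              by (simp only: left_diff_distrib sum_subtractf)
            finally have split: "(\<Sum>a\<in>N <+> T. c a * f a (X a - \<epsilon> \<cdot>\<^sub>v vec d y)) =
                (?Q (\<lambda>n. q (u + real_vec n)) - ?T) + ?Q (\<lambda>n. q (x + real_vec n) - q (u + real_vec n))" .
            have "\<bar>\<Sum>a\<in>N <+> T. c a * f a (X a - \<epsilon> \<cdot>\<^sub>v vec d y)\<bar> \<le>
                \<bar>?Q (\<lambda>n. q (u + real_vec n)) - ?T\<bar> + \<bar>?Q (\<lambda>n. q (x + real_vec n) - q (u + real_vec n))\<bar>"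
              unfolding split by (rule abs_triangle_ineq)
            also have "\<dots> \<le> real (card C) * b + e"
            proof (rule add_mono)
              show "\<bar>?Q (\<lambda>n. q (u + real_vec n)) - ?T\<bar> \<le> real (card C) * b"
              proof (rule generic[OF u])
                show "\<bar>u $ i - x $ i\<bar> \<le> 1" if "i < d" for i
                  unfolding u_def by (rule small[OF eps y that])
                show "\<forall>r\<in>C. em_generic d (\<lambda>i. (W *\<^sub>v (u + real_vec r)) $ i) \<tau>"
                  using elim unfolding u_def .
              qed
              have "\<bar>?Q (\<lambda>n. q (x + real_vec n) - q (u + real_vec n))\<bar> \<le> (\<Sum>n\<in>N. e')"
              proof (rule order_trans[OF sum_abs sum_mono])
                fix n assume n: "n \<in> N"
                have "x + real_vec n - \<epsilon> \<cdot>\<^sub>v vec d y = u + real_vec n" unfolding u_def using shift n Nc by blast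
                moreover have "\<bar>q (x + real_vec n - \<epsilon> \<cdot>\<^sub>v vec d y) - q (x + real_vec n)\<bar> < e'" using unif n y by blast
                ultimately have "\<bar>q (u + real_vec n) - q (x + real_vec n)\<bar> < e'" by simp
                hence "\<bar>q (x + real_vec n) - q (u + real_vec n)\<bar> \<le> e'" by linarith
                hence "\<bar>q (x + real_vec n) - q (u + real_vec n)\<bar> * indicat_real S (u + real_vec n) \<le> e' * 1"
                  using e' by (intro mult_mono) auto
                thus "\<bar>(q (x + real_vec n) - q (u + real_vec n)) * indicat_real S (u + real_vec n)\<bar> \<le> e'"
                  by (simp add: abs_mult)
              qed
              also have "\<dots> = e * (real (card N) / (real (card N) + 1))" by (simp add: e'_def)
              also have "\<dots> \<le> e * 1" using e by (intro mult_left_mono) auto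
              finally show "\<bar>?Q (\<lambda>n. q (x + real_vec n) - q (u + real_vec n))\<bar> \<le> e" by simp
            qed
            finally show "\<bar>\<Sum>a\<in>N <+> T. c a * f a (X a - \<epsilon> \<cdot>\<^sub>v vec d y)\<bar> \<le> real (card C) * b + e" .
          qed
        qed
      qed
    qed
    thus ?thesis by (rule tendsto_upperbound[OF tendsto_rabs[OF lim]]) simp
  qed
  hence "\<bar>remainder d M w q \<tau> x\<bar> \<le> real (card C) * b" by (rule field_le_epsilon)
  also have "real (card C) \<le> real_of_int \<bar>det M\<bar>"
    using cardC by linarith
  hence "real (card C) * b \<le> real_of_int \<bar>det M\<bar> * b" using b by (rule mult_right_mono)
  finally show ?thesis .
qed

text \<open>
  One term of the exponential series of \<open>m ln \<theta>\<close> already bounds the power of \<open>m\<close>.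
\<close>

lemma power_absorbs_polynomial:
  fixes \<theta> :: real
  assumes "\<theta> > 1"
  shows "\<exists>D>0. \<forall>m::nat. real m ^ d \<le> D * \<theta> ^ m"
proof -
  define e where "e = ln \<theta>"
  have e: "e > 0" using assms by (simp add: e_def)
  have "real m ^ d \<le> (fact d / e ^ d) * \<theta> ^ m" for m
  proof -
    have s: "(\<lambda>k. (e * real m) ^ k /\<^sub>R fact k) sums exp (e * real m)" by (rule exp_converges)
    have "sum (\<lambda>k. (e * real m) ^ k /\<^sub>R fact k) {d} \<le> exp (e * real m)"
      using s e sum_le_suminf[of "\<lambda>k. (e * real m) ^ k /\<^sub>R fact k" "{d}"] by (auto simp: sums_iff)
    hence "(e * real m) ^ d / fact d \<le> exp (e * real m)" by (simp add: divide_inverse mult.commute)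
    also have "exp (e * real m) = \<theta> ^ m" using assms by (simp add: e_def exp_of_nat2_mult)
    finally show ?thesis using e by (simp add: power_mult_distrib field_simps)
  qed
  moreover have "fact d / e ^ d > 0" using e by simp
  ultimately show ?thesis by blast
qed

theorem theorem7:
  fixes d :: nat and \<delta> \<tau>\<^sub>0 :: real
  assumes "d \<ge> 1" and "\<delta> > 0" and "\<tau>\<^sub>0 > 0"
  shows "\<exists>c :: real. \<forall>M \<in> carrier_mat d d. \<forall>w :: nat. \<forall>q :: real vec \<Rightarrow> real.
    det M \<noteq> (0 :: int) \<longrightarrow> C_k_vec d (w + 1) q \<longrightarrow>
    (\<forall>\<tau> > \<tau>\<^sub>0. \<forall>x \<in> carrier_vec d.
      \<bar>remainder d M w q \<tau> x\<bar> \<le>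
        c * real_of_int \<bar>det M\<bar> * \<tau> powi (int d - int w - 1)
        * (2 powi (int d - 2) / pi + \<delta>) ^ (w + 1)
        * (SUP \<alpha> \<in> {\<alpha> \<in> multi_indices d.
                      int w - int d + 2 \<le> int (msize d \<alpha>) \<and> msize d \<alpha> \<le> w + 1}.
             SUP y \<in> std_simplex d. \<bar>mixed_partial d \<alpha> (dilated q \<tau> M) y\<bar>))"
proof -
  define a where "a = 2 powi (int d - 2) / pi"
  have a0: "a > 0" by (simp add: a_def)
  \<comment> \<open>Half of \<open>\<delta>\<close> enlarges the base of the powers beyond \<open>1 / (2 \<pi>)\<close>; the other half absorbs the power
    of \<open>w + 1\<close>.\<close>
  define \<rho> where "\<rho> = (a + \<delta> / 2) / (2 ^ d / 2)"
  have a2: "a = 2 ^ d / 2 * (1 / (2 * pi))"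
    unfolding a_def by (subst power_int_diff) auto
  have \<rho>: "\<rho> > 1 / (2 * pi)"
  proof -
    have "\<rho> = a / (2 ^ d / 2) + \<delta> / 2 / (2 ^ d / 2)" unfolding \<rho>_def by (rule add_divide_distrib)
    moreover have "a / (2 ^ d / 2) = 1 / (2 * pi)" unfolding a2 by simp
    moreover have "\<delta> / 2 / (2 ^ d / 2) > 0" using assms by simp
    ultimately show ?thesis by linarith
  qed
  have base: "2 ^ d / 2 * \<rho> = a + \<delta> / 2" unfolding \<rho>_def by simp
  obtain C where C: "C \<ge> 0" and em: "\<And>w g x \<tau> K. C_k_vec d (Suc w) g \<Longrightarrow> \<tau> > \<tau>\<^sub>0 \<Longrightarrow> em_generic d x \<tau> \<Longrightarrow> K \<ge> 0 \<Longrightarrow>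
     (\<And>ks y. set ks \<subseteq> {..<d} \<Longrightarrow> length ks \<le> w + 1 \<Longrightarrow> w + 2 \<le> length ks + d \<Longrightarrow> y \<in> std_simplex d \<Longrightarrow> \<bar>word_partial ks g y\<bar> \<le> K) \<Longrightarrow>
     \<bar>(\<Sum>p\<in>lattice_points d x \<tau>. g p) - em_main d w g x \<tau>\<bar> \<le>
       C * real (w + 1) ^ d * \<tau> powi (int d - int w - 1) * (2 ^ d / 2 * \<rho>) ^ (w + 1) * K"
    using em_bound[OF assms(3) \<rho>, of d] by blast
  define \<theta> where "\<theta> = (a + \<delta>) / (a + \<delta> / 2)"
  have \<theta>: "\<theta> > 1" using a0 assms by (simp add: \<theta>_def)
  obtain D where D: "D > 0" "\<And>m::nat. real m ^ d \<le> D * \<theta> ^ m" using power_absorbs_polynomial[OF \<theta>] by blast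
  have "\<bar>remainder d M w q \<tau> x\<bar> \<le> (C * D) * real_of_int \<bar>det M\<bar> * \<tau> powi (int d - int w - 1) * (a + \<delta>) ^ (w + 1)
        * (SUP \<alpha> \<in> {\<alpha> \<in> multi_indices d. int w - int d + 2 \<le> int (msize d \<alpha>) \<and> msize d \<alpha> \<le> w + 1}.
             SUP y \<in> std_simplex d. \<bar>mixed_partial d \<alpha> (dilated q \<tau> M) y\<bar>)"
    if M: "M \<in> carrier_mat d d" and dM: "det M \<noteq> (0 :: int)" and q: "C_k_vec d (w + 1) q" and \<tau>: "\<tau> > \<tau>\<^sub>0" and x: "x \<in> carrier_vec d"
    for M w q \<tau> x
  proof -
    have t0: "\<tau> > 0" using \<tau> assms by simp
    define g where "g = dilated q \<tau> M"
    have g: "C_k_vec d (Suc w) g" unfolding g_def using C_k_vec_dilated[OF M q] by (simp del: C_k_vec.simps)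
    define A where "A = {\<alpha> \<in> multi_indices d. int w - int d + 2 \<le> int (msize d \<alpha>) \<and> msize d \<alpha> \<le> w + 1}"
    define s where "s = (\<lambda>\<alpha>. SUP y \<in> std_simplex d. \<bar>mixed_partial d \<alpha> g y\<bar>)"
    have finA: "finite A"
    proof (rule finite_subset)
      show "A \<subseteq> {..<d} \<rightarrow>\<^sub>E {..w + 1}"
      proof
        fix \<alpha> assume \<alpha>: "\<alpha> \<in> A"
        have "\<alpha> k \<le> w + 1" if "k < d" for k
        proof -
          have "\<alpha> k \<le> msize d \<alpha>" unfolding msize_def using that by (intro member_le_sum) auto
          thus ?thesis using \<alpha> by (simp add: A_def)
        qed
        thus "\<alpha> \<in> {..<d} \<rightarrow>\<^sub>E {..w + 1}" using \<alpha> by (simp add: A_def PiE_iff)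
      qed
    qed (simp add: finite_PiE)
    have zeroS: "0\<^sub>v d \<in> std_simplex d" by (simp add: std_simplex_def vec_total_def)
    \<comment> \<open>The suprema are taken over bounded sets, so they really are upper bounds.\<close>
    have s_upper: "\<bar>mixed_partial d \<alpha> g y\<bar> \<le> s \<alpha>" if \<alpha>: "\<alpha> \<in> A" and y: "y \<in> std_simplex d" for \<alpha> y
    proof -
      have "C_k_vec d 0 (word_partial (index_word d \<alpha>) g)"
        by (rule C_k_vec_word_partial[OF _ set_index_word])
           (rule C_k_vec_mono[OF g], use \<alpha> in \<open>simp add: length_index_word A_def\<close>)
      hence "continuous_vec d (mixed_partial d \<alpha> g)" unfolding mixed_partial_eq by simp
      from continuous_vec_bounded_on_simplex[OF this] show ?thesis
        unfolding s_def by (rule cSUP_upper[OF y])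
    qed
    define K where "K = (SUP \<alpha>\<in>A. s \<alpha>)"
    have K_upper: "s \<alpha> \<le> K" if "\<alpha> \<in> A" for \<alpha>
      unfolding K_def using that finA by (intro cSUP_upper) auto
    have K_word: "\<bar>word_partial ks g y\<bar> \<le> K"
      if ks: "set ks \<subseteq> {..<d}" "length ks \<le> w + 1" "w + 2 \<le> length ks + d" and y: "y \<in> std_simplex d" for ks y
    proof -
      have "C_k_vec d (length ks) g" by (rule C_k_vec_mono[OF g]) (use ks in simp)
      from word_partial_as_mixed[OF this ks(1)] obtain \<alpha> where \<alpha>: "\<alpha> \<in> multi_indices d" "msize d \<alpha> = length ks"
        "\<And>x. x \<in> carrier_vec d \<Longrightarrow> word_partial ks g x = mixed_partial d \<alpha> g x" by blast
      have \<alpha>A: "\<alpha> \<in> A" using \<alpha>(1,2) ks by (auto simp: A_def)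
      show ?thesis
        using order_trans[OF s_upper[OF \<alpha>A y] K_upper[OF \<alpha>A]] unfolding \<alpha>(3)[OF std_simplex_carrier[OF y]] .
    qed
    \<comment> \<open>The derivative of order \<open>w + 1\<close> in the first direction is among those that \<open>K\<close> bounds.\<close>
    have K0: "K \<ge> 0"
    proof -
      have "\<bar>word_partial (replicate (w + 1) 0) g (0\<^sub>v d)\<bar> \<le> K"
        by (rule K_word[OF _ _ _ zeroS]) (use assms(1) in auto)
      thus ?thesis by linarith
    qed
    define b where "b = C * real (w + 1) ^ d * \<tau> powi (int d - int w - 1) * (a + \<delta> / 2) ^ (w + 1) * K"
    have b0: "b \<ge> 0" using C t0 a0 assms K0 by (simp add: b_def)
    have "\<bar>remainder d M w q \<tau> x\<bar> \<le> real_of_int \<bar>det M\<bar> * b"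
    proof (rule remainder_bound[OF M dM t0 C_k_vec_continuous[OF q] x b0])
      fix z assume "em_generic d z \<tau>"
      from em[OF g \<tau> this K0 K_word]
      show "\<bar>(\<Sum>p\<in>lattice_points d z \<tau>. dilated q \<tau> M p) - em_main d w (dilated q \<tau> M) z \<tau>\<bar> \<le> b"
        unfolding b_def base g_def .
    qed
    also have "b \<le> C * (D * \<theta> ^ (w + 1)) * \<tau> powi (int d - int w - 1) * (a + \<delta> / 2) ^ (w + 1) * K"
      unfolding b_def using C t0 a0 assms K0 D(2)[of "w + 1"] by (intro mult_right_mono mult_left_mono) auto
    also have "\<dots> = C * D * \<tau> powi (int d - int w - 1) * (\<theta> * (a + \<delta> / 2)) ^ (w + 1) * K"
      by (simp only: power_mult_distrib mult_ac)
    also have "\<theta> * (a + \<delta> / 2) = a + \<delta>" using a0 assms by (simp add: \<theta>_def)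
    finally have "\<bar>remainder d M w q \<tau> x\<bar> \<le> real_of_int \<bar>det M\<bar> * (C * D * \<tau> powi (int d - int w - 1) * (a + \<delta>) ^ (w + 1) * K)"
      by (simp add: mult_left_mono)
    thus ?thesis unfolding K_def s_def A_def g_def by (simp only: mult_ac)
  qed
  thus ?thesis unfolding a_def by blast
qed

end
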